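(* Let $n \geq 2$ be an integer and let $G \subseteq S_n$ be a transitive subgroup. Assume that for some constant $e > \frac{1}{n^2-n}$ the bound $N_n(X;G) \ll X^e$ holds for every sufficiently large $X$, with an implied constant depending at most on $G$ and $e$ (that is, there exist constants $C, X_0 > 0$, depending at most on $G$ and $e$, such that $N_n(X;G) \leq C X^e$ for all $X \geq X_0$). Then there is a constant $c > 0$, depending at most on $n$, $G$ and $e$, such that for all real $B \geq 2$, $$P_n(B;G) \leq c\, B^{e(2n-2)+1} (\log B)^{n-1}.$$ Moreover, if the group $G$ is primitive, then this may be improved: there is a constant $c' > 0$, depending at most on $n$, $G$ and $e$, such that for all real $B \geq 2$, $$P_n(B;G) \leq c'\, B^{e(2n-2)+1-\frac{2}{n}} (\log B)^{n-1}.$$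
   Context: For a monic polynomial $f \in \mathbb{Z}[x]$, the height $\mathrm{ht}(f)$ is the maximum of the absolute values of its coefficients. For real $B \geq 1$, $$P_n(B;G) := \#\{ f \in \mathbb{Z}[x] \text{ monic of degree } n : \mathrm{ht}(f) \leq B,\ \mathrm{Gal}(f) \simeq G\},$$ where $\mathrm{Gal}(f)$ is the Galois group over $\mathbb{Q}$ of the splitting field of $f$, regarded as a permutation group on the $n$ roots of $f$ (so $f$ has $n$ distinct roots), and $\simeq$ means isomorphism of permutation groups of degree $n$, i.e. conjugacy in $S_n$. Since $G$ is transitive, every such $f$ is irreducible. For real $X$, let $\mathcal{F}_n(X;G)$ be the set of number fields $$\mathcal{F}_n(X;G) := \{ K/\mathbb{Q} : [K:\mathbb{Q}] = n,\ \mathrm{Gal}(\widetilde{K}/\mathbb{Q}) \simeq G,\ |\mathrm{Disc}(K)| \leq X\},$$ taken up to isomorphism, where $\widetilde{K}$ is the normal closure of $K/\mathbb{Q}$, $\mathrm{Disc}(K)$ is the absolute discriminant of $K$, and $\mathrm{Gal}(\widetilde{K}/\mathbb{Q})$ is regarded as a permutation group on the $n$ embeddings $K \hookrightarrow \widetilde{K}$, with $\simeq$ again meaning isomorphism of permutation groups of degree $n$. Set $N_n(X;G) := \#\mathcal{F}_n(X;G)$. A permutation group $G$ on $n$ elements is primitive if it preserves no nontrivial partition of the elements. *)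

theory Defs
  imports
    "HOL-Computational_Algebra.Computational_Algebra"
    "HOL-Algebra.Algebra"
    "HOL-Algebra.Algebraic_Closure_Type"
    "HOL-Library.Extended_Real"
    "Jordan_Normal_Form.Determinant"
begin

definition transitive_perm_group :: "nat \<Rightarrow> (nat \<Rightarrow> nat) set \<Rightarrow> bool" where
  "transitive_perm_group n G \<longleftrightarrow> (\<forall>i\<in>{1..n}. \<forall>j\<in>{1..n}. \<exists>g\<in>G. g i = j)"

definition primitive_perm_group :: "nat \<Rightarrow> (nat \<Rightarrow> nat) set \<Rightarrow> bool" where
  "primitive_perm_group n G \<longleftrightarrow>
     (\<forall>P. partition_on {1..n} P \<and> (\<forall>g\<in>G. \<forall>b\<in>P. g ` b \<in> P) \<longrightarrow>
        P = {{1..n}} \<or> P = (\<lambda>i. {i}) ` {1..n})"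

text \<open>
  The elements of \<open>\<Gamma>\<close> act on the set \<open>\<Omega>\<close> through \<open>act\<close>. Transporting the permutations of \<open>\<Omega>\<close>
  induced by \<open>\<Gamma>\<close> to \<open>{1..n}\<close> along a labelling \<open>\<beta>\<close> of \<open>\<Omega>\<close> gives a subgroup of the symmetric group;
  changing \<open>\<beta>\<close> conjugates it. The predicate says that \<open>G\<close> is one of these conjugate subgroups.
  In particular \<open>\<Omega>\<close> has exactly \<open>n\<close> elements.
\<close>
definition acts_as :: "nat \<Rightarrow> 'g set \<Rightarrow> ('g \<Rightarrow> 'x \<Rightarrow> 'x) \<Rightarrow> 'x set \<Rightarrow> (nat \<Rightarrow> nat) set \<Rightarrow> bool" where
  "acts_as n \<Gamma> act \<Omega> G \<longleftrightarrow>
     (\<exists>\<beta>. bij_betw \<beta> {1..n} \<Omega> \<and>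
        G = {p. p permutes {1..n} \<and> (\<exists>\<gamma>\<in>\<Gamma>. \<forall>i\<in>{1..n}. act \<gamma> (\<beta> i) = \<beta> (p i))})"

abbreviation complex_ring :: "complex ring" where
  "complex_ring \<equiv> ring_of_type_algebra"

abbreviation subring_of :: "complex set \<Rightarrow> complex ring" where
  "subring_of K \<equiv> complex_ring \<lparr>carrier := K\<rparr>"

definition embeddings :: "complex set \<Rightarrow> complex set \<Rightarrow> (complex \<Rightarrow> complex) set" where
  "embeddings K L = Ring.ring_hom (subring_of K) (subring_of L) \<inter> extensional K"

definition galois_group :: "complex set \<Rightarrow> (complex \<Rightarrow> complex) set" where
  "galois_group L =
     {\<sigma> \<in> ring_iso (subring_of L) (subring_of L) \<inter> extensional L. \<forall>q\<in>\<rat>. \<sigma> q = q}"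

definition poly_height :: "int poly \<Rightarrow> int" where
  "poly_height f = Max ((\<lambda>i. \<bar>poly.coeff f i\<bar>) ` {..Polynomial.degree f})"

definition complex_roots :: "int poly \<Rightarrow> complex set" where
  "complex_roots f = {z. poly (map_poly of_int f) z = 0}"

definition splitting_field :: "int poly \<Rightarrow> complex set" where
  "splitting_field f = generate_field complex_ring (complex_roots f)"

definition poly_has_galois_group :: "nat \<Rightarrow> int poly \<Rightarrow> (nat \<Rightarrow> nat) set \<Rightarrow> bool" where
  "poly_has_galois_group n f G \<longleftrightarrow>
     acts_as n (galois_group (splitting_field f)) (\<lambda>\<sigma> z. \<sigma> z) (complex_roots f) G"

definition galois_polys :: "nat \<Rightarrow> real \<Rightarrow> (nat \<Rightarrow> nat) set \<Rightarrow> int poly set" where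
  "galois_polys n B G =
     {f. Polynomial.degree f = n \<and> lead_coeff f = 1 \<and> real_of_int (poly_height f) \<le> B \<and>
         poly_has_galois_group n f G}"

definition P_count :: "nat \<Rightarrow> real \<Rightarrow> (nat \<Rightarrow> nat) set \<Rightarrow> nat" where
  "P_count n B G = card (galois_polys n B G)"

text \<open>The set is finite, so \<open>card\<close> in \<open>P_count\<close> is never the default value 0 of an infinite set.\<close>

lemma finite_galois_polys: "finite (galois_polys n B G)"
proof (rule finite_subset)
  let ?L = "{xs. set xs \<subseteq> {-\<lfloor>B\<rfloor>..\<lfloor>B\<rfloor>} \<and> length xs = Suc n}"
  show "galois_polys n B G \<subseteq> Poly ` ?L"
  proof
    fix f assume f: "f \<in> galois_polys n B G"
    hence f0: "f \<noteq> 0" by (auto simp: galois_polys_def)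
    have "\<bar>poly.coeff f i\<bar> \<le> \<lfloor>B\<rfloor>" if "i \<le> n" for i
    proof -
      have *: "\<bar>poly.coeff f i\<bar> \<le> poly_height f"
        using f that by (auto simp: poly_height_def galois_polys_def intro!: Max_ge)
      have "poly_height f \<le> \<lfloor>B\<rfloor>"
        using f by (simp add: galois_polys_def le_floor_iff)
      with * show ?thesis by linarith
    qed
    hence "\<forall>i\<le>n. poly.coeff f i \<in> {-\<lfloor>B\<rfloor>..\<lfloor>B\<rfloor>}"
      unfolding atLeastAtMost_iff abs_le_iff by (metis minus_le_iff)
    moreover have "coeffs f = map (poly.coeff f) [0..<Suc n]"
      using f f0 unfolding coeffs_def galois_polys_def by simp
    ultimately have "set (coeffs f) \<subseteq> {-\<lfloor>B\<rfloor>..\<lfloor>B\<rfloor>} \<and> length (coeffs f) = Suc n"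
      by (simp del: upt_Suc atLeastAtMost_iff add: image_subset_iff less_Suc_eq_le)
    hence "coeffs f \<in> ?L"
      by blast
    thus "f \<in> Poly ` ?L"
      by (rule image_eqI[rotated]) simp
  qed
  show "finite (Poly ` ?L)"
    by (intro finite_imageI finite_lists_length_eq) simp
qed

text \<open>Every number field is isomorphic to a subfield of \<open>\<complex>\<close>, so up to isomorphism it suffices
  to consider these.\<close>

definition number_field :: "nat \<Rightarrow> complex set \<Rightarrow> bool" where
  "number_field n K \<longleftrightarrow> subfield K complex_ring \<and> ring.dimension complex_ring n \<rat> K"

definition ring_of_integers :: "complex set \<Rightarrow> complex set" where
  "ring_of_integers K = {x \<in> K. algebraic_int x}"

definition integral_basis :: "nat \<Rightarrow> complex set \<Rightarrow> (nat \<Rightarrow> complex) \<Rightarrow> bool" where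
  "integral_basis n K \<omega> \<longleftrightarrow>
     (\<forall>i<n. \<omega> i \<in> ring_of_integers K) \<and>
     (\<forall>x\<in>ring_of_integers K. \<exists>c :: nat \<Rightarrow> int. x = (\<Sum>i<n. of_int (c i) * \<omega> i)) \<and>
     (\<forall>c :: nat \<Rightarrow> int. (\<Sum>i<n. of_int (c i) * \<omega> i) = 0 \<longrightarrow> (\<forall>i<n. c i = 0))"

text \<open>The square makes the value independent of the chosen integral basis and of the enumeration
  \<open>\<sigma>\<close> of the embeddings.\<close>

definition discriminant :: "complex set \<Rightarrow> int" where
  "discriminant K =
     (THE d. \<exists>n \<omega> \<sigma>. number_field n K \<and> integral_basis n K \<omega> \<and>
        bij_betw \<sigma> {..<n} (embeddings K UNIV) \<and>
        of_int d = (Determinant.det (Matrix.mat n n (\<lambda>(i, j). \<sigma> i (\<omega> j)))) ^ 2)"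

definition normal_closure :: "complex set \<Rightarrow> complex set" where
  "normal_closure K = generate_field complex_ring (\<Union>\<sigma>\<in>embeddings K UNIV. \<sigma> ` K)"

definition field_has_galois_group :: "nat \<Rightarrow> complex set \<Rightarrow> (nat \<Rightarrow> nat) set \<Rightarrow> bool" where
  "field_has_galois_group n K G \<longleftrightarrow>
     acts_as n (galois_group (normal_closure K)) (\<lambda>\<gamma> \<tau>. compose K \<gamma> \<tau>)
       (embeddings K (normal_closure K)) G"

definition galois_fields :: "nat \<Rightarrow> real \<Rightarrow> (nat \<Rightarrow> nat) set \<Rightarrow> complex set set" where
  "galois_fields n D G =
     {K. number_field n K \<and> field_has_galois_group n K G \<and> real_of_int (abs (discriminant K)) \<le> D}"

definition galois_field_classes :: "nat \<Rightarrow> real \<Rightarrow> (nat \<Rightarrow> nat) set \<Rightarrow> complex set set set" where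
  "galois_field_classes n D G =
     galois_fields n D G //
       {(K, K'). K \<in> galois_fields n D G \<and> K' \<in> galois_fields n D G \<and>
                 subring_of K \<simeq> subring_of K'}"

text \<open>By Hermite's theorem this count is always finite. An extended natural number is used because
  \<open>card\<close> would return 0 on an infinite set, so that an upper bound would not express a bound on
  the number of fields without invoking Hermite's theorem.\<close>

definition N_count :: "nat \<Rightarrow> real \<Rightarrow> (nat \<Rightarrow> nat) set \<Rightarrow> enat" where
  "N_count n D G =
     (if finite (galois_field_classes n D G) then enat (card (galois_field_classes n D G)) else \<infinity>)"

end

theory Submission
  imports Defs "Berlekamp_Zassenhaus.Mahler_Measure" "Jordan_Normal_Form.Char_Poly"
begin

unbundle no fps_syntax

text \<open>
  A polynomial \<open>f\<close> counted by \<open>P\<^sub>n(B; G)\<close> is irreducible, and \<open>K = \<rat>(\<alpha>)\<close>, for a root \<open>\<alpha>\<close>, is a field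
  counted by \<open>N\<^sub>n(X; G)\<close> with \<open>X \<asymp> B\<^bsup>2n-2\<^esup>\<close>, since \<open>Disc K\<close> is at most the discriminant of the order
  \<open>\<int>[\<alpha>]\<close> and the Mahler measure of \<open>f\<close> is \<open>O(B)\<close> by Landau's inequality. Conversely, the
  polynomials belonging to one field \<open>K\<close> correspond to integers \<open>x\<close> of \<open>K\<close> whose conjugates satisfy
  \<open>\<Prod> max(1, |x\<^sub>i|) = O(B)\<close>. These lie in \<open>O((log B)\<^bsup>n-1\<^esup>)\<close> boxes of volume \<open>O(B)\<close>. A nonzero integer
  has norm at least 1, so a cell with sides of length \<open>1/4\<close> contains at most one integer and each
  box contains \<open>O(B)\<close> of them, which gives the first bound.

  If \<open>G\<close> is primitive, every irrational integer of \<open>K\<close> generates \<open>K\<close> and therefore has discriminant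
  at least \<open>|Disc K|\<close>. So in a cell with sides of length at most a small multiple of
  \<open>T = |Disc K|\<^bsup>1/(n(n-1))\<^esup>\<close> any two integers differ by a rational integer, which saves a factor \<open>T\<close>.
  The second bound follows by summation over the fields.
\<close>

section \<open>Algebraic integers\<close>

text \<open>One fact carries the arithmetic: |Disc K| is the minimum of |disc| over all rational
  bases of K that consist of integers. Applied to the powers of \<alpha> it bounds Disc K from
  above, applied to a basis multiplied by x it bounds the norm of x from below, and applied to the
  powers of a difference of two integers it yields the saving in the primitive case. The counting
  itself is then a pigeonhole argument on cells.

  The group acts only through values of rational polynomials: an automorphism \<sigma> of the
  splitting field carries p(z) to p(\<sigma> z). Transitivity turns this into irreducibility of f,
  and primitivity excludes a partial coincidence among the conjugates of an integer.

  The exponent 2/n arises because |Disc K| may be as large as B^(2n-2), where the saving |Disc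
  K|^(1/(n(n-1))) is about B^(2/n). Fields of small discriminant save less, so the bound per field
  varies, and e > 1/(n^2-n) is what lets the large discriminants dominate the sum.\<close>

definition int_span :: "'i set \<Rightarrow> ('i \<Rightarrow> complex) \<Rightarrow> complex set" where
  "int_span I v = {\<Sum>i\<in>I. of_int (a i) * v i |a. True}"

lemma int_span_0: "0 \<in> int_span I v"
  unfolding int_span_def by (auto intro!: exI[of _ "\<lambda>_. 0"])

lemma int_span_add: "x \<in> int_span I v \<Longrightarrow> y \<in> int_span I v \<Longrightarrow> x + y \<in> int_span I v"
proof -
  assume "x \<in> int_span I v" "y \<in> int_span I v"
  then obtain a b where "x = (\<Sum>i\<in>I. of_int (a i) * v i)" "y = (\<Sum>i\<in>I. of_int (b i) * v i)"
    unfolding int_span_def by auto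
  hence "x + y = (\<Sum>i\<in>I. of_int (a i + b i) * v i)"
    by (simp add: sum.distrib algebra_simps)
  thus ?thesis unfolding int_span_def by (auto intro!: exI[of _ "\<lambda>i. a i + b i"])
qed

lemma int_span_scale: "x \<in> int_span I v \<Longrightarrow> of_int c * x \<in> int_span I v"
proof -
  assume "x \<in> int_span I v"
  then obtain a where "x = (\<Sum>i\<in>I. of_int (a i) * v i)"
    unfolding int_span_def by auto
  hence "of_int c * x = (\<Sum>i\<in>I. of_int (c * a i) * v i)"
    by (simp add: sum_distrib_left algebra_simps)
  thus ?thesis unfolding int_span_def by (auto intro!: exI[of _ "\<lambda>i. c * a i"])
qed

lemma int_span_sum: "(\<And>j. j \<in> J \<Longrightarrow> f j \<in> int_span I v) \<Longrightarrow> (\<Sum>j\<in>J. f j) \<in> int_span I v"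
  by (induction J rule: infinite_finite_induct) (auto intro: int_span_0 int_span_add)

lemma int_span_base: "finite I \<Longrightarrow> i \<in> I \<Longrightarrow> v i \<in> int_span I v"
proof -
  assume *: "finite I" "i \<in> I"
  have "(\<Sum>j\<in>I. of_int (if j = i then 1 else 0) * v j) = (\<Sum>j\<in>I. if j = i then v j else 0)"
    by (intro sum.cong) auto
  also have "\<dots> = v i" using * by simp
  finally show ?thesis unfolding int_span_def
    by (intro CollectI exI[of _ "\<lambda>j. if j = i then 1 else 0"]) simp
qed

lemma int_span_stable:
  assumes "\<And>i. i \<in> I \<Longrightarrow> x * v i \<in> int_span I v" "y \<in> int_span I v"
  shows "x * y \<in> int_span I v"
proof -
  obtain a where y: "y = (\<Sum>i\<in>I. of_int (a i) * v i)"
    using assms(2) unfolding int_span_def by auto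
  have "x * y = (\<Sum>i\<in>I. of_int (a i) * (x * v i))"
    by (simp add: y sum_distrib_left algebra_simps)
  thus ?thesis using assms(1) by (auto intro!: int_span_sum int_span_scale)
qed

text \<open>\<open>x\<close> is an eigenvalue of an integer matrix, hence a root of its characteristic polynomial.\<close>

lemma algebraic_int_if_stable:
  fixes x :: complex
  assumes fin: "finite I" and st: "\<And>i. i \<in> I \<Longrightarrow> x * v i \<in> int_span I v"
    and nz: "k \<in> I" "v k \<noteq> 0"
  shows "algebraic_int x"
proof -
  define m where "m = card I"
  obtain h where h: "bij_betw h {..<m} I"
    using ex_bij_betw_nat_finite[OF fin] unfolding m_def atLeast0LessThan by blast
  have "\<exists>A :: 'a \<Rightarrow> 'a \<Rightarrow> int. \<forall>i\<in>I. x * v i = (\<Sum>j\<in>I. of_int (A i j) * v j)"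
    using st unfolding int_span_def by (intro bchoice) auto
  then obtain A :: "'a \<Rightarrow> 'a \<Rightarrow> int" where
    A: "\<And>i. i \<in> I \<Longrightarrow> x * v i = (\<Sum>j\<in>I. of_int (A i j) * v j)" by metis
  define M :: "int mat" where "M = Matrix.mat m m (\<lambda>(i, j). A (h i) (h j))"
  define MC where "MC = map_mat complex_of_int M"
  define w where "w = Matrix.vec m (\<lambda>i. v (h i))"
  have M: "M \<in> carrier_mat m m" and MC: "MC \<in> carrier_mat m m" and w: "w \<in> carrier_vec m"
    by (auto simp: M_def MC_def w_def)
  obtain i0 where i0: "i0 < m" "h i0 = k"
    using h nz(1) unfolding bij_betw_def by (metis imageE lessThan_iff)
  have "MC *\<^sub>v w = x \<cdot>\<^sub>v w"
  proof (rule eq_vecI)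
    fix i assume "i < dim_vec (x \<cdot>\<^sub>v w)"
    hence i: "i < m" using w by auto
    have hi: "h i \<in> I" using h i by (auto simp: bij_betw_def)
    have "(MC *\<^sub>v w) $ i = (\<Sum>j<m. of_int (A (h i) (h j)) * v (h j))"
      using i by (simp add: MC_def M_def w_def scalar_prod_def atLeast0LessThan)
    also have "\<dots> = (\<Sum>j\<in>I. of_int (A (h i) j) * v j)"
      by (rule sum.reindex_bij_betw[OF h])
    also have "\<dots> = x * v (h i)" using A[OF hi] by simp
    finally show "(MC *\<^sub>v w) $ i = (x \<cdot>\<^sub>v w) $ i" using i by (simp add: w_def)
  qed (use MC w in auto)
  moreover have "w \<noteq> 0\<^sub>v m"
  proof
    assume "w = 0\<^sub>v m"
    hence "w $ i0 = 0" using i0 by simp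
    thus False using i0 nz by (simp add: w_def)
  qed
  ultimately have "eigenvalue MC x"
    unfolding eigenvalue_def eigenvector_def using MC w by auto
  hence "poly (char_poly MC) x = 0"
    using eigenvalue_root_char_poly[OF MC] by simp
  also have "char_poly MC = map_poly of_int (char_poly M)"
    unfolding MC_def by (rule of_int_hom.char_poly_hom[OF M])
  finally have "poly (map_poly of_int (char_poly M)) x = 0" .
  moreover have "lead_coeff (char_poly M) = 1"
    using degree_monic_char_poly[OF M] by simp
  ultimately show ?thesis unfolding algebraic_int_altdef_ipoly by blast
qed

text \<open>A monic equation rewrites the p-th power in terms of lower ones, so the span of the
  powers below p is closed under multiplication by x. Positivity of p puts 1 among the
  generators.\<close>

lemma algebraic_int_power_span:
  fixes x :: complex
  assumes "algebraic_int x"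
  obtains p where "p > 0" "x ^ p \<in> int_span {..<p} (\<lambda>i. x ^ i)"
proof -
  obtain f :: "int poly" where f: "poly (map_poly of_int f) x = 0" "lead_coeff f = 1"
    using assms unfolding algebraic_int_altdef_ipoly by blast
  let ?p = "Polynomial.degree f"
  have p: "?p > 0"
  proof (rule ccontr)
    assume "\<not> ?p > 0"
    hence "f = 1" using f(2) by (metis degree_eq_zeroE lead_coeff_pCons(2) gr0I pCons_one)
    thus False using f(1) by simp
  qed
  have "0 = (\<Sum>i\<le>?p. of_int (poly.coeff f i) * x ^ i)"
    using f(1) by (simp add: poly_altdef)
  also have "{..?p} = insert ?p {..<?p}" by auto
  also have "(\<Sum>i\<in>insert ?p {..<?p}. of_int (poly.coeff f i) * x ^ i) = x ^ ?p + (\<Sum>i<?p. of_int (poly.coeff f i) * x ^ i)"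
    using f(2) by simp
  finally have "x ^ ?p = (\<Sum>i<?p. of_int (- poly.coeff f i) * x ^ i)"
    by (simp add: sum_negf eq_neg_iff_add_eq_0)
  hence "x ^ ?p \<in> int_span {..<?p} (\<lambda>i. x ^ i)"
    unfolding int_span_def by (auto intro!: exI[of _ "\<lambda>i. - poly.coeff f i"])
  thus ?thesis using p that by blast
qed

text \<open>The products \<open>x ^ i * y ^ j\<close> with i < p and j < q span a module that x and
  y map into itself. Then x + y and xy do so too, and the eigenvalue criterion applies to both with
  the nonzero generator 1.\<close>

lemma
  fixes x y :: complex
  assumes "algebraic_int x" "algebraic_int y"
  shows algebraic_int_add: "algebraic_int (x + y)" and algebraic_int_mult: "algebraic_int (x * y)"
proof -
  obtain p where p: "p > 0" "x ^ p \<in> int_span {..<p} (\<lambda>i. x ^ i)"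
    using algebraic_int_power_span[OF assms(1)] .
  obtain q where q: "q > 0" "y ^ q \<in> int_span {..<q} (\<lambda>i. y ^ i)"
    using algebraic_int_power_span[OF assms(2)] .
  define I where "I = {..<p} \<times> {..<q}"
  define v where "v = (\<lambda>(i, j). x ^ i * y ^ j)"
  have fin: "finite I" and k: "(0, 0) \<in> I" and vk: "v (0, 0) \<noteq> 0"
    using p q by (auto simp: I_def v_def)
  have base: "x ^ i * y ^ j \<in> int_span I v" if "i < p" "j < q" for i j
    using int_span_base[OF fin, of "(i, j)" v] that by (simp add: I_def v_def)
  have X: "x * v i \<in> int_span I v" if iI: "i \<in> I" for i
  proof -
    obtain a b where i: "i = (a, b)" "a < p" "b < q" using iI by (cases i) (auto simp: I_def)
    have eq: "x * v i = x ^ Suc a * y ^ b" by (simp add: i v_def)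
    show ?thesis
    proof (cases "Suc a < p")
      case True
      thus ?thesis unfolding eq using i by (intro base)
    next
      case False
      hence "Suc a = p" using i by simp
      moreover obtain c where "x ^ p = (\<Sum>i<p. of_int (c i) * x ^ i)"
        using p(2) unfolding int_span_def by auto
      ultimately have "x * v i = (\<Sum>l<p. of_int (c l) * (x ^ l * y ^ b))"
        unfolding eq by (simp add: sum_distrib_right mult.assoc)
      also have "\<dots> \<in> int_span I v"
        using i by (intro int_span_sum int_span_scale base) auto
      finally show ?thesis .
    qed
  qed
  have Y: "y * v i \<in> int_span I v" if iI: "i \<in> I" for i
  proof -
    obtain a b where i: "i = (a, b)" "a < p" "b < q" using iI by (cases i) (auto simp: I_def)
    have eq: "y * v i = x ^ a * y ^ Suc b" by (simp add: i v_def)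
    show ?thesis
    proof (cases "Suc b < q")
      case True
      thus ?thesis unfolding eq using i by (intro base)
    next
      case False
      hence "Suc b = q" using i by simp
      moreover obtain c where "y ^ q = (\<Sum>i<q. of_int (c i) * y ^ i)"
        using q(2) unfolding int_span_def by auto
      ultimately have "y * v i = (\<Sum>l<q. of_int (c l) * (x ^ a * y ^ l))"
        unfolding eq by (simp add: sum_distrib_left mult_ac)
      also have "\<dots> \<in> int_span I v"
        using i by (intro int_span_sum int_span_scale base) auto
      finally show ?thesis .
    qed
  qed
  show "algebraic_int (x + y)"
    by (rule algebraic_int_if_stable[where v = v, OF fin _ k vk])
      (auto simp: distrib_right intro: int_span_add X Y)
  show "algebraic_int (x * y)"
    by (rule algebraic_int_if_stable[where v = v, OF fin _ k vk])
      (auto simp: mult.assoc intro: int_span_stable X Y)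
qed

lemma algebraic_int_diff: "algebraic_int x \<Longrightarrow> algebraic_int y \<Longrightarrow> algebraic_int (x - y :: complex)"
  using algebraic_int_add[of x "-y"] by simp

lemma algebraic_int_sum:
  "(\<And>i. i \<in> I \<Longrightarrow> algebraic_int (f i :: complex)) \<Longrightarrow> algebraic_int (\<Sum>i\<in>I. f i)"
  by (induction I rule: infinite_finite_induct) (auto intro: algebraic_int_add)

lemma algebraic_int_prod:
  "(\<And>i. i \<in> I \<Longrightarrow> algebraic_int (f i :: complex)) \<Longrightarrow> algebraic_int (\<Prod>i\<in>I. f i)"
  by (induction I rule: infinite_finite_induct) (auto intro: algebraic_int_mult)

lemma algebraic_int_power: "algebraic_int x \<Longrightarrow> algebraic_int (x ^ k :: complex)"
  by (induction k) (auto intro: algebraic_int_mult)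

lemma algebraic_int_det:
  fixes M :: "complex mat"
  assumes M: "M \<in> carrier_mat n n" and "\<And>i j. i < n \<Longrightarrow> j < n \<Longrightarrow> algebraic_int (M $$ (i, j))"
  shows "algebraic_int (det M)"
  unfolding det_def'[OF M] using assms(2)
  by (intro algebraic_int_sum algebraic_int_mult algebraic_int_prod)
    (auto simp: sign_def permutes_in_image)

lemma rational_det:
  fixes M :: "complex mat"
  assumes M: "M \<in> carrier_mat n n" and "\<And>i j. i < n \<Longrightarrow> j < n \<Longrightarrow> M $$ (i, j) \<in> \<rat>"
  shows "det M \<in> \<rat>"
  unfolding det_def'[OF M] using assms(2)
  by (intro Rats_sum Rats_mult Rats_prod)
    (auto simp: sign_def permutes_in_image)

section \<open>Values of rational polynomials and traces\<close>

text \<open>Elements of a number field are handled as values of rational polynomials at a root, so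
  that passing to a conjugate is evaluation of the same polynomial at another root.\<close>

definition rat_eval :: "rat poly \<Rightarrow> complex \<Rightarrow> complex" where
  "rat_eval p z = poly (map_poly of_rat p) z"

lemma rat_eval_simps [simp]:
  "rat_eval 0 z = 0" "rat_eval 1 z = 1" "rat_eval [:c:] z = of_rat c"
  "rat_eval (p + q) z = rat_eval p z + rat_eval q z"
  "rat_eval (p - q) z = rat_eval p z - rat_eval q z"
  "rat_eval (- p) z = - rat_eval p z"
  "rat_eval (p * q) z = rat_eval p z * rat_eval q z"
  "rat_eval (p ^ k) z = rat_eval p z ^ k"
  "rat_eval [:0, 1:] z = z"
  "rat_eval (sum f I) z = (\<Sum>i\<in>I. rat_eval (f i) z)"
proof -
  interpret map_poly_comm_ring_hom "of_rat :: rat \<Rightarrow> complex" ..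
  show "rat_eval 0 z = 0" "rat_eval 1 z = 1" "rat_eval [:c:] z = of_rat c"
    "rat_eval (p + q) z = rat_eval p z + rat_eval q z"
    "rat_eval (p - q) z = rat_eval p z - rat_eval q z"
    "rat_eval (- p) z = - rat_eval p z"
    "rat_eval (p * q) z = rat_eval p z * rat_eval q z"
    "rat_eval (p ^ k) z = rat_eval p z ^ k"
    "rat_eval [:0, 1:] z = z"
    "rat_eval (sum f I) z = (\<Sum>i\<in>I. rat_eval (f i) z)"
    by (simp_all add: rat_eval_def of_rat_hom.map_poly_pCons_hom poly_sum hom_add hom_minus hom_uminus hom_mult hom_power hom_sum)
qed

lemma cnj_of_rat: "cnj (of_rat q) = of_rat q"
  by (induction q) (simp add: of_rat_rat)

lemma rat_eval_cnj: "rat_eval p (cnj z) = cnj (rat_eval p z)"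
  unfolding rat_eval_def
  by (induction p) (auto simp: map_poly_pCons cnj_of_rat)

lemma poly_zero_if_many_roots:
  fixes p :: "complex poly"
  assumes "Polynomial.degree p < card R" "\<And>z. z \<in> R \<Longrightarrow> poly p z = 0"
  shows "p = 0"
proof (rule ccontr)
  assume p: "p \<noteq> 0"
  have "card R \<le> card {z. poly p z = 0}"
    using assms(2) poly_roots_finite[OF p] by (intro card_mono) auto
  also have "\<dots> \<le> Polynomial.degree p" using p by (rule card_poly_roots_bound)
  finally show False using assms(1) by simp
qed

text \<open>Both sides are monic of degree equal to the number of roots, so a nonzero difference
  would have smaller degree and vanish at too many points.\<close>

lemma monic_eq_prod_roots:
  fixes p :: "complex poly"
  assumes "lead_coeff p = 1" "card {z. poly p z = 0} = Polynomial.degree p"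
  shows "p = (\<Prod>z\<in>{z. poly p z = 0}. [:- z, 1:])"
proof -
  define R where "R = {z. poly p z = 0}"
  define q where "q = (\<Prod>z\<in>R. [:- z, 1:])"
  have p0: "p \<noteq> 0" using assms(1) by auto
  have fin: "finite R" unfolding R_def using p0 by (rule poly_roots_finite)
  have dq: "Polynomial.degree q = card R" "lead_coeff q = 1"
    unfolding q_def by (simp add: degree_prod_eq_sum_degree) (rule monic_prod, simp)
  have d: "Polynomial.degree p = card R" using assms(2) by (simp add: R_def)
  show ?thesis
  proof (cases "p = q")
    case True
    thus ?thesis by (simp add: q_def R_def)
  next
    case False
    have "Polynomial.degree p > 0"
    proof (rule ccontr)
      assume "\<not> Polynomial.degree p > 0"
      hence "p = 1" "q = 1" using assms(1) dq d
        by (metis degree_eq_zeroE lead_coeff_pCons(2) gr0I pCons_one)+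
      thus False using False by simp
    qed
    have "Polynomial.degree (p - q) < card R"
    proof (rule degree_lessI)
      show "p - q \<noteq> 0 \<or> card R > 0" using False by simp
      show "\<forall>k\<ge>card R. poly.coeff (p - q) k = 0"
      proof (intro allI impI)
        fix k assume "k \<ge> card R"
        thus "poly.coeff (p - q) k = 0"
          using dq d assms(1) by (cases "k = card R") (auto simp: coeff_eq_0)
      qed
    qed
    moreover have "poly (p - q) z = 0" if "z \<in> R" for z
      using that fin by (auto simp: R_def q_def poly_prod)
    ultimately have "p - q = 0" by (rule poly_zero_if_many_roots)
    thus ?thesis by (simp add: q_def R_def)
  qed
qed

text \<open>By Lagrange interpolation, the sum is the coefficient of degree \<open>n - 1\<close> of the remainder
  of \<open>F' g\<close> modulo \<open>F\<close>.\<close>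

lemma trace_rational:
  fixes F g :: "rat poly"
  assumes lc: "lead_coeff F = 1" and R: "R = {z. rat_eval F z = 0}"
    and card: "card R = Polynomial.degree F"
  shows "(\<Sum>z\<in>R. rat_eval g z) \<in> \<rat>"
proof (cases "Polynomial.degree F = 0")
  case True
  have "F = 1" using lc True by (metis degree_eq_zeroE lead_coeff_pCons(2) pCons_one)
  thus ?thesis by (simp add: R)
next
  case False
  define n where "n = Polynomial.degree F"
  define FC where "FC = (map_poly of_rat F :: complex poly)"
  define P where "P = (\<lambda>S. \<Prod>w\<in>S. [:- w, 1:] :: complex poly)"
  have n: "n > 0" and F0: "F \<noteq> 0" using False by (auto simp: n_def)
  have fin: "finite R" using card False card_ge_0_finite by force
  have FC: "FC = P R"
    unfolding P_def R rat_eval_def FC_def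
    by (rule monic_eq_prod_roots) (use lc card in \<open>auto simp: R rat_eval_def\<close>)
  define h where "h = (pderiv F * g) mod F"
  have dh: "Polynomial.degree h < n"
    unfolding h_def n_def using F0 False by (metis degree_mod_less' mod_0_imp_dvd degree_0 gr0I degree_mod_less)
  \<comment> \<open>At a root, F' is the product of the differences to the other roots. So Q below
    takes the values F'(z) g(z) on R: it is the Lagrange interpolant of F' g, free of
    denominators.\<close>
  have Pz: "poly (P (R - {w})) z = (if z = w then rat_eval (pderiv F) z else 0)"
    if "z \<in> R" "w \<in> R" for z w
  proof (cases "z = w")
    case True
    have "rat_eval (pderiv F) z = poly (pderiv FC) z"
      by (simp add: rat_eval_def FC_def of_rat_hom.map_poly_pderiv)
    also have "\<dots> = (\<Sum>a\<in>R. poly (P (R - {a})) z)"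
      unfolding FC P_def pderiv_prod by (simp add: poly_sum pderiv_pCons)
    also have "\<dots> = (\<Sum>a\<in>R. if a = z then poly (P (R - {z})) z else 0)"
      using that fin by (intro sum.cong) (auto simp: P_def poly_prod)
    also have "\<dots> = poly (P (R - {z})) z" using that fin by simp
    finally show ?thesis using True by simp
  next
    case False
    thus ?thesis using that fin by (auto simp: P_def poly_prod)
  qed
  define Q where "Q = (\<Sum>w\<in>R. Polynomial.smult (rat_eval g w) (P (R - {w})))"
  have dP: "Polynomial.degree (P (R - {w})) = n - 1" "lead_coeff (P (R - {w})) = 1" if "w \<in> R" for w
  proof -
    show "Polynomial.degree (P (R - {w})) = n - 1"
      using that fin card by (simp add: P_def degree_prod_eq_sum_degree n_def)
    show "lead_coeff (P (R - {w})) = 1" unfolding P_def by (rule monic_prod) simp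
  qed
  have dQ: "Polynomial.degree Q < n"
  proof -
    have "Polynomial.degree Q \<le> n - 1"
      unfolding Q_def by (rule degree_sum_le[OF fin]) (use dP in \<open>auto intro: order.trans[OF degree_smult_le]\<close>)
    thus ?thesis using n by simp
  qed
  have "map_poly of_rat h - Q = 0"
  proof (rule poly_zero_if_many_roots)
    have "Polynomial.degree (map_poly of_rat h :: complex poly) < n" using dh by simp
    thus "Polynomial.degree (map_poly of_rat h - Q) < card R"
      using dQ card n_def by (simp add: degree_diff_less)
    fix z assume z: "z \<in> R"
    have "poly (map_poly of_rat h) z = rat_eval h z" by (simp add: rat_eval_def)
    also have "\<dots> = rat_eval (pderiv F * g - F * ((pderiv F * g) div F)) z"
      unfolding h_def by (simp only: minus_mult_div_eq_mod)
    also have "\<dots> = rat_eval (pderiv F) z * rat_eval g z" using z by (simp add: R)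
    also have "\<dots> = poly Q z"
    proof -
      have "poly Q z = (\<Sum>w\<in>R. if w = z then rat_eval (pderiv F) z * rat_eval g z else 0)"
        unfolding Q_def poly_sum using Pz[OF z] by (intro sum.cong) auto
      thus ?thesis using z fin by simp
    qed
    finally show "poly (map_poly of_rat h - Q) z = 0" by simp
  qed
  \<comment> \<open>Each \<open>P (R - {w})\<close> is monic of degree n - 1, so this coefficient of
    Q is the trace, while that of h is rational.\<close>
  hence "poly.coeff Q (n - 1) = of_rat (poly.coeff h (n - 1))"
    by (metis eq_iff_diff_eq_0 coeff_map_poly of_rat_0)
  moreover have "poly.coeff Q (n - 1) = (\<Sum>w\<in>R. rat_eval g w)"
    unfolding Q_def coeff_sum using dP by (intro sum.cong) auto
  ultimately show ?thesis by (metis Rats_of_rat)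
qed

section \<open>Subfields of the complex numbers\<close>

lemma complex_ring_simps [simp]:
  "carrier complex_ring = UNIV" "x \<otimes>\<^bsub>complex_ring\<^esub> y = x * y" "x \<oplus>\<^bsub>complex_ring\<^esub> y = x + y"
  "\<one>\<^bsub>complex_ring\<^esub> = 1" "\<zero>\<^bsub>complex_ring\<^esub> = 0"
  by (simp_all add: ring_of_type_algebra_def)

lemma field_complex_ring: "field complex_ring"
  by (rule field_from_type_algebra)

lemma ring_complex_ring: "ring complex_ring"
  by (rule ring_from_type_algebra)

lemma complex_ring_minus [simp]: "\<ominus>\<^bsub>complex_ring\<^esub> x = - x"
proof -
  interpret ring complex_ring by (rule ring_complex_ring)
  have "x + \<ominus>\<^bsub>complex_ring\<^esub> x = 0" using r_neg[of x] by simp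
  thus ?thesis by (metis add.commute eq_neg_iff_add_eq_0)
qed

lemma complex_ring_inv [simp]: "x \<noteq> 0 \<Longrightarrow> inv\<^bsub>complex_ring\<^esub> x = inverse x"
proof -
  assume x: "x \<noteq> 0"
  interpret field complex_ring by (rule field_complex_ring)
  have "x \<in> Units complex_ring" using x field_Units by simp
  hence "x * inv\<^bsub>complex_ring\<^esub> x = 1" using Units_r_inv[of x] by simp
  thus ?thesis by (metis inverse_unique)
qed

lemma subfield_complexI:
  assumes "1 \<in> S" "\<And>x. x \<in> S \<Longrightarrow> - x \<in> S" "\<And>x y. x \<in> S \<Longrightarrow> y \<in> S \<Longrightarrow> x + y \<in> S"
    "\<And>x y. x \<in> S \<Longrightarrow> y \<in> S \<Longrightarrow> x * y \<in> S" "\<And>x. x \<in> S \<Longrightarrow> x \<noteq> 0 \<Longrightarrow> inverse x \<in> S"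
  shows "subfield S complex_ring"
proof -
  interpret field complex_ring by (rule field_complex_ring)
  show ?thesis
    by (rule subfieldI', rule subringI) (use assms in auto)
qed

lemma subfield_complexD:
  assumes "subfield S complex_ring"
  shows "0 \<in> S" "1 \<in> S" "\<And>x. x \<in> S \<Longrightarrow> - x \<in> S" "\<And>x y. x \<in> S \<Longrightarrow> y \<in> S \<Longrightarrow> x + y \<in> S"
    "\<And>x y. x \<in> S \<Longrightarrow> y \<in> S \<Longrightarrow> x * y \<in> S" "\<And>x. x \<in> S \<Longrightarrow> x \<noteq> 0 \<Longrightarrow> inverse x \<in> S"
    "of_rat q \<in> S"
proof -
  interpret field complex_ring by (rule field_complex_ring)
  note * = subringE[OF subfieldE(1)[OF assms]]
  show 01: "0 \<in> S" "1 \<in> S" and neg: "\<And>x. x \<in> S \<Longrightarrow> - x \<in> S"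
    and add: "\<And>x y. x \<in> S \<Longrightarrow> y \<in> S \<Longrightarrow> x + y \<in> S"
    and mult: "\<And>x y. x \<in> S \<Longrightarrow> y \<in> S \<Longrightarrow> x * y \<in> S"
    using * by auto
  show inv: "inverse x \<in> S" if "x \<in> S" "x \<noteq> 0" for x
    using subfield_m_inv(1)[OF assms, of x] that by simp
  have nat: "of_nat k \<in> S" for k by (induction k) (auto intro: 01 add)
  have int: "of_int k \<in> S" for k by (cases k) (auto intro: neg nat simp del: of_nat_Suc)
  show "of_rat q \<in> S"
    by (cases q) (auto simp: of_rat_rat divide_inverse intro!: mult inv int)
qed

lemma rat_eval_pCons [simp]: "rat_eval (pCons a p) x = of_rat a + x * rat_eval p x"
  by (simp add: rat_eval_def of_rat_hom.map_poly_pCons_hom)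

lemma subfield_rat_eval:
  assumes "subfield S complex_ring" "x \<in> S"
  shows "rat_eval p x \<in> S"
  using subfield_complexD[OF assms(1)] assms(2)
  by (induction p) (auto simp: rat_eval_pCons)

lemma subring_of_homD:
  assumes "\<phi> \<in> Ring.ring_hom (subring_of S) (subring_of L)"
  shows "\<And>x. x \<in> S \<Longrightarrow> \<phi> x \<in> L" "\<And>x y. x \<in> S \<Longrightarrow> y \<in> S \<Longrightarrow> \<phi> (x + y) = \<phi> x + \<phi> y"
    "\<And>x y. x \<in> S \<Longrightarrow> y \<in> S \<Longrightarrow> \<phi> (x * y) = \<phi> x * \<phi> y" "\<phi> 1 = 1"
  using ring_hom_memE[OF assms] by simp_all

lemma subring_of_homI:
  assumes "\<And>x. x \<in> S \<Longrightarrow> \<phi> x \<in> L" "\<And>x y. x \<in> S \<Longrightarrow> y \<in> S \<Longrightarrow> \<phi> (x + y) = \<phi> x + \<phi> y"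
    "\<And>x y. x \<in> S \<Longrightarrow> y \<in> S \<Longrightarrow> \<phi> (x * y) = \<phi> x * \<phi> y" "\<phi> 1 = 1"
  shows "\<phi> \<in> Ring.ring_hom (subring_of S) (subring_of L)"
  by (rule ring_hom_memI) (use assms in simp_all)

text \<open>A unital homomorphism fixes the integers, hence a fraction a/b after multiplication by
  b. Through this lemma both embeddings of K and Galois automorphisms act on the roots of rational
  polynomials.\<close>

lemma hom_rat_eval:
  assumes S: "subfield S complex_ring" and hom: "\<phi> \<in> Ring.ring_hom (subring_of S) (subring_of L)"
    and x: "x \<in> S"
  shows "\<phi> (rat_eval p x) = rat_eval p (\<phi> x)"
proof -
  note c = subfield_complexD[OF S] and h = subring_of_homD[OF hom]
  have 0: "\<phi> 0 = 0" using h(2)[of 0 0] c by simp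
  have neg: "\<phi> (- y) = - \<phi> y" if "y \<in> S" for y
    using h(2)[of y "-y"] c that 0 by (metis add.right_inverse add_eq_0_iff)
  have nat: "of_nat k \<in> S \<and> \<phi> (of_nat k) = of_nat k" for k
    by (induction k) (auto simp: h c 0)
  have int: "\<phi> (of_int k) = of_int k" for k
    by (cases k) (auto simp: neg nat simp del: of_nat_Suc)
  have rat: "\<phi> (of_rat q) = of_rat q" for q
  proof -
    obtain a b where q: "q = Rat.Fract a b" "b > 0" by (cases q) auto
    have "of_rat q \<in> S" "complex_of_int b \<in> S"
      using c(7)[of q] c(7)[of "of_int b"] by auto
    moreover have "of_rat q * of_int b = complex_of_int a" using q by (simp add: of_rat_rat)
    ultimately have "\<phi> (of_rat q) * of_int b = of_int a" using h(3) int by metis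
    thus ?thesis using q by (simp add: of_rat_rat field_simps)
  qed
  show ?thesis
    by (induction p) (simp_all add: 0 rat_eval_pCons h c x rat subfield_rat_eval[OF S])
qed

lemma subfield_generate: "subfield (generate_field complex_ring H) complex_ring"
proof -
  interpret field complex_ring by (rule field_complex_ring)
  show ?thesis by (rule generate_field_is_subfield) simp
qed

lemma generate_field_least:
  assumes "subfield E complex_ring" "H \<subseteq> E"
  shows "generate_field complex_ring H \<subseteq> E"
proof -
  interpret field complex_ring by (rule field_complex_ring)
  show ?thesis by (rule generate_field_min_subfield1) (use assms in auto)
qed

section \<open>The number field generated by a root\<close>

text \<open>\<open>card_R\<close> is separability in the form in which it is available: the Galois
  hypothesis contains a labelling of the roots by 1, ..., n.\<close>

locale root_field =
  fixes F :: "rat poly" and n :: nat and R :: "complex set" and \<alpha> :: complex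
  assumes monic_F: "lead_coeff F = 1" and irred: "Factorial_Ring.irreducible F" and degree_F: "Polynomial.degree F = n"
    and R_def: "R = {z. rat_eval F z = 0}" and card_R: "card R = n" and \<alpha>: "\<alpha> \<in> R"
begin

lemma F_nz: "F \<noteq> 0" using irred by auto

lemma finite_R: "finite R"
  unfolding R_def rat_eval_def by (rule poly_roots_finite) (use F_nz in simp)

lemma n_pos: "n > 0" using card_R finite_R \<alpha> card_gt_0_iff by blast

text \<open>F is the minimal polynomial of each of its roots: if F did not divide p, a Bezout
  identity for F and p evaluated at z would read 0 = 1.\<close>

lemma rat_eval_eq_0_iff: "z \<in> R \<Longrightarrow> rat_eval p z = 0 \<longleftrightarrow> F dvd p"
proof
  assume z: "z \<in> R" and p: "rat_eval p z = 0"
  show "F dvd p"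
  proof (rule ccontr)
    assume "\<not> F dvd p"
    hence "Rings.coprime F p"
      by (rule prime_elem_imp_coprime[OF field_poly_irreducible_imp_prime[OF irred]])
    hence "fst (bezout_coefficients F p) * F + snd (bezout_coefficients F p) * p = 1"
      by (simp add: bezout_coefficients_fst_snd)
    hence "rat_eval (fst (bezout_coefficients F p) * F + snd (bezout_coefficients F p) * p) z = 1"
      by simp
    thus False using p z by (simp add: R_def)
  qed
next
  assume z: "z \<in> R" and "F dvd p"
  thus "rat_eval p z = 0" by (auto simp: R_def dvd_def)
qed

definition K :: "complex set" where "K = range (\<lambda>p. rat_eval p \<alpha>)"

text \<open>The embedding of K that sends \<alpha> to z. For z in R the choice of the representing
  polynomial does not matter, since two of them differ by a multiple of F.\<close>

definition conjg :: "complex \<Rightarrow> complex \<Rightarrow> complex" where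
  "conjg z x = rat_eval (SOME p. rat_eval p \<alpha> = x) z"

lemma KI: "rat_eval p \<alpha> \<in> K" by (simp add: K_def)

lemma KE: assumes "x \<in> K" obtains p where "x = rat_eval p \<alpha>"
  using assms by (auto simp: K_def)

lemma KE_mod:
  assumes "x \<in> K"
  obtains p where "x = rat_eval p \<alpha>" "Polynomial.degree p < n"
proof -
  obtain p where p: "x = rat_eval p \<alpha>" using KE[OF assms] .
  have "rat_eval (p - F * (p div F)) \<alpha> = x" using \<alpha> by (simp add: p R_def)
  hence "x = rat_eval (p mod F) \<alpha>" by (simp add: minus_mult_div_eq_mod)
  moreover have "Polynomial.degree (p mod F) < n"
    using degree_mod_less[OF F_nz, of p] n_pos degree_F by (metis degree_0)
  ultimately show ?thesis using that by blast
qed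

lemma conjg_rat_eval: "z \<in> R \<Longrightarrow> conjg z (rat_eval p \<alpha>) = rat_eval p z"
proof -
  assume z: "z \<in> R"
  define q where "q = (SOME q. rat_eval q \<alpha> = rat_eval p \<alpha>)"
  have "rat_eval q \<alpha> = rat_eval p \<alpha>" unfolding q_def by (rule someI) (rule refl)
  hence "F dvd q - p" using rat_eval_eq_0_iff[OF \<alpha>, of "q - p"] by simp
  hence "rat_eval q z = rat_eval p z" using rat_eval_eq_0_iff[OF z, of "q - p"] by simp
  thus ?thesis by (simp add: conjg_def q_def)
qed

lemma conjg_\<alpha>: "z \<in> R \<Longrightarrow> conjg z \<alpha> = z"
  using conjg_rat_eval[of z "[:0, 1:]"] by simp

lemma \<alpha>_K: "\<alpha> \<in> K" using KI[of "[:0, 1:]"] by simp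

lemma K_inverse: assumes "x \<in> K" "x \<noteq> 0" shows "inverse x \<in> K"
proof -
  obtain p where p: "x = rat_eval p \<alpha>" using KE assms by blast
  have "\<not> F dvd p" using rat_eval_eq_0_iff[OF \<alpha>] assms p by simp
  hence "Rings.coprime F p"
    by (rule prime_elem_imp_coprime[OF field_poly_irreducible_imp_prime[OF irred]])
  hence "fst (bezout_coefficients F p) * F + snd (bezout_coefficients F p) * p = 1"
    by (simp add: bezout_coefficients_fst_snd)
  hence "rat_eval (fst (bezout_coefficients F p) * F + snd (bezout_coefficients F p) * p) \<alpha> = 1"
    by simp
  hence "rat_eval (snd (bezout_coefficients F p)) \<alpha> * x = 1"
    using \<alpha> by (simp add: R_def p)
  hence "inverse x = rat_eval (snd (bezout_coefficients F p)) \<alpha>"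
    by (metis inverse_unique mult.commute)
  thus ?thesis by (simp add: KI)
qed

lemma subfield_K: "subfield K complex_ring"
proof (rule subfield_complexI)
  show "1 \<in> K" using KI[of 1] by simp
  show "- x \<in> K" if "x \<in> K" for x
    using that by (elim KE) (metis KI rat_eval_simps(6))
  show "x + y \<in> K" if "x \<in> K" "y \<in> K" for x y
    using that by (elim KE) (metis KI rat_eval_simps(4))
  show "x * y \<in> K" if "x \<in> K" "y \<in> K" for x y
    using that by (elim KE) (metis KI rat_eval_simps(7))
qed (rule K_inverse)

lemmas K_closed = subfield_complexD[OF subfield_K]

lemma K_diff: "x \<in> K \<Longrightarrow> y \<in> K \<Longrightarrow> x - y \<in> K"
  using K_closed(3,4) by (metis diff_conv_add_uminus)

lemma K_power: "x \<in> K \<Longrightarrow> x ^ k \<in> K"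
  by (induction k) (auto intro: K_closed)

lemma K_sum: "(\<And>i. i \<in> I \<Longrightarrow> f i \<in> K) \<Longrightarrow> (\<Sum>i\<in>I. f i) \<in> K"
  by (induction I rule: infinite_finite_induct) (auto intro: K_closed)

lemma K_of_int: "of_int k \<in> K"
  using K_closed(7)[of "of_int k"] by simp

lemma conjg_simps:
  assumes "z \<in> R"
  shows "conjg z (of_rat q) = of_rat q" "conjg z 0 = 0" "conjg z 1 = 1" "conjg z (of_int k) = of_int k"
    "x \<in> K \<Longrightarrow> y \<in> K \<Longrightarrow> conjg z (x + y) = conjg z x + conjg z y"
    "x \<in> K \<Longrightarrow> y \<in> K \<Longrightarrow> conjg z (x - y) = conjg z x - conjg z y"
    "x \<in> K \<Longrightarrow> y \<in> K \<Longrightarrow> conjg z (x * y) = conjg z x * conjg z y"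
    "x \<in> K \<Longrightarrow> conjg z (x ^ j) = conjg z x ^ j"
proof -
  show rat: "conjg z (of_rat q) = of_rat q" for q using conjg_rat_eval[OF assms, of "[:q:]"] by simp
  show "conjg z 0 = 0" "conjg z 1 = 1" "conjg z (of_int k) = of_int k"
    using rat[of 0] rat[of 1] rat[of "of_int k"] by simp_all
  show "conjg z (x + y) = conjg z x + conjg z y" "conjg z (x - y) = conjg z x - conjg z y"
    "conjg z (x * y) = conjg z x * conjg z y" if "x \<in> K" "y \<in> K"
    using that
    by (elim KE; simp add: conjg_rat_eval[OF assms] rat_eval_simps(4,5,7)[symmetric] del: rat_eval_simps(4,5,7))+
  show "conjg z (x ^ j) = conjg z x ^ j" if "x \<in> K"
    using that
    by (elim KE; simp add: conjg_rat_eval[OF assms] rat_eval_simps(8)[symmetric] del: rat_eval_simps(8))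
qed

lemma conjg_sum: "z \<in> R \<Longrightarrow> (\<And>i. i \<in> I \<Longrightarrow> f i \<in> K) \<Longrightarrow> conjg z (\<Sum>i\<in>I. f i) = (\<Sum>i\<in>I. conjg z (f i))"
  by (induction I rule: infinite_finite_induct) (auto simp: conjg_simps K_sum)

lemma conjg_eq_0_iff: "z \<in> R \<Longrightarrow> x \<in> K \<Longrightarrow> conjg z x = 0 \<longleftrightarrow> x = 0"
  by (elim KE) (simp add: conjg_rat_eval rat_eval_eq_0_iff \<alpha>)

lemma conjg_hom: "z \<in> R \<Longrightarrow> (\<And>x. x \<in> K \<Longrightarrow> conjg z x \<in> L) \<Longrightarrow> restrict (conjg z) K \<in> embeddings K L"
  unfolding embeddings_def
  by (intro IntI subring_of_homI) (auto simp: conjg_simps K_closed)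

lemma embedding_eq_conj:
  assumes "\<phi> \<in> embeddings K L"
  shows "\<phi> \<alpha> \<in> R \<inter> L" "\<phi> = restrict (conjg (\<phi> \<alpha>)) K"
proof -
  have hom: "\<phi> \<in> Ring.ring_hom (subring_of K) (subring_of L)" and ext: "\<phi> \<in> extensional K"
    using assms by (auto simp: embeddings_def)
  note ev = hom_rat_eval[OF subfield_K hom \<alpha>_K]
  have "rat_eval F (\<phi> \<alpha>) = \<phi> 0" using ev[of F] \<alpha> by (simp add: R_def)
  also have "\<dots> = 0" using ev[of 0] by simp
  finally show R: "\<phi> \<alpha> \<in> R \<inter> L" using subring_of_homD(1)[OF hom \<alpha>_K] by (simp add: R_def)
  show "\<phi> = restrict (conjg (\<phi> \<alpha>)) K"
  proof (rule extensionalityI[OF ext])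
    fix x assume x: "x \<in> K"
    then obtain p where "x = rat_eval p \<alpha>" using KE by blast
    thus "\<phi> x = restrict (conjg (\<phi> \<alpha>)) K x" using x R ev[of p] by (simp add: conjg_rat_eval)
  qed simp
qed

lemma conjg_in_subfield:
  assumes "subfield L complex_ring" "z \<in> L" "z \<in> R" "x \<in> K"
  shows "conjg z x \<in> L"
  using assms by (auto elim!: KE simp: conjg_rat_eval intro: subfield_rat_eval)

text \<open>An embedding is determined by the image of \<alpha>, which must be a root of F. The
  target stays general: \<open>UNIV\<close> serves the discriminant, the splitting field the
  permutation action.\<close>

lemma embeddings_eq:
  assumes "subfield L complex_ring" "R \<subseteq> L"
  shows "embeddings K L = (\<lambda>z. restrict (conjg z) K) ` R"
proof (intro equalityI subsetI)
  fix \<phi> assume "\<phi> \<in> embeddings K L"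
  from embedding_eq_conj[OF this] show "\<phi> \<in> (\<lambda>z. restrict (conjg z) K) ` R" by auto
next
  fix \<phi> assume "\<phi> \<in> (\<lambda>z. restrict (conjg z) K) ` R"
  thus "\<phi> \<in> embeddings K L" using assms by (auto intro!: conjg_hom conjg_in_subfield)
qed

lemma subfield_UNIV: "subfield UNIV complex_ring" by (rule subfield_complexI) auto

lemmas embeddings_UNIV = embeddings_eq[OF subfield_UNIV subset_UNIV]

lemma inj_on_restrict_conjg: "inj_on (\<lambda>z. restrict (conjg z) K) R"
proof (rule inj_onI)
  fix z w assume "z \<in> R" "w \<in> R" "restrict (conjg z) K = restrict (conjg w) K"
  hence "conjg z \<alpha> = conjg w \<alpha>" using \<alpha>_K by (metis restrict_apply)
  thus "z = w" using \<open>z \<in> R\<close> \<open>w \<in> R\<close> by (simp add: conjg_\<alpha>)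
qed

lemma trace_rat: "x \<in> K \<Longrightarrow> (\<Sum>z\<in>R. conjg z x) \<in> \<rat>"
  using trace_rational[OF monic_F R_def] card_R degree_F by (elim KE) (simp add: conjg_rat_eval)

text \<open>If x = p(\<alpha>) is a zero of a monic integer polynomial g, then F divides the
  composition of g with p, so g also annihilates p(z).\<close>

lemma conjg_algebraic_int: "z \<in> R \<Longrightarrow> x \<in> K \<Longrightarrow> algebraic_int x \<Longrightarrow> algebraic_int (conjg z x)"
proof -
  assume z: "z \<in> R" and x: "x \<in> K" and a: "algebraic_int x"
  obtain f :: "int poly" where f: "poly (map_poly of_int f) x = 0" "lead_coeff f = 1"
    using a unfolding algebraic_int_altdef_ipoly by blast
  define g where "g = (map_poly of_int f :: rat poly)"
  have g: "map_poly of_rat g = (map_poly of_int f :: complex poly)"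
    by (simp add: g_def map_poly_map_poly comp_def)
  obtain p where p: "x = rat_eval p \<alpha>" using KE[OF x] .
  have comp: "rat_eval (pcompose g p) w = poly (map_poly of_int f) (rat_eval p w)" for w
    unfolding rat_eval_def g[symmetric] by (simp add: of_rat_hom.map_poly_pcompose poly_pcompose)
  have "F dvd pcompose g p" using comp[of \<alpha>] f p rat_eval_eq_0_iff[OF \<alpha>] by simp
  hence "rat_eval (pcompose g p) z = 0" using rat_eval_eq_0_iff[OF z] by simp
  hence "poly (map_poly of_int f) (conjg z x) = 0"
    using comp[of z] z by (simp add: p conjg_rat_eval)
  thus ?thesis unfolding algebraic_int_altdef_ipoly using f(2) by blast
qed

lemma cnj_R: "cnj z \<in> R \<longleftrightarrow> z \<in> R"
  by (simp add: R_def rat_eval_cnj)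

lemma conjg_cnj: "z \<in> R \<Longrightarrow> x \<in> K \<Longrightarrow> conjg (cnj z) x = cnj (conjg z x)"
  by (elim KE) (simp add: conjg_rat_eval cnj_R rat_eval_cnj)

text \<open>The powers of \<alpha> are adjoined one at a time to follow the inductive definition of
  dimension. If \<open>\<alpha> ^ k\<close> with k < n were in the span of the earlier powers, F
  would have a nonzero multiple of degree below n.\<close>

lemma number_field_K: "number_field n K"
proof -
  interpret ring complex_ring by (rule ring_complex_ring)
  define E where "E k = {rat_eval p \<alpha> |p. p = 0 \<or> Polynomial.degree p < k}" for k
  have line: "line_extension \<rat> (\<alpha> ^ k) (E k) = E (Suc k)" for k
  proof (intro equalityI subsetI)
    fix x assume "x \<in> line_extension \<rat> (\<alpha> ^ k) (E k)"
    then obtain q p where *: "x = of_rat q * \<alpha> ^ k + rat_eval p \<alpha>" "p = 0 \<or> Polynomial.degree p < k"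
      by (auto simp: line_extension_mem_iff E_def Rats_def)
    have "x = rat_eval ([:q:] * [:0, 1:] ^ k + p) \<alpha>" by (simp add: * del: mult_pCons_left mult_pCons_right)
    moreover have "[:q:] * [:0, 1:] ^ k = Polynomial.monom q k" by (simp add: monom_altdef)
    moreover have "Polynomial.degree (Polynomial.monom q k + p) < Suc k"
      using * degree_monom_le[of q k] by (intro degree_add_less) (auto simp: less_Suc_eq_le)
    ultimately show "x \<in> E (Suc k)"
      unfolding E_def by (intro CollectI exI[of _ "Polynomial.monom q k + p"]) (metis (no_types, lifting))
  next
    fix x assume "x \<in> E (Suc k)"
    then obtain p where p: "x = rat_eval p \<alpha>" and "p = 0 \<or> Polynomial.degree p < Suc k"
      by (auto simp: E_def)
    hence dp: "Polynomial.degree p < Suc k" by auto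
    define r where "r = p - Polynomial.monom (poly.coeff p k) k"
    have r: "r = 0 \<or> Polynomial.degree r < k"
    proof (cases "r = 0")
      case False
      have "\<forall>j\<ge>k. poly.coeff r j = 0" using dp by (auto simp: r_def coeff_eq_0)
      thus ?thesis using False by (metis leading_coeff_0_iff not_le)
    qed simp
    have "p = [:poly.coeff p k:] * [:0, 1:] ^ k + r" by (simp add: r_def monom_altdef)
    hence "x = rat_eval ([:poly.coeff p k:] * [:0, 1:] ^ k + r) \<alpha>" using p by metis
    hence "x = of_rat (poly.coeff p k) * \<alpha> ^ k + rat_eval r \<alpha>"
      by (simp del: mult_pCons_left mult_pCons_right)
    moreover have "rat_eval r \<alpha> \<in> E k" using r by (auto simp: E_def)
    moreover have "complex_of_rat (poly.coeff p k) \<in> \<rat>" by simp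
    ultimately show "x \<in> line_extension \<rat> (\<alpha> ^ k) (E k)"
      unfolding line_extension_mem_iff complex_ring_simps by blast
  qed
  have "dimension k \<rat> (E k)" if "k \<le> n" for k
    using that
  proof (induction k)
    case 0
    have "E 0 = {\<zero>\<^bsub>complex_ring\<^esub>}" by (auto simp: E_def)
    thus ?case using zero_dim by metis
  next
    case (Suc k)
    have "\<alpha> ^ k \<notin> E k"
    proof
      assume "\<alpha> ^ k \<in> E k"
      then obtain p where p: "\<alpha> ^ k = rat_eval p \<alpha>" "p = 0 \<or> Polynomial.degree p < k"
        by (auto simp: E_def)
      define q where "q = Polynomial.monom 1 k - p"
      have "rat_eval q \<alpha> = rat_eval ([:0, 1:] ^ k - p) \<alpha>" by (simp add: q_def monom_altdef)
      hence "F dvd q" using p rat_eval_eq_0_iff[OF \<alpha>] by simp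
      moreover have "poly.coeff q k = 1" using p(2) by (auto simp: q_def coeff_eq_0)
      hence "q \<noteq> 0" by auto
      moreover have "Polynomial.degree q \<le> k"
        using p(2) by (auto simp: q_def degree_monom_eq intro!: degree_diff_le)
      ultimately have "n \<le> k" using dvd_imp_degree_le[of F q] degree_F by simp
      thus False using Suc by simp
    qed
    thus ?case using Suc_dim[of "\<alpha> ^ k" "E k" k \<rat>] Suc line[of k] by simp
  qed
  moreover have "E n = K"
  proof (intro equalityI subsetI)
    fix x assume "x \<in> K"
    thus "x \<in> E n" by (elim KE_mod) (auto simp: E_def)
  qed (auto simp: E_def KI K_closed)
  ultimately show ?thesis unfolding number_field_def using subfield_K by (metis order_refl)
qed

end

section \<open>Determinants\<close>

text \<open>The determinant of the transpose times the matrix. For conjugates, the entries on the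
  right are traces, hence rational and independent of the enumeration of the embeddings.\<close>

lemma det_square_gram:
  fixes a :: "nat \<Rightarrow> nat \<Rightarrow> 'a :: comm_ring_1"
  shows "det (Matrix.mat n n (\<lambda>(i, j). a i j)) ^ 2 =
    det (Matrix.mat n n (\<lambda>(j, k). \<Sum>i<n. a i j * a i k))"
proof -
  define M where "M = Matrix.mat n n (\<lambda>(i, j). a i j)"
  have M: "M \<in> carrier_mat n n" by (simp add: M_def)
  have "transpose_mat M * M = Matrix.mat n n (\<lambda>(j, k). \<Sum>i<n. a i j * a i k)"
    by (rule eq_matI) (auto simp: M_def scalar_prod_def atLeast0LessThan)
  moreover have "det (transpose_mat M * M) = det M ^ 2"
    using M by (simp add: det_mult[of _ n] det_transpose power2_eq_square)
  ultimately show ?thesis by (simp add: M_def)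
qed

lemma det_nonzero_iff:
  fixes a :: "nat \<Rightarrow> nat \<Rightarrow> 'a :: field"
  shows "det (Matrix.mat n n (\<lambda>(i, j). a i j)) \<noteq> 0 \<longleftrightarrow>
    (\<forall>c. (\<forall>i<n. (\<Sum>j<n. a i j * c j) = 0) \<longrightarrow> (\<forall>j<n. c j = 0))"
proof -
  define M where "M = Matrix.mat n n (\<lambda>(i, j). a i j)"
  have M: "M \<in> carrier_mat n n" by (simp add: M_def)
  have Mv: "M *\<^sub>v v = 0\<^sub>v n \<longleftrightarrow> (\<forall>i<n. (\<Sum>j<n. a i j * v $ j) = 0)" if "v \<in> carrier_vec n" for v
    using that by (auto simp: M_def vec_eq_iff scalar_prod_def atLeast0LessThan)
  have "det M = 0 \<longleftrightarrow> (\<exists>v. v \<in> carrier_vec n \<and> v \<noteq> 0\<^sub>v n \<and> M *\<^sub>v v = 0\<^sub>v n)"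
    using M by (rule det_0_iff_vec_prod_zero)
  also have "\<dots> \<longleftrightarrow> (\<exists>c. (\<forall>i<n. (\<Sum>j<n. a i j * c j) = 0) \<and> (\<exists>j<n. c j \<noteq> 0))"
  proof
    assume "\<exists>v. v \<in> carrier_vec n \<and> v \<noteq> 0\<^sub>v n \<and> M *\<^sub>v v = 0\<^sub>v n"
    then obtain v where v: "v \<in> carrier_vec n" "v \<noteq> 0\<^sub>v n" "M *\<^sub>v v = 0\<^sub>v n" by blast
    have "\<exists>j<n. v $ j \<noteq> 0" using v(1,2) by (auto simp: vec_eq_iff)
    thus "\<exists>c. (\<forall>i<n. (\<Sum>j<n. a i j * c j) = 0) \<and> (\<exists>j<n. c j \<noteq> 0)"
      using Mv[OF v(1)] v(3) by (intro exI[of _ "\<lambda>j. v $ j"]) auto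
  next
    assume "\<exists>c. (\<forall>i<n. (\<Sum>j<n. a i j * c j) = 0) \<and> (\<exists>j<n. c j \<noteq> 0)"
    then obtain c where c: "\<forall>i<n. (\<Sum>j<n. a i j * c j) = 0" "\<exists>j<n. c j \<noteq> 0" by blast
    have "M *\<^sub>v Matrix.vec n c = 0\<^sub>v n" using c(1) by (subst Mv) auto
    moreover have "Matrix.vec n c \<noteq> 0\<^sub>v n" using c(2) by (auto simp: vec_eq_iff)
    ultimately show "\<exists>v. v \<in> carrier_vec n \<and> v \<noteq> 0\<^sub>v n \<and> M *\<^sub>v v = 0\<^sub>v n"
      by (intro exI[of _ "Matrix.vec n c"]) simp
  qed
  finally show ?thesis unfolding M_def by blast
qed

lemma linear_system_solvable:
  fixes a :: "nat \<Rightarrow> nat \<Rightarrow> 'a :: field"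
  assumes "det (Matrix.mat n n (\<lambda>(i, j). a i j)) \<noteq> 0"
  shows "\<exists>c. \<forall>i<n. (\<Sum>j<n. a i j * c j) = b i"
proof -
  define M where "M = Matrix.mat n n (\<lambda>(i, j). a i j)"
  have M: "M \<in> carrier_mat n n" by (simp add: M_def)
  note adj = adj_mat[OF M]
  define v where "v = inverse (det M) \<cdot>\<^sub>v (adj_mat M *\<^sub>v Matrix.vec n b)"
  have v: "v \<in> carrier_vec n" using adj by (simp add: v_def)
  have "M *\<^sub>v v = inverse (det M) \<cdot>\<^sub>v (M *\<^sub>v (adj_mat M *\<^sub>v Matrix.vec n b))"
    unfolding v_def using M adj by (intro mult_mat_vec[of M n n]) auto
  also have "M *\<^sub>v (adj_mat M *\<^sub>v Matrix.vec n b) = (M * adj_mat M) *\<^sub>v Matrix.vec n b"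
    using M adj by (intro assoc_mult_mat_vec[symmetric]) auto
  also have "inverse (det M) \<cdot>\<^sub>v \<dots> = Matrix.vec n b"
    using assms unfolding adj(2) M_def[symmetric]
    by (auto simp: vec_eq_iff scalar_prod_def if_distrib if_distribR sum.delta cong: if_cong)
  finally have *: "M *\<^sub>v v = Matrix.vec n b" .
  show ?thesis
  proof (intro exI allI impI)
    fix i assume i: "i < n"
    have "(M *\<^sub>v v) $ i = (\<Sum>j<n. a i j * v $ j)"
      using i v by (auto simp: M_def scalar_prod_def atLeast0LessThan)
    thus "(\<Sum>j<n. a i j * v $ j) = b i" using * i by simp
  qed
qed

text \<open>Leibniz expansion: n! terms, each bounded by c. This is cruder than Hadamard's
  inequality but affects only constants.\<close>

lemma norm_det_le:
  fixes a :: "nat \<Rightarrow> nat \<Rightarrow> complex"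
  assumes "\<And>p. p permutes {0..<n} \<Longrightarrow> (\<Prod>i<n. cmod (a i (p i))) \<le> c"
  shows "cmod (det (Matrix.mat n n (\<lambda>(i, j). a i j))) \<le> fact n * c"
proof -
  let ?P = "{p. p permutes {0..<n}}"
  have "cmod (det (Matrix.mat n n (\<lambda>(i, j). a i j))) =
      cmod (\<Sum>p\<in>?P. signof p * (\<Prod>i=0..<n. a i (p i)))"
    by (subst det_def'[of _ n]) (auto intro!: arg_cong[of _ _ cmod] sum.cong prod.cong simp: permutes_in_image)
  also have "\<dots> \<le> (\<Sum>p\<in>?P. cmod (signof p * (\<Prod>i=0..<n. a i (p i))))"
    by (rule norm_sum)
  also have "\<dots> \<le> (\<Sum>p\<in>?P. c)"
  proof (rule sum_mono)
    fix p assume "p \<in> ?P"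
    hence "(\<Prod>i<n. cmod (a i (p i))) \<le> c" using assms by simp
    thus "cmod (signof p * (\<Prod>i=0..<n. a i (p i))) \<le> c"
      by (simp add: norm_mult prod_norm[symmetric] atLeast0LessThan sign_def)
  qed
  also have "\<dots> = fact n * c" by (simp add: card_permutations)
  finally show ?thesis .
qed

text \<open>Every permutation contributes the exponent 0 + ... + (n - 1) = n(n - 1)/2, and the
  square doubles it. This is the origin of the exponent 1/(n(n - 1)) in the cell size.\<close>

lemma norm_det_powers_le:
  assumes "\<And>i. i < n \<Longrightarrow> cmod (b i) \<le> T"
  shows "cmod (det (Matrix.mat n n (\<lambda>(i, j). b i ^ j))) ^ 2 \<le> (fact n) ^ 2 * T ^ (n * (n - 1))"
proof -
  have "cmod (det (Matrix.mat n n (\<lambda>(i, j). b i ^ j))) \<le> fact n * T ^ (\<Sum>i<n. i)"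
  proof (rule norm_det_le)
    fix p assume p: "p permutes {0..<n}"
    have "(\<Prod>i<n. cmod (b i ^ p i)) \<le> (\<Prod>i<n. T ^ p i)"
      using assms by (intro prod_mono) (auto simp: norm_power intro: power_mono)
    also have "\<dots> = T ^ (\<Sum>i<n. p i)" by (simp add: power_sum)
    also have "(\<Sum>i<n. p i) = (\<Sum>i<n. i)"
      using sum.permute[OF p, of "\<lambda>i. i"] by (simp add: atLeast0LessThan comp_def)
    finally show "(\<Prod>i<n. cmod (b i ^ p i)) \<le> T ^ (\<Sum>i<n. i)" .
  qed
  hence "cmod (det (Matrix.mat n n (\<lambda>(i, j). b i ^ j))) ^ 2 \<le> (fact n * T ^ (\<Sum>i<n. i)) ^ 2"
    by (intro power_mono) auto
  also have "\<dots> = (fact n) ^ 2 * T ^ ((\<Sum>i<n. i) * 2)"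
    by (simp add: power_mult_distrib power_mult)
  also have "(\<Sum>i<n. i) * 2 = n * (n - 1)"
  proof (induction n)
    case (Suc n)
    thus ?case by (cases n) (auto simp: algebra_simps)
  qed simp
  finally show ?thesis .
qed

text \<open>No row carries an exponent above n - 1, so each term is bounded by a power of the
  product of the \<open>max 1 (cmod (b i))\<close>. Applied to the roots, this gives the growth
  B^(2n-2) of the discriminants.\<close>

lemma norm_det_powers_le':
  "cmod (det (Matrix.mat n n (\<lambda>(i, j). b i ^ j))) ^ 2 \<le>
     (fact n) ^ 2 * (\<Prod>i<n. max 1 (cmod (b i))) ^ (2 * (n - 1))"
proof -
  have "cmod (det (Matrix.mat n n (\<lambda>(i, j). b i ^ j))) \<le> fact n * (\<Prod>i<n. max 1 (cmod (b i))) ^ (n - 1)"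
  proof (rule norm_det_le)
    fix p assume p: "p permutes {0..<n}"
    have "(\<Prod>i<n. cmod (b i ^ p i)) \<le> (\<Prod>i<n. max 1 (cmod (b i)) ^ (n - 1))"
    proof (intro prod_mono conjI)
      fix i assume "i \<in> {..<n}"
      hence "p i < n" using permutes_in_image[OF p, of i] by auto
      have "cmod (b i ^ p i) \<le> max 1 (cmod (b i)) ^ p i"
        by (simp add: norm_power power_mono)
      also have "\<dots> \<le> max 1 (cmod (b i)) ^ (n - 1)"
        using \<open>p i < n\<close> by (intro power_increasing) auto
      finally show "cmod (b i ^ p i) \<le> max 1 (cmod (b i)) ^ (n - 1)" .
    qed auto
    thus "(\<Prod>i<n. cmod (b i ^ p i)) \<le> (\<Prod>i<n. max 1 (cmod (b i))) ^ (n - 1)"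
      by (simp add: prod_power_distrib)
  qed
  hence "cmod (det (Matrix.mat n n (\<lambda>(i, j). b i ^ j))) ^ 2 \<le>
      (fact n * (\<Prod>i<n. max 1 (cmod (b i))) ^ (n - 1)) ^ 2"
    by (intro power_mono) auto
  thus ?thesis by (simp add: power_mult_distrib power_mult[symmetric] mult.commute)
qed

section \<open>Integral bases and the discriminant\<close>

context root_field
begin

definition zs :: "nat \<Rightarrow> complex" where "zs = (SOME h. bij_betw h {..<n} R)"

lemma zs: "bij_betw zs {..<n} R"
proof -
  have "\<exists>h. bij_betw h {..<n} R"
    using ex_bij_betw_nat_finite[OF finite_R] card_R by (simp add: atLeast0LessThan)
  thus ?thesis unfolding zs_def by (rule someI_ex)
qed

lemma zs_R: "i < n \<Longrightarrow> zs i \<in> R" using zs by (auto simp: bij_betw_def)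

definition OK where "OK = ring_of_integers K"

lemma OK_iff: "x \<in> OK \<longleftrightarrow> x \<in> K \<and> algebraic_int x"
  by (simp add: OK_def ring_of_integers_def)

lemma OK_closed:
  "x \<in> OK \<Longrightarrow> y \<in> OK \<Longrightarrow> x + y \<in> OK" "x \<in> OK \<Longrightarrow> y \<in> OK \<Longrightarrow> x - y \<in> OK"
  "x \<in> OK \<Longrightarrow> y \<in> OK \<Longrightarrow> x * y \<in> OK" "x \<in> OK \<Longrightarrow> x ^ j \<in> OK" "of_int k \<in> OK"
  by (auto simp: OK_iff K_closed K_diff K_power K_of_int algebraic_int_add algebraic_int_diff
      algebraic_int_mult algebraic_int_power)

definition conj_mat :: "(nat \<Rightarrow> complex) \<Rightarrow> complex mat" where
  "conj_mat \<theta> = Matrix.mat n n (\<lambda>(i, j). conjg (zs i) (\<theta> j))"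

lemma conj_mat_carrier [simp]: "conj_mat \<theta> \<in> carrier_mat n n" by (simp add: conj_mat_def)

text \<open>The determinant of the trace form is preferred to the square of
  \<open>det (conj_mat \<theta>)\<close> because its entries are rational; the two agree by
  \<open>disc_conv_det\<close>.\<close>

definition disc :: "(nat \<Rightarrow> complex) \<Rightarrow> complex" where
  "disc \<theta> = det (Matrix.mat n n (\<lambda>(j, k). \<Sum>z\<in>R. conjg z (\<theta> j) * conjg z (\<theta> k)))"

lemma disc_conv_det: "disc \<theta> = det (conj_mat \<theta>) ^ 2"
  unfolding disc_def conj_mat_def det_square_gram by (simp add: sum.reindex_bij_betw[OF zs, symmetric])

lemma trace_mult: "x \<in> K \<Longrightarrow> y \<in> K \<Longrightarrow> (\<Sum>z\<in>R. conjg z x * conjg z y) \<in> \<rat>"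
  using trace_rat[of "x * y"] by (simp add: conjg_simps K_closed)

lemma disc_int:
  assumes "\<And>j. j < n \<Longrightarrow> \<theta> j \<in> OK"
  shows "disc \<theta> \<in> \<int>"
proof (rule rational_algebraic_int_is_int)
  show "disc \<theta> \<in> \<rat>"
    unfolding disc_def
  proof (rule rational_det)
    fix j k assume "j < n" "k < n"
    thus "Matrix.mat n n (\<lambda>(j, k). \<Sum>z\<in>R. conjg z (\<theta> j) * conjg z (\<theta> k)) $$ (j, k) \<in> \<rat>"
      using trace_mult[of "\<theta> j" "\<theta> k"] assms by (simp add: OK_iff)
  qed simp
  show "algebraic_int (disc \<theta>)"
    unfolding disc_def using assms
    by (intro algebraic_int_det)
      (auto simp: OK_iff intro!: algebraic_int_sum algebraic_int_mult conjg_algebraic_int)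
qed

text \<open>Solving for the coordinates through the conjugates would only give complex numbers.
  Pairing with each \<theta> j under the trace yields a rational system, invertible since its
  determinant is the square of the given one.\<close>

lemma coordinates:
  assumes \<theta>: "\<And>j. j < n \<Longrightarrow> \<theta> j \<in> K" and det: "det (conj_mat \<theta>) \<noteq> 0" and x: "x \<in> K"
  obtains q :: "nat \<Rightarrow> rat" where "x = (\<Sum>j<n. of_rat (q j) * \<theta> j)"
proof -
  have "\<exists>G. \<forall>j<n. \<forall>k<n. (\<Sum>z\<in>R. conjg z (\<theta> j) * conjg z (\<theta> k)) = of_rat (G j k)"
  proof -
    have "\<forall>j k. \<exists>r. j < n \<longrightarrow> k < n \<longrightarrow> (\<Sum>z\<in>R. conjg z (\<theta> j) * conjg z (\<theta> k)) = of_rat r"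
      using trace_mult[OF \<theta> \<theta>] by (metis Rats_cases)
    thus ?thesis by metis
  qed
  then obtain G where G: "\<And>j k. j < n \<Longrightarrow> k < n \<Longrightarrow>
    (\<Sum>z\<in>R. conjg z (\<theta> j) * conjg z (\<theta> k)) = of_rat (G j k)" by blast
  have "\<forall>j. \<exists>r. j < n \<longrightarrow> (\<Sum>z\<in>R. conjg z (\<theta> j) * conjg z x) = of_rat r"
    using trace_mult[OF \<theta> x] by (metis Rats_cases)
  then obtain t where t: "\<And>j. j < n \<Longrightarrow> (\<Sum>z\<in>R. conjg z (\<theta> j) * conjg z x) = of_rat (t j)"
    by metis
  have "disc \<theta> = det (map_mat of_rat (Matrix.mat n n (\<lambda>(j, k). G j k)))"
    unfolding disc_def by (intro arg_cong[of _ _ det] eq_matI) (auto simp: G)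
  also have "\<dots> = of_rat (det (Matrix.mat n n (\<lambda>(j, k). G j k)))"
    by (rule of_rat_hom.hom_det)
  finally have "det (Matrix.mat n n (\<lambda>(j, k). G j k)) \<noteq> 0"
    using det by (auto simp: disc_conv_det)
  then obtain q where q: "\<And>j. j < n \<Longrightarrow> (\<Sum>k<n. G j k * q k) = t j"
    using linear_system_solvable[of n G t] by blast
  define y where "y = x - (\<Sum>k<n. of_rat (q k) * \<theta> k)"
  have sK: "(\<Sum>k<n. of_rat (q k) * \<theta> k) \<in> K" using \<theta> by (auto intro!: K_sum K_closed)
  have y: "y \<in> K" using x sK by (simp add: y_def K_diff)
  have conj_y: "conjg z y = conjg z x - (\<Sum>k<n. of_rat (q k) * conjg z (\<theta> k))" if "z \<in> R" for z
  proof -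
    have "conjg z (\<Sum>k<n. of_rat (q k) * \<theta> k) = (\<Sum>k<n. of_rat (q k) * conjg z (\<theta> k))"
      using that \<theta> by (subst conjg_sum) (auto simp: conjg_simps K_closed)
    thus ?thesis using that x sK by (simp add: y_def conjg_simps)
  qed
  have tr0: "(\<Sum>z\<in>R. conjg z (\<theta> j) * conjg z y) = 0" if "j < n" for j
  proof -
    have "(\<Sum>z\<in>R. conjg z (\<theta> j) * conjg z y) = (\<Sum>z\<in>R. conjg z (\<theta> j) * conjg z x) -
        (\<Sum>z\<in>R. \<Sum>k<n. of_rat (q k) * (conjg z (\<theta> j) * conjg z (\<theta> k)))"
      by (simp add: conj_y algebra_simps sum_subtractf sum_distrib_left)
    also have "(\<Sum>z\<in>R. \<Sum>k<n. of_rat (q k) * (conjg z (\<theta> j) * conjg z (\<theta> k))) =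
        (\<Sum>k<n. of_rat (q k) * (\<Sum>z\<in>R. conjg z (\<theta> j) * conjg z (\<theta> k)))"
      by (subst sum.swap) (simp add: sum_distrib_left)
    also have "\<dots> = of_rat (\<Sum>k<n. G j k * q k)"
      using that by (simp add: G of_rat_sum of_rat_mult) (simp add: mult.commute)
    finally show ?thesis using that q t by simp
  qed
  \<comment> \<open>The defect y is orthogonal to every \<theta> j under the trace, so its vector of
    conjugates lies in the kernel of the transposed matrix, which is trivial.\<close>
  have "det (transpose_mat (conj_mat \<theta>)) \<noteq> 0" using det by (simp add: det_transpose[of _ n])
  also have "transpose_mat (conj_mat \<theta>) = Matrix.mat n n (\<lambda>(j, i). conjg (zs i) (\<theta> j))"
    by (rule eq_matI) (auto simp: conj_mat_def)
  finally have "\<forall>c. (\<forall>j<n. (\<Sum>i<n. conjg (zs i) (\<theta> j) * c i) = 0) \<longrightarrow> (\<forall>i<n. c i = 0)"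
    unfolding det_nonzero_iff .
  note * = spec[OF this, of "\<lambda>i. conjg (zs i) y"]
  have "(\<Sum>i<n. conjg (zs i) (\<theta> j) * conjg (zs i) y) = 0" if "j < n" for j
    using tr0[OF that] by (simp add: sum.reindex_bij_betw[OF zs, of "\<lambda>z. conjg z (\<theta> j) * conjg z y"])
  hence "conjg (zs 0) y = 0" using * n_pos by blast
  hence "y = 0" using conjg_eq_0_iff[OF zs_R[OF n_pos] y] by simp
  thus ?thesis using that by (simp add: y_def)
qed

lemma det_conj_mat_powers:
  assumes "x \<in> K"
  shows "det (conj_mat (\<lambda>j. x ^ j)) = det (Matrix.mat n n (\<lambda>(i, j). conjg (zs i) x ^ j))"
  unfolding conj_mat_def
  by (intro arg_cong[of _ _ det] eq_matI) (auto simp: conjg_simps zs_R assms)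

text \<open>Vandermonde: a vector in the kernel is the coefficient list of a polynomial of degree
  below n that vanishes at the n distinct conjugates of x.\<close>

lemma det_conj_mat_powers_nonzero:
  assumes x: "x \<in> K" and inj: "inj_on (\<lambda>z. conjg z x) R"
  shows "det (conj_mat (\<lambda>j. x ^ j)) \<noteq> 0"
  unfolding det_conj_mat_powers[OF x] det_nonzero_iff
proof (intro allI impI)
  fix c j assume c: "\<forall>i<n. (\<Sum>j<n. conjg (zs i) x ^ j * c j) = 0" and j: "j < n"
  define p where "p = (\<Sum>j<n. Polynomial.monom (c j) j)"
  have "p = 0"
  proof (rule poly_zero_if_many_roots[of _ "(\<lambda>z. conjg z x) ` R"])
    have "Polynomial.degree p \<le> n - 1"
      unfolding p_def by (intro degree_sum_le) (auto intro: order.trans[OF degree_monom_le])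
    thus "Polynomial.degree p < card ((\<lambda>z. conjg z x) ` R)"
      using n_pos by (simp add: card_image[OF inj] card_R)
    fix w assume "w \<in> (\<lambda>z. conjg z x) ` R"
    then obtain z where "z \<in> R" "w = conjg z x" by blast
    then obtain i where "i < n" "w = conjg (zs i) x"
      using bij_betw_imp_surj_on[OF zs] by (metis imageE lessThan_iff)
    thus "poly p w = 0" using c by (simp add: p_def poly_sum poly_monom mult.commute)
  qed
  hence "poly.coeff p j = 0" by simp
  thus "c j = 0" using j by (simp add: p_def coeff_sum)
qed

definition OK_tuple :: "(nat \<Rightarrow> complex) \<Rightarrow> bool" where
  "OK_tuple \<theta> \<longleftrightarrow> (\<forall>j<n. \<theta> j \<in> OK) \<and> det (conj_mat \<theta>) \<noteq> 0"

text \<open>Discriminants of tuples of integers are rational integers, so their absolute values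
  attain a minimum; the powers of \<alpha> provide a tuple to start from.\<close>

lemma minimal_tuple:
  assumes "\<alpha> \<in> OK"
  obtains \<omega> where "OK_tuple \<omega>" "\<And>\<theta>. OK_tuple \<theta> \<Longrightarrow> cmod (disc \<omega>) \<le> cmod (disc \<theta>)"
proof -
  have inj: "inj_on (\<lambda>z. conjg z \<alpha>) R" by (intro inj_onI) (simp add: conjg_\<alpha>)
  have 1: "OK_tuple (\<lambda>j. \<alpha> ^ j)"
    using assms det_conj_mat_powers_nonzero[OF \<alpha>_K inj] by (simp add: OK_tuple_def OK_closed)
  have nat: "\<exists>k::nat. cmod (disc \<theta>) = real k" if "OK_tuple \<theta>" for \<theta>
  proof -
    have "disc \<theta> \<in> \<int>" using that by (intro disc_int) (simp add: OK_tuple_def)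
    then obtain k where "disc \<theta> = of_int k" by (auto simp: Ints_def)
    thus ?thesis by (intro exI[of _ "nat \<bar>k\<bar>"]) simp
  qed
  define m where "m \<theta> = nat \<lfloor>cmod (disc \<theta>)\<rfloor>" for \<theta>
  obtain \<omega> where \<omega>: "OK_tuple \<omega>" "\<And>\<theta>. OK_tuple \<theta> \<Longrightarrow> m \<omega> \<le> m \<theta>"
    using ex_has_least_nat[of OK_tuple _ m, OF 1] by blast
  show ?thesis
  proof (rule that[OF \<omega>(1)])
    fix \<theta> assume "OK_tuple \<theta>"
    thus "cmod (disc \<omega>) \<le> cmod (disc \<theta>)"
      using \<omega>(2)[of \<theta>] nat[of \<theta>] nat[OF \<omega>(1)] by (auto simp: m_def)
  qed
qed

text \<open>If some coordinate of an integer were not integral, then replacing the corresponding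
  basis element by the fractional part would make the discriminant smaller.\<close>

lemma minimal_tuple_integral_basis:
  assumes \<omega>: "OK_tuple \<omega>" and min: "\<And>\<theta>. OK_tuple \<theta> \<Longrightarrow> cmod (disc \<omega>) \<le> cmod (disc \<theta>)"
  shows "integral_basis n K \<omega>"
  unfolding integral_basis_def OK_def[symmetric]
proof (intro conjI ballI allI impI)
  show "\<omega> i \<in> OK" if "i < n" for i using \<omega> that by (simp add: OK_tuple_def)
  have det: "det (conj_mat \<omega>) \<noteq> 0" using \<omega> by (simp add: OK_tuple_def)
  have \<omega>K: "\<omega> j \<in> K" if "j < n" for j using \<omega> that by (simp add: OK_tuple_def OK_iff)
  show "c i = 0" if sum: "(\<Sum>j<n. of_int (c j) * \<omega> j) = 0" and i: "i < n" for c :: "nat \<Rightarrow> int" and i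
  proof -
    have "(\<Sum>j<n. conjg (zs k) (\<omega> j) * complex_of_int (c j)) = 0" if "k < n" for k
    proof -
      have "(\<Sum>j<n. conjg (zs k) (\<omega> j) * complex_of_int (c j)) = conjg (zs k) (\<Sum>j<n. of_int (c j) * \<omega> j)"
        using that \<omega>K by (subst conjg_sum) (auto simp: conjg_simps zs_R K_of_int mult.commute intro: K_closed)
      also have "\<dots> = 0" using sum that by (simp add: conjg_simps zs_R)
      finally show ?thesis .
    qed
    moreover have "\<forall>c. (\<forall>k<n. (\<Sum>j<n. conjg (zs k) (\<omega> j) * c j) = 0) \<longrightarrow> (\<forall>j<n. c j = 0)"
      using det unfolding conj_mat_def det_nonzero_iff .
    note spec[OF this, of "\<lambda>j. complex_of_int (c j)"]
    ultimately have "complex_of_int (c i) = 0" using i by blast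
    thus ?thesis by simp
  qed
  fix x assume x: "x \<in> OK"
  obtain q where q: "x = (\<Sum>j<n. of_rat (q j) * \<omega> j)"
    using coordinates[OF \<omega>K det, of x] x by (auto simp: OK_iff)
  have "q k \<in> \<int>" if k: "k < n" for k
  proof (rule ccontr)
    assume not_int: "q k \<notin> \<int>"
    define r where "r = frac (q k)"
    have r: "0 < r" "r < 1" using not_int by (auto simp: r_def frac_gt_0_iff frac_lt_1)
    define y where "y = x - of_int \<lfloor>q k\<rfloor> * \<omega> k"
    define u where "u = Matrix.vec n (\<lambda>j. if j = k then of_rat r else complex_of_rat (q j))"
    define \<theta> where "\<theta> = \<omega>(k := y)"
    have y_eq: "y = (\<Sum>j<n. u $ j * \<omega> j)"
    proof -
      have "(\<Sum>j<n. u $ j * \<omega> j) = (\<Sum>j<n. of_rat (q j) * \<omega> j - (if j = k then of_int \<lfloor>q k\<rfloor> * \<omega> k else 0))"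
        by (intro sum.cong) (auto simp: u_def r_def frac_def of_rat_diff algebra_simps)
      also have "\<dots> = y" using k by (simp add: sum_subtractf q[symmetric] y_def)
      finally show ?thesis by simp
    qed
    have yO: "y \<in> OK" unfolding y_def using x k \<omega> by (auto simp: OK_tuple_def intro!: OK_closed)
    \<comment> \<open>Cramer's rule: the new k-th column is the old matrix applied to the
      coordinates of y, so the determinant is multiplied by the k-th coordinate r, strictly between
      0 and 1.\<close>
    have "conj_mat \<theta> = replace_col (conj_mat \<omega>) (conj_mat \<omega> *\<^sub>v u) k"
    proof (rule eq_matI)
      fix i j assume ij: "i < dim_row (replace_col (conj_mat \<omega>) (conj_mat \<omega> *\<^sub>v u) k)"
        "j < dim_col (replace_col (conj_mat \<omega>) (conj_mat \<omega> *\<^sub>v u) k)"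
      hence i: "i < n" and j: "j < n" by (auto simp: replace_col_def conj_mat_def)
      have "conjg (zs i) y = (\<Sum>l<n. conjg (zs i) (u $ l * \<omega> l))"
        unfolding y_eq using i \<omega>K by (intro conjg_sum) (auto simp: zs_R u_def intro!: K_closed)
      also have "\<dots> = (\<Sum>l<n. conjg (zs i) (\<omega> l) * u $ l)"
        using i \<omega>K by (intro sum.cong) (auto simp: u_def conjg_simps zs_R K_closed)
      finally have "conjg (zs i) y = (\<Sum>l<n. conjg (zs i) (\<omega> l) * u $ l)" .
      thus "conj_mat \<theta> $$ (i, j) = replace_col (conj_mat \<omega>) (conj_mat \<omega> *\<^sub>v u) k $$ (i, j)"
        using i j by (auto simp: replace_col_def conj_mat_def \<theta>_def scalar_prod_def atLeast0LessThan u_def)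
    qed (auto simp: replace_col_def conj_mat_def)
    hence det\<theta>: "det (conj_mat \<theta>) = of_rat r * det (conj_mat \<omega>)"
      using cramer_lemma_mat[of "conj_mat \<omega>" n u k] k by (simp add: u_def)
    have "OK_tuple \<theta>"
      using det\<theta> det r yO \<omega> by (auto simp: OK_tuple_def \<theta>_def)
    hence "cmod (disc \<omega>) \<le> cmod (disc \<theta>)" by (rule min)
    moreover have "complex_of_rat r = of_real (real_of_rat r)"
      by (cases r) (simp add: of_rat_rat)
    hence "cmod (disc \<theta>) = real_of_rat r ^ 2 * cmod (disc \<omega>)"
      using r by (simp add: disc_conv_det det\<theta> norm_mult norm_power power_mult_distrib)
    ultimately have "1 \<le> real_of_rat r ^ 2" using det by (simp add: disc_conv_det)
    moreover have "real_of_rat r ^ 2 < 1" using r by (simp add: power_less_one_iff of_rat_less_1_iff)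
    ultimately show False by simp
  qed
  hence "\<forall>k. \<exists>c::int. k < n \<longrightarrow> q k = of_int c" by (metis Ints_cases)
  then obtain c :: "nat \<Rightarrow> int" where c: "\<And>k. k < n \<Longrightarrow> q k = of_int (c k)" by metis
  show "\<exists>c. x = (\<Sum>i<n. of_int (c i) * \<omega> i)"
    by (rule exI[of _ c]) (simp add: q c)
qed

text \<open>The matrix expressing \<theta> in the basis \<omega> is integral and its determinant
  enters squared, so the factor cannot be negative. This later excludes a change of sign between two
  integral bases.\<close>

lemma disc_change_of_basis:
  assumes "integral_basis n K \<omega>" "\<And>j. j < n \<Longrightarrow> \<theta> j \<in> OK"
  shows "\<exists>c::int. disc \<theta> = of_int (c ^ 2) * disc \<omega>"
proof -
  have \<omega>K: "\<omega> j \<in> K" if "j < n" for j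
    using assms(1) that by (auto simp: integral_basis_def ring_of_integers_def)
  have "\<forall>j. \<exists>c :: nat \<Rightarrow> int. j < n \<longrightarrow> \<theta> j = (\<Sum>i<n. of_int (c i) * \<omega> i)"
    using assms unfolding integral_basis_def OK_def by blast
  then obtain C :: "nat \<Rightarrow> nat \<Rightarrow> int"
    where C: "\<And>j. j < n \<Longrightarrow> \<theta> j = (\<Sum>i<n. of_int (C j i) * \<omega> i)" by metis
  define M :: "int mat" where "M = Matrix.mat n n (\<lambda>(i, j). C j i)"
  have "conj_mat \<theta> = conj_mat \<omega> * map_mat of_int M"
  proof (rule eq_matI)
    fix i j assume "i < dim_row (conj_mat \<omega> * map_mat of_int M)" "j < dim_col (conj_mat \<omega> * map_mat of_int M)"
    hence ij: "i < n" "j < n" by (auto simp: conj_mat_def M_def)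
    have "conjg (zs i) (\<theta> j) = (\<Sum>l<n. conjg (zs i) (of_int (C j l) * \<omega> l))"
      unfolding C[OF ij(2)] using ij \<omega>K by (intro conjg_sum) (auto simp: zs_R intro!: K_closed K_of_int)
    also have "\<dots> = (\<Sum>l<n. conjg (zs i) (\<omega> l) * of_int (C j l))"
      using ij \<omega>K by (intro sum.cong) (auto simp: conjg_simps zs_R K_of_int)
    finally show "conj_mat \<theta> $$ (i, j) = (conj_mat \<omega> * map_mat of_int M) $$ (i, j)"
      using ij by (simp add: conj_mat_def M_def scalar_prod_def atLeast0LessThan)
  qed (auto simp: conj_mat_def M_def)
  hence "det (conj_mat \<theta>) = det (conj_mat \<omega>) * det (map_mat of_int M)"
    by (simp add: det_mult[of _ n] M_def)
  also have "det (map_mat of_int M) = complex_of_int (det M)" by (rule of_int_hom.hom_det)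
  finally show ?thesis by (intro exI[of _ "det M"]) (simp add: disc_conv_det power_mult_distrib)
qed

lemma det_embeddings_square:
  assumes \<sigma>: "bij_betw \<sigma> {..<n} (embeddings K UNIV)" and \<omega>: "\<And>j. j < n \<Longrightarrow> \<omega> j \<in> K"
  shows "det (Matrix.mat n n (\<lambda>(i, j). \<sigma> i (\<omega> j))) ^ 2 = disc \<omega>"
proof -
  have "(\<Sum>i<n. \<sigma> i (\<omega> j) * \<sigma> i (\<omega> k)) = (\<Sum>z\<in>R. conjg z (\<omega> j) * conjg z (\<omega> k))" if "j < n" "k < n" for j k
  proof -
    have "(\<Sum>i<n. \<sigma> i (\<omega> j) * \<sigma> i (\<omega> k)) = (\<Sum>s\<in>embeddings K UNIV. s (\<omega> j) * s (\<omega> k))"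
      using sum.reindex_bij_betw[OF \<sigma>, of "\<lambda>s. s (\<omega> j) * s (\<omega> k)"] by simp
    also have "\<dots> = (\<Sum>z\<in>R. conjg z (\<omega> j) * conjg z (\<omega> k))"
      unfolding embeddings_UNIV by (subst sum.reindex[OF inj_on_restrict_conjg]) (simp add: \<omega> that)
    finally show ?thesis .
  qed
  thus ?thesis
    unfolding disc_def det_square_gram by (intro arg_cong[of _ _ det] eq_matI) auto
qed

text \<open>Two integral bases express each other, so their discriminants differ by squares of
  integers whose product is 1. This makes the definite description in \<open>discriminant\<close>
  well defined. Comparison with a tuple of nonzero determinant shows that the value is not
  0.\<close>

lemma integral_basis_disc:
  assumes \<alpha>OK: "\<alpha> \<in> OK" and \<omega>: "integral_basis n K \<omega>"
  shows "disc \<omega> = of_int (discriminant K)" "disc \<omega> \<noteq> 0"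
proof -
  obtain \<omega>0 where \<omega>0: "OK_tuple \<omega>0" "\<And>\<theta>. OK_tuple \<theta> \<Longrightarrow> cmod (disc \<omega>0) \<le> cmod (disc \<theta>)"
    using minimal_tuple[OF \<alpha>OK] by blast
  have inO: "\<omega> j \<in> OK" if "integral_basis n K \<omega>" "j < n" for \<omega> j
    using that by (simp add: integral_basis_def OK_def)
  have nz: "disc \<omega> \<noteq> 0" if "integral_basis n K \<omega>" for \<omega>
    using disc_change_of_basis[OF that, of \<omega>0] \<omega>0(1) by (auto simp: OK_tuple_def disc_conv_det)
  show nz\<omega>: "disc \<omega> \<noteq> 0" using nz[OF \<omega>] .
  have unique: "disc \<omega>' = disc \<omega>" if \<omega>': "integral_basis n K \<omega>'" for \<omega>'
  proof -
    obtain c where c: "disc \<omega>' = of_int (c ^ 2) * disc \<omega>"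
      using disc_change_of_basis[OF \<omega>, of \<omega>'] inO[OF \<omega>'] by blast
    obtain c' where c': "disc \<omega> = of_int (c' ^ 2) * disc \<omega>'"
      using disc_change_of_basis[OF \<omega>', of \<omega>] inO[OF \<omega>] by blast
    have "of_int (c' ^ 2 * c ^ 2) * disc \<omega> = 1 * disc \<omega>"
      using c c' by (metis mult.assoc mult_1 of_int_mult)
    hence "complex_of_int (c' ^ 2 * c ^ 2) = of_int 1" using nz\<omega> by simp
    hence "c' ^ 2 * c ^ 2 = 1" by (simp only: of_int_eq_iff)
    hence "c ^ 2 = 1 \<or> c ^ 2 = -1" unfolding zmult_eq_1_iff by blast
    moreover have "c ^ 2 \<ge> 0" by simp
    ultimately have "c ^ 2 = 1" by linarith
    thus ?thesis using c by simp
  qed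
  obtain d where d: "disc \<omega> = of_int d" using disc_int[of \<omega>] inO[OF \<omega>] by (auto simp: Ints_def)
  have card_emb: "card (embeddings K UNIV) = n"
    unfolding embeddings_UNIV by (simp add: card_image[OF inj_on_restrict_conjg] card_R)
  have "discriminant K = d"
    unfolding discriminant_def
  proof (rule the_equality)
    have "finite (embeddings K UNIV)" unfolding embeddings_UNIV using finite_R by simp
    then obtain \<sigma> where \<sigma>: "bij_betw \<sigma> {..<n} (embeddings K UNIV)"
      using ex_bij_betw_nat_finite card_emb atLeast0LessThan by metis
    have "of_int d = det (Matrix.mat n n (\<lambda>(i, j). \<sigma> i (\<omega> j))) ^ 2"
      using det_embeddings_square[OF \<sigma>, of \<omega>] inO[OF \<omega>] d by (simp add: OK_iff)
    thus "\<exists>n \<omega> \<sigma>. number_field n K \<and> integral_basis n K \<omega> \<and> bij_betw \<sigma> {..<n} (embeddings K UNIV) \<and>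
        of_int d = det (Matrix.mat n n (\<lambda>(i, j). \<sigma> i (\<omega> j))) ^ 2"
      using number_field_K \<omega> \<sigma> by blast
  next
    fix d' assume "\<exists>n \<omega> \<sigma>. number_field n K \<and> integral_basis n K \<omega> \<and> bij_betw \<sigma> {..<n} (embeddings K UNIV) \<and>
        of_int d' = det (Matrix.mat n n (\<lambda>(i, j). \<sigma> i (\<omega> j))) ^ 2"
    then obtain n' \<omega>' \<sigma>' where *: "integral_basis n' K \<omega>'" "bij_betw \<sigma>' {..<n'} (embeddings K UNIV)"
      "of_int d' = det (Matrix.mat n' n' (\<lambda>(i, j). \<sigma>' i (\<omega>' j))) ^ 2" by blast
    \<comment> \<open>The definition also quantifies over the degree; the number of embeddings fixes
      it.\<close>
    have "n' = n" using bij_betw_same_card[OF *(2)] card_emb by simp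
    with * have **: "integral_basis n K \<omega>'" "bij_betw \<sigma>' {..<n} (embeddings K UNIV)"
      "of_int d' = det (Matrix.mat n n (\<lambda>(i, j). \<sigma>' i (\<omega>' j))) ^ 2" by auto
    have "complex_of_int d' = disc \<omega>'"
      using det_embeddings_square[OF **(2), of \<omega>'] inO[OF **(1)] **(3) by (simp add: OK_iff)
    also have "\<dots> = of_int d" using unique[OF **(1)] d by simp
    finally show "d' = d" by simp
  qed
  thus "disc \<omega> = of_int (discriminant K)" using d by simp
qed

text \<open>A tuple of least discriminant is an integral basis, so its discriminant is that of K.
  Minimality thereby becomes the lower bound on which the later estimates rest.\<close>

lemma
  assumes \<alpha>OK: "\<alpha> \<in> OK"
  shows discriminant_nonzero: "discriminant K \<noteq> 0"
    and discriminant_le: "OK_tuple \<theta> \<Longrightarrow> \<bar>discriminant K\<bar> \<le> cmod (det (conj_mat \<theta>)) ^ 2"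
    and ex_tuple_discriminant: "\<exists>\<omega>. OK_tuple \<omega> \<and> \<bar>discriminant K\<bar> = cmod (det (conj_mat \<omega>)) ^ 2"
proof -
  obtain \<omega> where \<omega>: "OK_tuple \<omega>" "\<And>\<theta>. OK_tuple \<theta> \<Longrightarrow> cmod (disc \<omega>) \<le> cmod (disc \<theta>)"
    using minimal_tuple[OF \<alpha>OK] by blast
  note d = integral_basis_disc[OF \<alpha>OK minimal_tuple_integral_basis[OF \<omega>]]
  show "discriminant K \<noteq> 0" using d by auto
  have *: "cmod (disc \<omega>) = \<bar>discriminant K\<bar>" using d by simp
  have **: "cmod (disc \<theta>) = cmod (det (conj_mat \<theta>)) ^ 2" for \<theta>
    by (simp add: disc_conv_det norm_power)
  show "\<bar>discriminant K\<bar> \<le> cmod (det (conj_mat \<theta>)) ^ 2" if "OK_tuple \<theta>"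
    using \<omega>(2)[OF that] * ** by metis
  show "\<exists>\<omega>. OK_tuple \<omega> \<and> \<bar>discriminant K\<bar> = cmod (det (conj_mat \<omega>)) ^ 2"
    using \<omega>(1) * ** by metis
qed

text \<open>Multiplying a minimal tuple by x keeps it integral and independent and multiplies the
  determinant by the product of the conjugates of x. A factor of modulus below 1 would contradict
  minimality.\<close>

lemma norm_ge_1:
  assumes \<alpha>OK: "\<alpha> \<in> OK" and x: "x \<in> OK" "x \<noteq> 0"
  shows "(\<Prod>z\<in>R. cmod (conjg z x)) \<ge> 1"
proof -
  obtain \<omega> where \<omega>: "OK_tuple \<omega>" "\<bar>discriminant K\<bar> = cmod (det (conj_mat \<omega>)) ^ 2"
    using ex_tuple_discriminant[OF \<alpha>OK] by blast
  define \<theta> where "\<theta> j = x * \<omega> j" for j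
  define D where "D = Matrix.mat n n (\<lambda>(i, j). if i = j then conjg (zs i) x else 0)"
  have D: "D \<in> carrier_mat n n" by (simp add: D_def)
  have "conj_mat \<theta> = D * conj_mat \<omega>"
  proof (rule eq_matI)
    fix i j assume "i < dim_row (D * conj_mat \<omega>)" "j < dim_col (D * conj_mat \<omega>)"
    hence ij: "i < n" "j < n" by (auto simp: D_def conj_mat_def)
    have "(D * conj_mat \<omega>) $$ (i, j) = (\<Sum>l<n. (if i = l then conjg (zs i) x else 0) * conjg (zs l) (\<omega> j))"
      using ij by (simp add: D_def conj_mat_def scalar_prod_def atLeast0LessThan)
    also have "\<dots> = (\<Sum>l<n. if l = i then conjg (zs i) x * conjg (zs i) (\<omega> j) else 0)"
      by (intro sum.cong) auto
    also have "\<dots> = conjg (zs i) x * conjg (zs i) (\<omega> j)" using ij by simp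
    also have "\<dots> = conjg (zs i) (\<theta> j)"
      using ij x \<omega>(1) by (simp add: \<theta>_def conjg_simps zs_R OK_iff OK_tuple_def)
    finally show "conj_mat \<theta> $$ (i, j) = (D * conj_mat \<omega>) $$ (i, j)"
      using ij by (simp add: conj_mat_def)
  qed (auto simp: D_def conj_mat_def)
  hence "det (conj_mat \<theta>) = det D * det (conj_mat \<omega>)" using D by (simp add: det_mult[of _ n])
  also have "det D = prod_list (diag_mat D)"
    by (rule det_upper_triangular[OF _ D]) (auto simp: D_def upper_triangular_def)
  also have "\<dots> = (\<Prod>i<n. conjg (zs i) x)"
    by (simp add: prod_list_diag_prod D_def atLeast0LessThan)
  also have "\<dots> = (\<Prod>z\<in>R. conjg z x)" by (rule prod.reindex_bij_betw[OF zs])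
  finally have det: "det (conj_mat \<theta>) = (\<Prod>z\<in>R. conjg z x) * det (conj_mat \<omega>)" .
  have "OK_tuple \<theta>"
    using x \<omega>(1) finite_R by (auto simp: OK_tuple_def det \<theta>_def conjg_eq_0_iff OK_iff OK_closed K_closed algebraic_int_mult)
  hence "\<bar>discriminant K\<bar> \<le> cmod (det (conj_mat \<theta>)) ^ 2" by (rule discriminant_le[OF \<alpha>OK])
  also have "\<dots> = (\<Prod>z\<in>R. cmod (conjg z x)) ^ 2 * \<bar>discriminant K\<bar>"
    by (simp add: det \<omega>(2)[symmetric] norm_mult power_mult_distrib prod_norm)
  finally have "1 \<le> (\<Prod>z\<in>R. cmod (conjg z x)) ^ 2" using discriminant_nonzero[OF \<alpha>OK] by simp
  thus ?thesis
    using power2_le_imp_le[of 1 "\<Prod>z\<in>R. cmod (conjg z x)"] by (simp add: prod_nonneg)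
qed

lemma OK_tuple_powers: "x \<in> OK \<Longrightarrow> inj_on (\<lambda>z. conjg z x) R \<Longrightarrow> OK_tuple (\<lambda>j. x ^ j)"
  by (simp add: OK_tuple_def OK_closed det_conj_mat_powers_nonzero OK_iff[of x, THEN iffD1])

text \<open>Read backwards: an integer with distinct conjugates cannot have all of them small
  compared with |Disc K|^(1/(n(n-1))).\<close>

lemma discriminant_le_power:
  fixes T :: real
  assumes "\<alpha> \<in> OK" "x \<in> OK" "inj_on (\<lambda>z. conjg z x) R" "\<And>z. z \<in> R \<Longrightarrow> cmod (conjg z x) \<le> T"
  shows "\<bar>discriminant K\<bar> \<le> (fact n) ^ 2 * T ^ (n * (n - 1))"
proof -
  have "\<bar>discriminant K\<bar> \<le> cmod (det (conj_mat (\<lambda>j. x ^ j))) ^ 2"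
    by (intro discriminant_le OK_tuple_powers assms)
  also have "\<dots> \<le> (fact n) ^ 2 * T ^ (n * (n - 1))"
    unfolding det_conj_mat_powers[OF OK_iff[THEN iffD1, OF assms(2), THEN conjunct1]]
    by (rule norm_det_powers_le) (simp add: assms(4) zs_R)
  finally show ?thesis .
qed

lemma discriminant_le_mahler:
  assumes "\<alpha> \<in> OK"
  shows "\<bar>discriminant K\<bar> \<le> (fact n) ^ 2 * (\<Prod>z\<in>R. max 1 (cmod z)) ^ (2 * (n - 1))"
proof -
  have "\<bar>discriminant K\<bar> \<le> cmod (det (conj_mat (\<lambda>j. \<alpha> ^ j))) ^ 2"
    using assms by (intro discriminant_le OK_tuple_powers) (auto simp: conjg_\<alpha> inj_on_def)
  also have "det (conj_mat (\<lambda>j. \<alpha> ^ j)) = det (Matrix.mat n n (\<lambda>(i, j). zs i ^ j))"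
    unfolding det_conj_mat_powers[OF \<alpha>_K]
    by (intro arg_cong[of _ _ det] eq_matI) (auto simp: conjg_\<alpha> zs_R)
  also have "cmod \<dots> ^ 2 \<le> (fact n) ^ 2 * (\<Prod>i<n. max 1 (cmod (zs i))) ^ (2 * (n - 1))"
    by (rule norm_det_powers_le')
  also have "(\<Prod>i<n. max 1 (cmod (zs i))) = (\<Prod>z\<in>R. max 1 (cmod z))"
    by (rule prod.reindex_bij_betw[OF zs])
  finally show ?thesis .
qed

end

section \<open>Counting vectors of conjugates\<close>

lemma card_le_fibres:
  assumes "finite A" "\<And>c. c \<in> h ` A \<Longrightarrow> real (card {a \<in> A. h a = c}) \<le> m"
  shows "real (card A) \<le> m * real (card (h ` A))"
proof -
  have "card A = (\<Sum>c\<in>h ` A. card {a \<in> A. h a = c})"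
    using sum.image_gen[OF assms(1), of "\<lambda>_. 1::nat" h] by simp
  hence "real (card A) = (\<Sum>c\<in>h ` A. real (card {a \<in> A. h a = c}))" by simp
  also have "\<dots> \<le> (\<Sum>c\<in>h ` A. m)" by (intro sum_mono assms)
  finally show ?thesis by (simp add: mult.commute)
qed

text \<open>The interval contains at most 2t + 2 integers, and t >= 1 absorbs the 2. The factor 4
  per coordinate in \<open>cell_count\<close> originates here.\<close>

lemma card_floor_interval_le: "t \<ge> 1 \<Longrightarrow> real (card {\<lfloor>- t\<rfloor>..\<lfloor>t\<rfloor>}) \<le> 4 * (t::real)"
  by simp linarith

text \<open>For a pair of complex conjugate roots, the real part of the coordinate is read off at the
  root in the upper half plane and the imaginary part at the other one, so that \<open>R\<close> indexes
  the real coordinates.\<close>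

lemma cell_count:
  fixes v :: "'a \<Rightarrow> complex \<Rightarrow> complex"
  assumes finR: "finite R" and cnjR: "\<And>z. z \<in> R \<Longrightarrow> cnj z \<in> R" and finA: "finite A" "A \<noteq> {}"
    and vc: "\<And>a z. a \<in> A \<Longrightarrow> z \<in> R \<Longrightarrow> v a (cnj z) = cnj (v a z)"
    and w: "\<And>z. z \<in> R \<Longrightarrow> 0 < w z" "\<And>z. z \<in> R \<Longrightarrow> w z \<le> B z" "\<And>z. z \<in> R \<Longrightarrow> w (cnj z) = w z"
    and bd: "\<And>a z. a \<in> A \<Longrightarrow> z \<in> R \<Longrightarrow> cmod (v a z) \<le> B z"
    and cl: "\<And>a. a \<in> A \<Longrightarrow> real (card {b \<in> A. \<forall>z\<in>R. cmod (v a z - v b z) \<le> 2 * w z}) \<le> m"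
  shows "real (card A) \<le> m * (\<Prod>z\<in>R. 4 * (B z / w z))"
proof -
  define x where "x a z = (if Im z \<ge> 0 then Re (v a z) else Im (v a z))" for a z
  define cell where "cell a = restrict (\<lambda>z. \<lfloor>x a z / w z\<rfloor>) R" for a
  have x_le: "\<bar>x a z\<bar> \<le> B z" if "a \<in> A" "z \<in> R" for a z
    using bd[OF that] abs_Re_le_cmod[of "v a z"] abs_Im_le_cmod[of "v a z"] by (auto simp: x_def)
  \<comment> \<open>Real and imaginary part each differ by at most w, and the modulus is at most the
    sum of the two.\<close>
  have close: "cmod (v a z - v b z) \<le> 2 * w z" if ab: "a \<in> A" "b \<in> A" "cell a = cell b" and z: "z \<in> R" for a b z
  proof -
    have near: "\<bar>x a u - x b u\<bar> \<le> w u" if u: "u \<in> R" for u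
    proof -
      have "\<lfloor>x a u / w u\<rfloor> = \<lfloor>x b u / w u\<rfloor>"
        using fun_cong[OF ab(3), of u] u by (simp add: cell_def)
      hence "\<bar>x a u / w u - x b u / w u\<bar> \<le> 1" by linarith
      hence "\<bar>(x a u - x b u) / w u\<bar> \<le> 1" by (simp add: diff_divide_distrib)
      thus ?thesis using w(1)[OF u] by (simp add: abs_divide)
    qed
    have re_im: "\<bar>Re (v a z - v b z)\<bar> \<le> w z" "\<bar>Im (v a z - v b z)\<bar> \<le> w z"
    proof -
      note n1 = near[OF z] and n2 = near[OF cnjR[OF z]]
      have vcz: "v a (cnj z) = cnj (v a z)" "v b (cnj z) = cnj (v b z)" using vc ab z by auto
      \<comment> \<open>At a real root the value itself is real. At any other root one of the two
        parts is read off at the conjugate root, where the side w is the same.\<close>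
      consider "Im z = 0" | "Im z > 0" | "Im z < 0" by linarith
      hence "\<bar>Re (v a z - v b z)\<bar> \<le> w z \<and> \<bar>Im (v a z - v b z)\<bar> \<le> w z"
      proof cases
        case 1
        hence "cnj z = z" by (simp add: complex_eq_iff)
        hence "Im (v a z) = 0" "Im (v b z) = 0" using vcz by (metis complex_cnj_cancel_iff Reals_cnj_iff complex_is_Real_iff)+
        thus ?thesis using n1 1 w(1)[OF z] by (simp add: x_def)
      next
        case 2
        thus ?thesis using n1 n2 vcz w(3)[OF z] by (simp add: x_def)
      next
        case 3
        thus ?thesis using n1 n2 vcz w(3)[OF z] by (simp add: x_def)
      qed
      thus "\<bar>Re (v a z - v b z)\<bar> \<le> w z" "\<bar>Im (v a z - v b z)\<bar> \<le> w z" by auto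
    qed
    thus ?thesis using cmod_le[of "v a z - v b z"] by linarith
  qed
  have fib: "real (card {a \<in> A. cell a = c}) \<le> m" if c: "c \<in> cell ` A" for c
  proof -
    obtain a where a: "a \<in> A" "c = cell a" using c by blast
    have "card {b \<in> A. cell b = c} \<le> card {b \<in> A. \<forall>z\<in>R. cmod (v a z - v b z) \<le> 2 * w z}"
      using finA close[OF a(1)] a(2) by (intro card_mono) auto
    thus ?thesis using cl[OF a(1)] by linarith
  qed
  have t1: "B z / w z \<ge> 1" if "z \<in> R" for z using w(1,2)[OF that] by simp
  have "cell ` A \<subseteq> PiE R (\<lambda>z. {\<lfloor>- (B z / w z)\<rfloor>..\<lfloor>B z / w z\<rfloor>})"
  proof (intro subsetI, elim imageE)
    fix c a assume c: "c = cell a" and a: "a \<in> A"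
    have "\<lfloor>x a z / w z\<rfloor> \<in> {\<lfloor>- (B z / w z)\<rfloor>..\<lfloor>B z / w z\<rfloor>}" if z: "z \<in> R" for z
    proof -
      have "- B z \<le> x a z" "x a z \<le> B z" using x_le[OF a z] by auto
      hence "- B z / w z \<le> x a z / w z" "x a z / w z \<le> B z / w z"
        using w(1)[OF z] by (intro divide_right_mono; simp)+
      thus ?thesis by (auto intro: floor_mono)
    qed
    thus "c \<in> PiE R (\<lambda>z. {\<lfloor>- (B z / w z)\<rfloor>..\<lfloor>B z / w z\<rfloor>})" by (auto simp: c cell_def)
  qed
  hence "card (cell ` A) \<le> card (PiE R (\<lambda>z. {\<lfloor>- (B z / w z)\<rfloor>..\<lfloor>B z / w z\<rfloor>}))"
    using finR by (intro card_mono finite_PiE) auto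
  also have "\<dots> = (\<Prod>z\<in>R. card {\<lfloor>- (B z / w z)\<rfloor>..\<lfloor>B z / w z\<rfloor>})" using finR by (rule card_PiE)
  finally have "real (card (cell ` A)) \<le> (\<Prod>z\<in>R. real (card {\<lfloor>- (B z / w z)\<rfloor>..\<lfloor>B z / w z\<rfloor>}))"
    by (metis of_nat_le_iff of_nat_prod)
  also have "\<dots> \<le> (\<Prod>z\<in>R. 4 * (B z / w z))"
    using t1 by (intro prod_mono conjI card_floor_interval_le) auto
  finally have card_cell: "real (card (cell ` A)) \<le> (\<Prod>z\<in>R. 4 * (B z / w z))" .
  obtain a where "a \<in> A" using finA(2) by blast
  hence "m \<ge> 0" using cl[of a] by linarith
  have "real (card A) \<le> m * real (card (cell ` A))" by (rule card_le_fibres[OF finA(1) fib])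
  also have "\<dots> \<le> m * (\<Prod>z\<in>R. 4 * (B z / w z))"
    using card_cell \<open>m \<ge> 0\<close> by (rule mult_left_mono)
  finally show ?thesis .
qed

text \<open>Only \<open>card R - 1\<close> of the coordinates are localized dyadically; the bound on the last one is
  forced by the bound on the product.\<close>

lemma dyadic_cover:
  fixes v :: "'a \<Rightarrow> complex \<Rightarrow> complex"
  assumes finR: "finite R" and cnjR: "\<And>z. z \<in> R \<Longrightarrow> cnj z \<in> R" and R_ne: "R \<noteq> {}" and finA: "finite A"
    and vc: "\<And>a z. a \<in> A \<Longrightarrow> z \<in> R \<Longrightarrow> v a (cnj z) = cnj (v a z)"
    and M: "M \<ge> 1" and Q: "Q \<ge> 0"
    and prodM: "\<And>a. a \<in> A \<Longrightarrow> (\<Prod>z\<in>R. max 1 (cmod (v a z))) \<le> M"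
    and box: "\<And>A' B. A' \<subseteq> A \<Longrightarrow> A' \<noteq> {} \<Longrightarrow> (\<And>z. z \<in> R \<Longrightarrow> 1 \<le> B z) \<Longrightarrow>
      (\<And>z. z \<in> R \<Longrightarrow> B (cnj z) = B z) \<Longrightarrow> (\<And>a z. a \<in> A' \<Longrightarrow> z \<in> R \<Longrightarrow> cmod (v a z) \<le> B z) \<Longrightarrow>
      (\<Prod>z\<in>R. B z) \<le> 2 ^ card R * M \<Longrightarrow> real (card A') \<le> Q"
  shows "real (card A) \<le> Q * (log 2 M + 1) ^ (card R - 1)"
proof -
  obtain z0 where z0: "z0 \<in> R" using R_ne by blast
  define S where "S = R - {z0}"
  have finS: "finite S" and cardS: "card S = card R - 1" and R: "R = insert z0 S" "z0 \<notin> S"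
    using z0 finR by (auto simp: S_def)
  define t where "t a z = max 1 (cmod (v a z))" for a z
  have t1: "t a z \<ge> 1" and t0: "0 \<le> t a z" for a z by (simp_all add: t_def)
  define key where "key a = restrict (\<lambda>z. nat \<lfloor>log 2 (t a z)\<rfloor>) S" for a
  have t_le: "t a z \<le> M" if "a \<in> A" "z \<in> R" for a z
  proof -
    have "t a z * 1 \<le> t a z * (\<Prod>u\<in>R - {z}. t a u)"
      using t1[of a z] by (intro mult_left_mono prod_ge_1) (auto simp: t1 t0)
    also have "\<dots> = (\<Prod>u\<in>R. t a u)" using that finR by (simp add: prod.remove)
    also have "\<dots> \<le> M" using prodM[OF that(1)] by (simp add: t_def)
    finally show ?thesis by simp
  qed
  have key_bounds: "2 ^ key a z \<le> t a z" "t a z \<le> 2 ^ (key a z + 1)" if "z \<in> S" for a z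
  proof -
    have l: "log 2 (t a z) \<ge> 0" using t1[of a z] by simp
    have k: "key a z = nat \<lfloor>log 2 (t a z)\<rfloor>" using that by (simp add: key_def)
    have "real (key a z) \<le> log 2 (t a z)" "log 2 (t a z) \<le> real (key a z + 1)"
      unfolding k using l by linarith+
    thus "2 ^ key a z \<le> t a z" "t a z \<le> 2 ^ (key a z + 1)"
      using t1[of a z] by (simp_all only: le_log_iff[of 2 "t a z"] log_le_iff[of 2 "t a z"] powr_realpow[symmetric])
  qed
  have fib: "real (card {a \<in> A. key a = g}) \<le> Q" if g: "g \<in> key ` A" for g
  proof -
    define A' where "A' = {a \<in> A. key a = g}"
    \<comment> \<open>At z0 the bound is M divided by the lower bounds \<open>2 ^ g u\<close> of the
      other coordinates. In the product these powers cancel, and only a factor 2 for each u in S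
      survives.\<close>
    define B0 where "B0 z = (if z = z0 then M / 2 ^ (\<Sum>u\<in>S. g u) else 2 ^ (g z + 1))" for z
    have tB0: "t a z \<le> B0 z" if a: "a \<in> A'" and z: "z \<in> R" for a z
    proof (cases "z = z0")
      case False
      hence "z \<in> S" using z by (simp add: S_def)
      thus ?thesis using key_bounds(2)[of z a] a False by (simp add: A'_def B0_def)
    next
      case True
      have "2 ^ (\<Sum>u\<in>S. g u) = (\<Prod>u\<in>S. 2 ^ g u :: real)" by (simp add: power_sum)
      also have "\<dots> \<le> (\<Prod>u\<in>S. t a u)"
        using key_bounds(1)[of _ a] a by (intro prod_mono) (auto simp: A'_def)
      finally have "t a z0 * 2 ^ (\<Sum>u\<in>S. g u) \<le> t a z0 * (\<Prod>u\<in>S. t a u)"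
        using t1[of a z0] by (intro mult_left_mono) auto
      also have "\<dots> = (\<Prod>u\<in>R. t a u)" using R finS by simp
      also have "\<dots> \<le> M" using prodM[of a] a by (simp add: t_def A'_def)
      finally show ?thesis using True by (simp add: B0_def field_simps)
    qed
    \<comment> \<open>\<open>box\<close> asks for bounds invariant under conjugation. Since t takes
      equal values at z and \<open>cnj z\<close>, the minimum is still a bound, and the product of
      the bounds can only decrease.\<close>
    define B where "B z = min (B0 z) (B0 (cnj z))" for z
    have tB: "t a z \<le> B z" if "a \<in> A'" "z \<in> R" for a z
    proof -
      have "t a (cnj z) = t a z" using that vc by (simp add: t_def A'_def)
      thus ?thesis using tB0[OF that] tB0[OF that(1) cnjR[OF that(2)]] by (simp add: B_def)
    qed
    obtain a0 where a0: "a0 \<in> A'" using g by (auto simp: A'_def)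
    have "real (card A') \<le> Q"
    proof (rule box)
      show "A' \<subseteq> A" "A' \<noteq> {}" using a0 by (auto simp: A'_def)
      show B1: "1 \<le> B z" if "z \<in> R" for z using tB[OF a0 that] t1[of a0 z] by linarith
      show "B (cnj z) = B z" for z by (simp add: B_def min.commute)
      show "cmod (v a z) \<le> B z" if "a \<in> A'" "z \<in> R" for a z
        using tB[OF that] by (simp add: t_def)
      have "(\<Prod>z\<in>R. B z) \<le> (\<Prod>z\<in>R. B0 z)"
        using B1 by (intro prod_mono) (force simp: B_def)
      also have "\<dots> = B0 z0 * (\<Prod>z\<in>S. B0 z)" using R finS by simp
      also have "(\<Prod>z\<in>S. B0 z) = (\<Prod>z\<in>S. 2 * 2 ^ g z)"
        using R by (intro prod.cong) (auto simp: B0_def)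
      also have "B0 z0 * \<dots> = 2 ^ card S * M"
        using finS by (simp add: B0_def prod.distrib power_sum)
      also have "\<dots> \<le> 2 ^ card R * M"
        using M by (intro mult_right_mono power_increasing) (auto simp: cardS)
      finally show "(\<Prod>z\<in>R. B z) \<le> 2 ^ card R * M" .
    qed
    thus ?thesis by (simp add: A'_def)
  qed
  \<comment> \<open>Each of the card R - 1 localized coordinates has at most L + 1 dyadic positions,
    because no single factor t exceeds M.\<close>
  define L where "L = nat \<lfloor>log 2 M\<rfloor>"
  have "key ` A \<subseteq> PiE S (\<lambda>_. {..L})"
  proof (intro subsetI, elim imageE)
    fix g a assume g: "g = key a" and a: "a \<in> A"
    have "log 2 (t a z) \<le> log 2 M" if "z \<in> S" for z
      using t_le[OF a, of z] t1[of a z] that R by (subst log_le_cancel_iff) auto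
    thus "g \<in> PiE S (\<lambda>_. {..L})" by (auto simp: g key_def L_def intro!: nat_mono floor_mono)
  qed
  hence "card (key ` A) \<le> card (PiE S (\<lambda>_. {..L}))"
    using finS by (intro card_mono finite_PiE) auto
  also have "\<dots> = (L + 1) ^ (card R - 1)" using finS by (simp add: card_PiE cardS)
  finally have "real (card (key ` A)) \<le> real ((L + 1) ^ (card R - 1))"
    by (simp only: of_nat_le_iff)
  also have "\<dots> = real (L + 1) ^ (card R - 1)" by simp
  also have "\<dots> \<le> (log 2 M + 1) ^ (card R - 1)"
    using M by (intro power_mono) (auto simp: L_def)
  finally have key_card: "real (card (key ` A)) \<le> (log 2 M + 1) ^ (card R - 1)" .
  have "real (card A) \<le> Q * real (card (key ` A))" by (rule card_le_fibres[OF finA fib])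
  also have "\<dots> \<le> Q * (log 2 M + 1) ^ (card R - 1)" using key_card Q by (rule mult_left_mono)
  finally show ?thesis .
qed

text \<open>\<open>kappa n\<close> is chosen such that \<open>(n!)\<^sup>2 (2 kappa n)\<^bsup>n(n-1)\<^esup> < 1\<close>.\<close>

definition kappa :: "nat \<Rightarrow> real" where "kappa n = 1 / (4 * fact n)"

text \<open>The factor 4 + 1/kappa comes from the rational integers in a cell, and 8^n is 4^n from
  the cells times 2^n from the dyadic cover. Of the n - 1 powers of \<open>kappa n\<close>, one
  comes from T and n - 2 from sides of which only the lower bound \<open>kappa n\<close> is
  used.\<close>

definition count_const :: "nat \<Rightarrow> real" where "count_const n = (4 + 1 / kappa n) * 8 ^ n / kappa n ^ (n - 1)"

section \<open>Integers of a number field with bounded product of conjugates\<close>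

context root_field
begin

lemma R_ne: "R \<noteq> {}" using \<alpha> by auto

text \<open>With w = 1/4 the conjugates of two integers in a cell differ by at most 1/2, so a
  nonzero difference would have norm below 1. Each coordinate costs 16 from the cells and 2 from the
  dyadic cover, hence \<open>32 ^ n\<close>.\<close>

theorem card_bounded_conjugates:
  fixes M :: real
  assumes \<alpha>OK: "\<alpha> \<in> OK" and A: "finite A" "A \<subseteq> OK" and M: "M \<ge> 1"
    and prodM: "\<And>x. x \<in> A \<Longrightarrow> (\<Prod>z\<in>R. max 1 (cmod (conjg z x))) \<le> M"
  shows "real (card A) \<le> 32 ^ n * M * (log 2 M + 1) ^ (n - 1)"
proof -
  have AK: "x \<in> K" if "x \<in> A" for x using A that by (auto simp: OK_iff)
  have "real (card A) \<le> (32 ^ n * M) * (log 2 M + 1) ^ (card R - 1)"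
  proof (rule dyadic_cover[where v = "\<lambda>x z. conjg z x" and R = R])
    show "conjg (cnj z) x = cnj (conjg z x)" if "x \<in> A" "z \<in> R" for x z
      using that AK by (simp add: conjg_cnj)
    fix A' B
    assume A': "A' \<subseteq> A" "A' \<noteq> {}" and B: "\<And>z. z \<in> R \<Longrightarrow> 1 \<le> B z" "\<And>z. z \<in> R \<Longrightarrow> B (cnj z) = B z"
      "\<And>a z. a \<in> A' \<Longrightarrow> z \<in> R \<Longrightarrow> cmod (conjg z a) \<le> B z" "(\<Prod>z\<in>R. B z) \<le> 2 ^ card R * M"
    have A'K: "a \<in> K" "a \<in> OK" if "a \<in> A'" for a using A A' AK that by auto
    have "real (card A') \<le> 1 * (\<Prod>z\<in>R. 4 * (B z / (1 / 4)))"
    proof (rule cell_count[where v = "\<lambda>x z. conjg z x" and R = R and w = "\<lambda>_. 1 / 4"])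
      show "conjg (cnj z) x = cnj (conjg z x)" if "x \<in> A'" "z \<in> R" for x z
        using that A'K by (simp add: conjg_cnj)
      show "finite A'" using A' A finite_subset by blast
      show "1 / 4 \<le> B z" if "z \<in> R" for z using B(1)[OF that] by simp
      fix a assume a: "a \<in> A'"
      have "b = a" if b: "b \<in> A'" and near: "\<forall>z\<in>R. cmod (conjg z a - conjg z b) \<le> 2 * (1 / 4)" for b
      proof (rule ccontr)
        assume "b \<noteq> a"
        hence "a - b \<in> OK" "a - b \<noteq> 0" using a b A'K OK_closed by auto
        hence "1 \<le> (\<Prod>z\<in>R. cmod (conjg z (a - b)))" by (rule norm_ge_1[OF \<alpha>OK])
        also have "\<dots> \<le> (\<Prod>z\<in>R. 1 / 2)"
          using near a b A'K by (intro prod_mono) (auto simp: conjg_simps)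
        also have "\<dots> = (1 / 2) ^ n" by (simp add: card_R)
        also have "\<dots> < 1" using n_pos by (simp add: power_less_one_iff)
        finally show False by simp
      qed
      hence "{b \<in> A'. \<forall>z\<in>R. cmod (conjg z a - conjg z b) \<le> 2 * (1 / 4)} \<subseteq> {a}" by blast
      hence "card {b \<in> A'. \<forall>z\<in>R. cmod (conjg z a - conjg z b) \<le> 2 * (1 / 4)} \<le> card {a}"
        by (rule card_mono[rotated]) simp
      thus "real (card {b \<in> A'. \<forall>z\<in>R. cmod (conjg z a - conjg z b) \<le> 2 * (1 / 4)}) \<le> 1" by simp
    qed (use finite_R A' B in \<open>auto simp: cnj_R\<close>)
    also have "\<dots> = 16 ^ n * (\<Prod>z\<in>R. B z)" by (simp add: prod.distrib card_R)
    also have "\<dots> \<le> 16 ^ n * (2 ^ n * M)"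
      using B(4) by (intro mult_left_mono) (auto simp: card_R)
    also have "\<dots> = 32 ^ n * M" by (simp add: mult.assoc[symmetric] power_mult_distrib[symmetric])
    finally show "real (card A') \<le> 32 ^ n * M" .
  qed (use finite_R A M prodM R_ne in \<open>auto simp: cnj_R\<close>)
  thus ?thesis by (simp add: card_R)
qed

text \<open>The saving comes from a box containing a generator having a side of length at least \<open>T\<close>.\<close>

theorem card_bounded_conjugates_primitive:
  fixes M :: real
  assumes \<alpha>OK: "\<alpha> \<in> OK" and A: "finite A" "A \<subseteq> OK" and M: "M \<ge> 1" and n2: "n \<ge> 2"
    and prodM: "\<And>x. x \<in> A \<Longrightarrow> (\<Prod>z\<in>R. max 1 (cmod (conjg z x))) \<le> M"
    and gen: "\<And>x. x \<in> A \<Longrightarrow> inj_on (\<lambda>z. conjg z x) R"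
    and prim: "\<And>x. x \<in> OK \<Longrightarrow> x \<in> \<int> \<or> inj_on (\<lambda>z. conjg z x) R"
  shows "real (card A) \<le> count_const n * M / real_of_int \<bar>discriminant K\<bar> powr (1 / real (n * (n - 1))) * (log 2 M + 1) ^ (n - 1)"
proof -
  have AK: "x \<in> K" if "x \<in> A" for x using A that by (auto simp: OK_iff)
  define D where "D = real_of_int \<bar>discriminant K\<bar>"
  define N where "N = n * (n - 1)"
  define T where "T = kappa n * D powr (1 / real N)"
  have "\<bar>discriminant K\<bar> \<ge> 1" using discriminant_nonzero[OF \<alpha>OK] by linarith
  hence D1: "D \<ge> 1" unfolding D_def by linarith
  have N2: "N \<ge> 2"
  proof -
    have "2 * 1 \<le> n * (n - 1)" using n2 by (intro mult_le_mono) auto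
    thus ?thesis by (simp add: N_def)
  qed
  have \<kappa>: "kappa n > 0" "kappa n \<le> 1"
  proof -
    have "1 \<le> (fact n :: real)" by simp
    hence "1 \<le> (4 * fact n :: real)" by linarith
    thus "kappa n > 0" "kappa n \<le> 1" by (simp_all add: kappa_def del: of_nat_fact)
  qed
  have T\<kappa>: "T \<ge> kappa n"
  proof -
    have "1 \<le> D powr (1 / real N)" using D1 by (simp add: ge_one_powr_ge_zero)
    hence "kappa n * 1 \<le> kappa n * D powr (1 / real N)" using \<kappa> by (intro mult_left_mono) auto
    thus ?thesis by (simp add: T_def)
  qed
  \<comment> \<open>Since N >= 2, the constant (n!)^2 / (2 n!)^N is at most 1/4, so conjugates
    bounded by 2T are too small for a generator. The factor 2 allows for differences within a
    cell.\<close>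
  have small: "(fact n) ^ 2 * t ^ N < D" if t: "0 \<le> t" "t \<le> 2 * T" for t
  proof -
    have "(fact n) ^ 2 * t ^ N \<le> (fact n) ^ 2 * (2 * T) ^ N"
      using t by (intro mult_left_mono power_mono) auto
    also have "2 * T = 1 / (2 * fact n) * D powr (1 / real N)" by (simp add: T_def kappa_def)
    also have "\<dots> ^ N = (1 / (2 * fact n)) ^ N * (D powr (1 / real N)) ^ N" by (rule power_mult_distrib)
    also have "(D powr (1 / real N)) ^ N = D"
      using D1 N2 by (simp add: powr_realpow[symmetric] powr_powr)
    finally have "(fact n) ^ 2 * t ^ N \<le> (fact n) ^ 2 * ((1 / (2 * fact n)) ^ N * D)" .
    moreover have "(1 / (2 * fact n :: real)) ^ N \<le> (1 / (2 * fact n)) ^ 2"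
    proof (rule power_decreasing[OF N2])
      have "1 \<le> (fact n :: real)" by simp
      thus "1 / (2 * fact n) \<le> (1 :: real)" by (subst divide_le_eq_1_pos) linarith+
    qed simp
    hence "(fact n) ^ 2 * ((1 / (2 * fact n :: real)) ^ N * D) \<le> (fact n) ^ 2 * ((1 / (2 * fact n)) ^ 2 * D)"
      by (intro mult_left_mono mult_right_mono) (use D1 in simp_all)
    moreover have "(fact n) ^ 2 * ((1 / (2 * fact n)) ^ 2 * D) = D / 4"
      by (simp add: power_mult_distrib power_divide)
    ultimately show ?thesis using D1 by linarith
  qed
  define Q where "Q = count_const n * M / D powr (1 / real N)"
  have "real (card A) \<le> Q * (log 2 M + 1) ^ (card R - 1)"
  proof (rule dyadic_cover[where v = "\<lambda>x z. conjg z x" and R = R])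
    show "conjg (cnj z) x = cnj (conjg z x)" if "x \<in> A" "z \<in> R" for x z
      using that AK by (simp add: conjg_cnj)
    show "0 \<le> Q" using M \<kappa> by (simp add: Q_def count_const_def)
    fix A' B
    assume A': "A' \<subseteq> A" "A' \<noteq> {}" and B: "\<And>z. z \<in> R \<Longrightarrow> 1 \<le> B z" "\<And>z. z \<in> R \<Longrightarrow> B (cnj z) = B z"
      "\<And>a z. a \<in> A' \<Longrightarrow> z \<in> R \<Longrightarrow> cmod (conjg z a) \<le> B z" "(\<Prod>z\<in>R. B z) \<le> 2 ^ card R * M"
    have A'K: "a \<in> K" "a \<in> OK" if "a \<in> A'" for a using A A' AK that by auto
    have "\<exists>z1\<in>R. B z1 = Max (B ` R)"
    proof -
      have "Max (B ` R) \<in> B ` R" using finite_R R_ne by (intro Max_in) auto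
      thus ?thesis by force
    qed
    then obtain z1 where z1: "z1 \<in> R" "\<And>z. z \<in> R \<Longrightarrow> B z \<le> B z1"
      using finite_R by (metis Max_ge finite_imageI imageI)
    obtain a0 where a0: "a0 \<in> A'" using A' by blast
    have "T \<le> B z1"
    proof (rule ccontr)
      assume "\<not> T \<le> B z1"
      hence "(fact n) ^ 2 * (B z1) ^ N < D" using B(1)[OF z1(1)] \<kappa> T\<kappa> by (intro small) auto
      moreover have "D \<le> (fact n) ^ 2 * (B z1) ^ N"
        unfolding D_def N_def
      proof (rule discriminant_le_power[OF \<alpha>OK, of a0])
        show "a0 \<in> OK" "inj_on (\<lambda>z. conjg z a0) R" using a0 A' A'K gen by auto
        show "cmod (conjg z a0) \<le> B z1" if "z \<in> R" for z
          using B(3)[OF a0 that] z1(2)[OF that] by linarith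
      qed
      ultimately show False by simp
    qed
    \<comment> \<open>Two integers in a cell may still differ by a rational integer, whose size can
      be read off at any coordinate. Reading it at a z2 other than the widest side z1 cancels
      \<open>w z2\<close> in the denominator and leaves \<open>w z1\<close> = T there.\<close>
    have "\<exists>z2\<in>R. z2 \<noteq> z1"
    proof (rule ccontr)
      assume "\<not> ?thesis"
      hence "R \<subseteq> {z1}" by blast
      hence "card R \<le> 1" using card_mono[of "{z1}" R] by simp
      thus False using card_R n2 by simp
    qed
    then obtain z2 where z2: "z2 \<in> R" "z2 \<noteq> z1" by blast
    \<comment> \<open>The bound T excludes generators among the differences within a cell, the bound
      B z meets the requirement of \<open>cell_count\<close> that cells be no wider than the box,
      and both are at least \<open>kappa n\<close>.\<close>
    define w where "w z = min (B z) T" for z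
    have w\<kappa>: "kappa n \<le> w z" if "z \<in> R" for z using B(1)[OF that] \<kappa> T\<kappa> by (simp add: w_def)
    define m where "m = (4 + 1 / kappa n) * w z2"
    have "real (card A') \<le> m * (\<Prod>z\<in>R. 4 * (B z / w z))"
    proof (rule cell_count[where v = "\<lambda>x z. conjg z x" and R = R])
      show "conjg (cnj z) x = cnj (conjg z x)" if "x \<in> A'" "z \<in> R" for x z
        using that A'K by (simp add: conjg_cnj)
      show "finite A'" using A' A finite_subset by blast
      show "0 < w z" if "z \<in> R" for z using w\<kappa>[OF that] \<kappa> by linarith
      fix a assume a: "a \<in> A'"
      define k where "k = \<lfloor>2 * w z2\<rfloor>"
      have k0: "k \<ge> 0" using w\<kappa>[OF z2(1)] \<kappa> by (simp add: k_def)
      have "b \<in> (\<lambda>j. a - of_int j) ` {-k..k}"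
        if b: "b \<in> A'" and near: "\<forall>z\<in>R. cmod (conjg z a - conjg z b) \<le> 2 * w z" for b
      proof -
        have ab: "a - b \<in> OK" using a b A'K OK_closed by auto
        have conj_ab: "conjg z (a - b) = conjg z a - conjg z b" if "z \<in> R" for z
          using that a b A'K by (simp add: conjg_simps)
        have "\<not> inj_on (\<lambda>z. conjg z (a - b)) R"
        proof
          assume inj: "inj_on (\<lambda>z. conjg z (a - b)) R"
          have "D \<le> (fact n) ^ 2 * (2 * T) ^ N"
            unfolding D_def N_def
          proof (rule discriminant_le_power[OF \<alpha>OK ab inj])
            fix z assume z: "z \<in> R"
            hence "cmod (conjg z (a - b)) \<le> 2 * w z" using near conj_ab by simp
            also have "\<dots> \<le> 2 * T" by (simp add: w_def)
            finally show "cmod (conjg z (a - b)) \<le> 2 * T" .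
          qed
          moreover have "(fact n) ^ 2 * (2 * T) ^ N < D" using \<kappa> T\<kappa> by (intro small) auto
          ultimately show False by simp
        qed
        then obtain j where j: "a - b = of_int j" using prim[OF ab] by (auto simp: Ints_def)
        have "cmod (conjg z2 (a - b)) \<le> 2 * w z2" using near conj_ab z2 by simp
        hence "\<bar>real_of_int j\<bar> \<le> 2 * w z2" using j z2 by (simp add: conjg_simps)
        hence "\<bar>j\<bar> \<le> k" unfolding k_def by linarith
        hence "j \<in> {-k..k}" by auto
        moreover have "b = a - of_int j" using j by (simp add: algebra_simps)
        ultimately show ?thesis by blast
      qed
      hence "{b \<in> A'. \<forall>z\<in>R. cmod (conjg z a - conjg z b) \<le> 2 * w z} \<subseteq> (\<lambda>j. a - of_int j) ` {-k..k}" by blast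
      hence "card {b \<in> A'. \<forall>z\<in>R. cmod (conjg z a - conjg z b) \<le> 2 * w z} \<le> card ((\<lambda>j. a - of_int j :: complex) ` {-k..k})"
        by (rule card_mono[rotated]) simp
      also have "\<dots> \<le> card {-k..k}" by (rule card_image_le) simp
      finally have "real (card {b \<in> A'. \<forall>z\<in>R. cmod (conjg z a - conjg z b) \<le> 2 * w z}) \<le> 2 * of_int k + 1"
        using k0 by simp
      also have "\<dots> \<le> 4 * w z2 + 1" unfolding k_def by linarith
      \<comment> \<open>The lower bound on w turns the additive 1 of the count into a multiple of
        \<open>w z2\<close>, so that it cancels as well.\<close>
      also have "1 \<le> w z2 / kappa n" using w\<kappa>[OF z2(1)] \<kappa> by simp
      hence "4 * w z2 + 1 \<le> m" by (simp add: m_def algebra_simps)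
      finally show "real (card {b \<in> A'. \<forall>z\<in>R. cmod (conjg z a - conjg z b) \<le> 2 * w z}) \<le> m" .
    qed (use finite_R A' B in \<open>auto simp: cnj_R w_def\<close>)
    also have "(\<Prod>z\<in>R. 4 * (B z / w z)) = 4 ^ n * (\<Prod>z\<in>R. B z) / (\<Prod>z\<in>R. w z)"
      by (simp add: prod.distrib prod_dividef card_R)
    also have "(\<Prod>z\<in>R. w z) = w z1 * (w z2 * (\<Prod>z\<in>R - {z1} - {z2}. w z))"
      using z1 z2 finite_R by (simp add: prod.remove)
    also have "m * (4 ^ n * (\<Prod>z\<in>R. B z) / (w z1 * (w z2 * (\<Prod>z\<in>R - {z1} - {z2}. w z)))) =
        (4 + 1 / kappa n) * (4 ^ n * (\<Prod>z\<in>R. B z)) / (w z1 * (\<Prod>z\<in>R - {z1} - {z2}. w z))"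
    proof -
      have cancel: "c * u * (x / (y * (u * t))) = c * x / (y * t)" if "u \<noteq> 0" for c u x y t :: real
        using that by simp
      show ?thesis unfolding m_def by (rule cancel) (use w\<kappa>[OF z2(1)] \<kappa> in linarith)
    qed
    also have "\<dots> \<le> (4 + 1 / kappa n) * (4 ^ n * (2 ^ n * M)) / (T * kappa n ^ (n - 2))"
    proof (intro frac_le mult_left_mono mult_mono)
      show "(\<Prod>z\<in>R. B z) \<le> 2 ^ n * M" using B(4) by (simp add: card_R)
      show "T \<le> w z1" using \<open>T \<le> B z1\<close> by (simp add: w_def)
      have "kappa n ^ (n - 2) = (\<Prod>z\<in>R - {z1} - {z2}. kappa n)"
        using z1 z2 finite_R by (simp add: card_R numeral_2_eq_2)
      also have "\<dots> \<le> (\<Prod>z\<in>R - {z1} - {z2}. w z)"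
        using w\<kappa> \<kappa> by (intro prod_mono) auto
      finally show "kappa n ^ (n - 2) \<le> (\<Prod>z\<in>R - {z1} - {z2}. w z)" .
      show "0 < T * kappa n ^ (n - 2)" using \<kappa> T\<kappa> by simp
      show "0 \<le> w z1" using w\<kappa>[OF z1(1)] \<kappa> by simp
    qed (use \<kappa> M in auto)
    also have "\<dots> = Q"
    proof -
      have "kappa n ^ (n - 1) = kappa n * kappa n ^ (n - 2)" using n2
        by (cases n; cases "n - 1") auto
      moreover have "(8::real) ^ n = 4 ^ n * 2 ^ n" by (simp add: power_mult_distrib[symmetric])
      ultimately show ?thesis by (simp add: Q_def count_const_def T_def mult_ac)
    qed
    finally show "real (card A') \<le> Q" .
  qed (use finite_R A M prodM R_ne in \<open>auto simp: cnj_R\<close>)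
  thus ?thesis by (simp add: card_R Q_def D_def N_def)
qed

end

section \<open>Polynomials with a transitive Galois group\<close>

abbreviation rat_of_int_poly :: "int poly \<Rightarrow> rat poly" where
  "rat_of_int_poly f \<equiv> map_poly of_int f"

lemma rat_eval_of_int_poly: "rat_eval (rat_of_int_poly f) z = poly (map_poly of_int f) z"
  by (simp add: rat_eval_def map_poly_map_poly comp_def)

lemma complex_roots_eq: "complex_roots f = {z. rat_eval (rat_of_int_poly f) z = 0}"
  by (simp add: complex_roots_def rat_eval_of_int_poly)

lemma subfield_splitting_field: "subfield (splitting_field f) complex_ring"
  unfolding splitting_field_def by (rule subfield_generate)

lemma roots_in_splitting_field: "complex_roots f \<subseteq> splitting_field f"
  unfolding splitting_field_def by (auto intro: generate_field.incl)

lemma galois_group_rat_eval: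
  assumes "\<sigma> \<in> galois_group L" "subfield L complex_ring" "z \<in> L"
  shows "\<sigma> (rat_eval p z) = rat_eval p (\<sigma> z)"
  by (rule hom_rat_eval[OF assms(2) _ assms(3)]) (use assms(1) in \<open>auto simp: galois_group_def ring_iso_def\<close>)

lemma galois_group_inj: "\<sigma> \<in> galois_group L \<Longrightarrow> inj_on \<sigma> L"
  by (auto simp: galois_group_def ring_iso_def bij_betw_def)

text \<open>\<open>acts_as\<close> is unfolded with one labelling \<beta> fixed, so that an element
  of G can be exchanged for an automorphism permuting the labelled roots.\<close>

locale galois_poly =
  fixes n :: nat and f :: "int poly" and G :: "(nat \<Rightarrow> nat) set" and \<beta> :: "nat \<Rightarrow> complex"
  assumes n_pos': "n \<ge> 1" and degree_f: "Polynomial.degree f = n" and monic_f: "lead_coeff f = 1"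
    and trans: "transitive_perm_group n G"
    and \<beta>: "bij_betw \<beta> {1..n} (complex_roots f)"
    and G_def: "G = {p. p permutes {1..n} \<and>
      (\<exists>\<sigma>\<in>galois_group (splitting_field f). \<forall>i\<in>{1..n}. \<sigma> (\<beta> i) = \<beta> (p i))}"
begin

abbreviation "F \<equiv> rat_of_int_poly f"
abbreviation "R \<equiv> complex_roots f"
abbreviation "L \<equiv> splitting_field f"

lemma \<beta>_R: "i \<in> {1..n} \<Longrightarrow> \<beta> i \<in> R" using \<beta> by (auto simp: bij_betw_def)

lemma R_E: assumes "z \<in> R" obtains i where "i \<in> {1..n}" "z = \<beta> i"
  using assms bij_betw_imp_surj_on[OF \<beta>] by (metis imageE)

lemma card_roots: "card R = n" using bij_betw_same_card[OF \<beta>] by simp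

lemma degree_rat: "Polynomial.degree F = n" and monic_rat: "lead_coeff F = 1"
  using degree_f monic_f by simp_all

text \<open>Automorphisms carry zeros of a rational factor to zeros of it. By transitivity a factor
  vanishing at \<beta> 1 vanishes at all n roots, so it has degree n and the cofactor is
  constant.\<close>

lemma irreducible_F: "Factorial_Ring.irreducible F"
proof (rule Factorial_Ring.irreducibleI)
  show "F \<noteq> 0" using monic_rat by auto
  show "\<not> F dvd 1" using degree_rat n_pos' by (auto simp: is_unit_iff_degree[OF \<open>F \<noteq> 0\<close>])
  have main: "Polynomial.degree q = 0" if F: "F = p * q" and p1: "rat_eval p (\<beta> 1) = 0" for p q
  proof -
    have p0: "p \<noteq> 0" and q0: "q \<noteq> 0" using F \<open>F \<noteq> 0\<close> by auto
    have "rat_eval p (\<beta> j) = 0" if j: "j \<in> {1..n}" for j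
    proof -
      obtain g where g: "g \<in> G" "g 1 = j"
        using trans j n_pos' unfolding transitive_perm_group_def by (metis atLeastAtMost_iff order_refl)
      then obtain \<sigma> where \<sigma>: "\<sigma> \<in> galois_group L" "\<forall>i\<in>{1..n}. \<sigma> (\<beta> i) = \<beta> (g i)"
        unfolding G_def by blast
      have "\<beta> 1 \<in> L" using \<beta>_R[of 1] n_pos' roots_in_splitting_field by auto
      note ev = galois_group_rat_eval[OF \<sigma>(1) subfield_splitting_field this]
      have "rat_eval p (\<beta> j) = rat_eval p (\<sigma> (\<beta> 1))" using \<sigma>(2) g n_pos' by auto
      also have "\<dots> = \<sigma> (rat_eval p (\<beta> 1))" by (simp only: ev)
      also have "\<dots> = \<sigma> (rat_eval 0 (\<beta> 1))" using p1 by simp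
      also have "\<dots> = 0" using ev[of 0] by simp
      finally show ?thesis .
    qed
    hence "R \<subseteq> {z. poly (map_poly of_rat p) z = 0}"
      unfolding rat_eval_def by (metis (mono_tags, lifting) R_E mem_Collect_eq subsetI)
    hence "card R \<le> card {z. poly (map_poly of_rat p :: complex poly) z = 0}"
      using p0 by (intro card_mono poly_roots_finite) auto
    also have "\<dots> \<le> Polynomial.degree p"
      using p0 card_poly_roots_bound[of "map_poly of_rat p :: complex poly"] by simp
    finally have "n \<le> Polynomial.degree p" by (simp add: card_roots)
    thus ?thesis using degree_rat degree_mult_eq[OF p0 q0] F by simp
  qed
  fix p q assume F: "F = p * q"
  have "rat_eval F (\<beta> 1) = 0" using \<beta>_R[of 1] n_pos' by (simp add: complex_roots_eq)
  hence "rat_eval p (\<beta> 1) = 0 \<or> rat_eval q (\<beta> 1) = 0" by (simp add: F)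
  hence "Polynomial.degree q = 0 \<or> Polynomial.degree p = 0"
    using main[of p q] main[of q p] F by (auto simp: mult.commute)
  thus "p dvd 1 \<or> q dvd 1" using F \<open>F \<noteq> 0\<close> by (auto simp: is_unit_iff_degree)
qed

end

lemma galois_polysE:
  assumes "f \<in> galois_polys n B G" "n \<ge> 1" "transitive_perm_group n G"
  obtains \<beta> where "galois_poly n f G \<beta>"
  using assms unfolding galois_polys_def poly_has_galois_group_def acts_as_def galois_poly_def by blast

section \<open>The root field of a counted polynomial\<close>

locale galois_root = galois_poly +
  fixes \<alpha> :: complex
  assumes \<alpha>_root: "\<alpha> \<in> complex_roots f"

sublocale galois_root \<subseteq> root_field F n R \<alpha>
  by unfold_locales (fact monic_rat irreducible_F degree_rat complex_roots_eq card_roots \<alpha>_root)+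

context galois_root
begin

lemma root_algebraic_int: "z \<in> R \<Longrightarrow> algebraic_int z"
  unfolding algebraic_int_altdef_ipoly complex_roots_def using monic_f by blast

lemma \<alpha>_OK: "\<alpha> \<in> OK" using root_algebraic_int[OF \<alpha>_root] \<alpha>_K by (simp add: OK_iff)

lemma normal_closure_eq: "normal_closure K = L"
proof
  have "conjg z x \<in> L" if "z \<in> R" "x \<in> K" for z x
    using that roots_in_splitting_field by (intro conjg_in_subfield subfield_splitting_field) auto
  thus "normal_closure K \<subseteq> L"
    unfolding normal_closure_def embeddings_UNIV
    by (intro generate_field_least subfield_splitting_field) auto
  have "z \<in> (\<Union>\<sigma>\<in>embeddings K UNIV. \<sigma> ` K)" if "z \<in> R" for z
  proof (rule UN_I)
    show "restrict (conjg z) K \<in> embeddings K UNIV" using that by (simp add: embeddings_UNIV)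
    show "z \<in> restrict (conjg z) K ` K"
      using that \<alpha>_K by (intro image_eqI[of _ _ \<alpha>]) (simp_all add: conjg_\<alpha>)
  qed
  thus "L \<subseteq> normal_closure K"
    unfolding splitting_field_def normal_closure_def
    by (intro generate_field_least subfield_generate subsetI generate_field.incl)
qed

text \<open>Both embeddings are determined by their values at \<alpha>, which are \<sigma> z and w.
  This identifies the action on embeddings with the action on roots.\<close>

lemma compose_conjg_iff:
  assumes \<sigma>: "\<sigma> \<in> galois_group L" and z: "z \<in> R" and w: "w \<in> R"
  shows "compose K \<sigma> (restrict (conjg z) K) = restrict (conjg w) K \<longleftrightarrow> \<sigma> z = w"
proof
  assume "compose K \<sigma> (restrict (conjg z) K) = restrict (conjg w) K"
  hence "compose K \<sigma> (restrict (conjg z) K) \<alpha> = restrict (conjg w) K \<alpha>" by simp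
  thus "\<sigma> z = w" using \<alpha>_K z w by (simp add: compose_def conjg_\<alpha>)
next
  assume "\<sigma> z = w"
  have "\<sigma> (conjg z x) = conjg w x" if x: "x \<in> K" for x
  proof -
    obtain p where p: "x = rat_eval p \<alpha>" using KE[OF x] .
    have "z \<in> L" using z roots_in_splitting_field by auto
    from galois_group_rat_eval[OF \<sigma> subfield_splitting_field this, of p]
    show ?thesis using z w \<open>\<sigma> z = w\<close> by (simp add: p conjg_rat_eval)
  qed
  thus "compose K \<sigma> (restrict (conjg z) K) = restrict (conjg w) K"
    by (auto simp: compose_def restrict_def fun_eq_iff)
qed

lemma field_has_galois_group_K: "field_has_galois_group n K G"
proof -
  define \<beta>' where "\<beta>' i = restrict (conjg (\<beta> i)) K" for i
  have emb: "embeddings K L = (\<lambda>z. restrict (conjg z) K) ` R"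
    by (rule embeddings_eq[OF subfield_splitting_field roots_in_splitting_field])
  have "bij_betw (\<lambda>z. restrict (conjg z) K) R (embeddings K L)"
    unfolding emb by (rule inj_on_imp_bij_betw[OF inj_on_restrict_conjg])
  hence bij: "bij_betw \<beta>' {1..n} (embeddings K L)"
    unfolding \<beta>'_def using bij_betw_trans[OF \<beta>] by (simp add: comp_def)
  have iff: "(\<forall>i\<in>{1..n}. compose K \<sigma> (\<beta>' i) = \<beta>' (p i)) \<longleftrightarrow> (\<forall>i\<in>{1..n}. \<sigma> (\<beta> i) = \<beta> (p i))"
    if "p permutes {1..n}" "\<sigma> \<in> galois_group L" for p \<sigma>
    unfolding \<beta>'_def using that permutes_in_image[OF that(1)]
    by (intro ball_cong refl compose_conjg_iff \<beta>_R) auto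
  have "G = {p. p permutes {1..n} \<and> (\<exists>\<sigma>\<in>galois_group L. \<forall>i\<in>{1..n}. compose K \<sigma> (\<beta>' i) = \<beta>' (p i))}"
    unfolding G_def using iff by (intro Collect_cong conj_cong bex_cong refl) auto
  thus ?thesis
    unfolding field_has_galois_group_def acts_as_def normal_closure_eq using bij by blast
qed

lemma galois_fields_K: "real_of_int \<bar>discriminant K\<bar> \<le> D \<Longrightarrow> K \<in> galois_fields n D G"
  using number_field_K field_has_galois_group_K by (simp add: galois_fields_def)

text \<open>The indices at which the conjugates of \<open>x\<close> agree form a partition preserved by \<open>G\<close>.\<close>

lemma primitive_conjugates:
  assumes prim: "primitive_perm_group n G" and x: "x \<in> OK"
  shows "x \<in> \<int> \<or> inj_on (\<lambda>z. conjg z x) R"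
proof -
  have xK: "x \<in> K" using x by (simp add: OK_iff)
  define h where "h i = conjg (\<beta> i) x" for i
  define blk where "blk i = {j\<in>{1..n}. h j = h i}" for i
  define P where "P = blk ` {1..n}"
  \<comment> \<open>The representative has degree below n, so that equal values at all n roots force
    it to be constant.\<close>
  obtain q where q: "x = rat_eval q \<alpha>" "Polynomial.degree q < n" using KE_mod[OF xK] .
  have h: "h i = rat_eval q (\<beta> i)" if "i \<in> {1..n}" for i
    using \<beta>_R[OF that] by (simp add: h_def q conjg_rat_eval)
  have part: "partition_on {1..n} P"
    by (rule partition_onI) (auto simp: P_def blk_def disjnt_def)
  have inv: "g ` b \<in> P" if g: "g \<in> G" and b: "b \<in> P" for g b
  proof -
    obtain i where i: "i \<in> {1..n}" "b = blk i" using b by (auto simp: P_def)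
    obtain \<sigma> where \<sigma>: "\<sigma> \<in> galois_group L" "\<forall>i\<in>{1..n}. \<sigma> (\<beta> i) = \<beta> (g i)"
      and perm: "g permutes {1..n}" using g unfolding G_def by blast
    have gi: "g j \<in> {1..n} \<longleftrightarrow> j \<in> {1..n}" for j using permutes_in_image[OF perm] .
    have hg: "h (g j) = \<sigma> (h j)" if j: "j \<in> {1..n}" for j
    proof -
      have "\<beta> j \<in> L" using \<beta>_R[OF j] roots_in_splitting_field by auto
      from galois_group_rat_eval[OF \<sigma>(1) subfield_splitting_field this, of q]
      show ?thesis using h[OF j] h[of "g j"] gi[of j] j \<sigma>(2) by simp
    qed
    have hL: "h j \<in> L" if "j \<in> {1..n}" for j
      using h[OF that] \<beta>_R[OF that] roots_in_splitting_field
      by (auto intro!: subfield_rat_eval subfield_splitting_field)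
    \<comment> \<open>\<sigma> is injective on the splitting field and carries the conjugate with
      index j to that with index g j, so coincidences are preserved in both directions.\<close>
    have iff: "h (g j) = h (g i) \<longleftrightarrow> h j = h i" if "j \<in> {1..n}" for j
      using hg[OF that] hg[OF i(1)] hL[OF that] hL[OF i(1)] galois_group_inj[OF \<sigma>(1)]
      by (metis inj_onD)
    have "g ` blk i = blk (g i)"
    proof (intro equalityI subsetI)
      fix j assume "j \<in> g ` blk i"
      thus "j \<in> blk (g i)" using iff gi by (auto simp: blk_def)
    next
      fix j assume j: "j \<in> blk (g i)"
      obtain k where k: "j = g k" using permutes_surj[OF perm] by (metis surjD)
      thus "j \<in> g ` blk i" using j iff[of k] gi[of k] by (auto simp: blk_def)
    qed
    thus ?thesis using i gi by (auto simp: P_def)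
  qed
  have "P = {{1..n}} \<or> P = (\<lambda>i. {i}) ` {1..n}"
    by (rule mp[OF spec[OF prim[unfolded primitive_perm_group_def]]]) (use part inv in simp)
  thus ?thesis
  proof
    assume P: "P = {{1..n}}"
    have "blk 1 \<in> P" using n_pos' by (auto simp: P_def)
    hence blk1: "blk 1 = {1..n}" unfolding P by (rule singletonD)
    have const: "h j = h 1" if j: "j \<in> {1..n}" for j
    proof -
      have "j \<in> blk 1" unfolding blk1 by (rule j)
      thus ?thesis by (simp add: blk_def)
    qed
    have "map_poly of_rat q - [:h 1:] = 0"
    proof (rule poly_zero_if_many_roots)
      show "Polynomial.degree (map_poly of_rat q - [:h 1:]) < card R"
        using q(2) n_pos' card_roots by (intro degree_diff_less) auto
      fix z assume "z \<in> R"
      then obtain i where "i \<in> {1..n}" "z = \<beta> i" by (rule R_E)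
      thus "poly (map_poly of_rat q - [:h 1:]) z = 0"
        using const[of i] h[of i] by (simp add: rat_eval_def)
    qed
    hence "(map_poly of_rat q :: complex poly) = [:h 1:]" by simp
    hence "Polynomial.degree (map_poly of_rat q :: complex poly) = 0" by simp
    hence "Polynomial.degree q = 0" by simp
    then obtain r where "q = [:r:]" by (elim degree_eq_zeroE)
    hence "x \<in> \<rat>" using q by simp
    thus ?thesis using x rational_algebraic_int_is_int by (auto simp: OK_iff)
  next
    assume P: "P = (\<lambda>i. {i}) ` {1..n}"
    have "inj_on (\<lambda>z. conjg z x) R"
    proof (rule inj_onI)
      fix z w assume zw: "z \<in> R" "w \<in> R" "conjg z x = conjg w x"
      obtain i where i: "i \<in> {1..n}" "z = \<beta> i" by (rule R_E[OF zw(1)])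
      obtain j where j: "j \<in> {1..n}" "w = \<beta> j" by (rule R_E[OF zw(2)])
      have "i \<in> blk i" "j \<in> blk i" using i j zw(3) by (auto simp: blk_def h_def)
      moreover have "blk i \<in> P" using i by (auto simp: P_def)
      then obtain k where "blk i = {k}" using P by auto
      ultimately show "z = w" using i j by simp
    qed
    thus ?thesis ..
  qed
qed

text \<open>For monic f the product is the Mahler measure, which Landau's inequality bounds by the
  Euclidean norm of the coefficients. These are n + 1 numbers of size at most B, and sqrt(n + 1) is
  rounded up to n + 1.\<close>

lemma prod_roots_le:
  assumes "real_of_int (poly_height f) \<le> B" "B \<ge> 0"
  shows "(\<Prod>z\<in>R. max 1 (cmod z)) \<le> (real n + 1) * B"
proof -
  obtain xs where xs: "set xs = R" "distinct xs" using finite_distinct_list[OF finite_R] by blast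
  have "map_poly complex_of_int f = (\<Prod>z\<in>{z. poly (map_poly complex_of_int f) z = 0}. [:- z, 1:])"
    by (rule monic_eq_prod_roots) (use monic_f degree_f card_roots in \<open>auto simp: complex_roots_def\<close>)
  also have "\<dots> = (\<Prod>z\<in>set xs. [:- z, 1:])" by (simp add: xs complex_roots_def)
  also have "\<dots> = Polynomial.smult 1 (\<Prod>z\<leftarrow>xs. [:- z, 1:])"
    by (subst prod.distinct_set_conv_list[OF xs(2)]) simp
  finally have "mahler_measure f = (\<Prod>z\<leftarrow>xs. max 1 (cmod z))"
    unfolding mahler_measure_def by (simp only: mahler_measure_poly_explicit) simp
  also have "\<dots> = (\<Prod>z\<in>set xs. max 1 (cmod z))"
    by (rule prod.distinct_set_conv_list[OF xs(2), symmetric])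
  also have "\<dots> = (\<Prod>z\<in>R. max 1 (cmod z))" by (simp add: xs)
  finally have "(\<Prod>z\<in>R. max 1 (cmod z)) \<le> sqrt (real_of_int (\<Sum>a\<leftarrow>coeffs f. a * a))"
    using Landau_inequality_mahler_measure[of f] by simp
  also have "(\<Sum>a\<leftarrow>coeffs f. a * a) = (\<Sum>i\<le>n. poly.coeff f i * poly.coeff f i)"
  proof -
    have "f \<noteq> 0" using monic_f by auto
    hence "coeffs f = map (poly.coeff f) [0..<Suc n]" by (simp add: coeffs_def degree_f)
    hence "(\<Sum>a\<leftarrow>coeffs f. a * a) = (\<Sum>i\<leftarrow>[0..<Suc n]. poly.coeff f i * poly.coeff f i)"
      by (simp only: map_map comp_def)
    also have "\<dots> = (\<Sum>i\<in>set [0..<Suc n]. poly.coeff f i * poly.coeff f i)"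
      by (rule sum.distinct_set_conv_list[symmetric]) simp
    also have "set [0..<Suc n] = {..n}" by auto
    finally show ?thesis .
  qed
  also have "sqrt (real_of_int (\<Sum>i\<le>n. poly.coeff f i * poly.coeff f i)) \<le> sqrt (((real n + 1) * B) ^ 2)"
  proof (rule real_sqrt_le_mono)
    have "real_of_int (poly.coeff f i * poly.coeff f i) \<le> B ^ 2" if "i \<le> n" for i
    proof -
      have "\<bar>poly.coeff f i\<bar> \<le> poly_height f"
        unfolding poly_height_def using that degree_f by (intro Max_ge) auto
      hence "\<bar>real_of_int (poly.coeff f i)\<bar> \<le> B" using assms(1) by linarith
      hence "\<bar>real_of_int (poly.coeff f i)\<bar> ^ 2 \<le> B ^ 2" by (intro power_mono) auto
      thus ?thesis by (simp add: power2_eq_square)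
    qed
    hence "real_of_int (\<Sum>i\<le>n. poly.coeff f i * poly.coeff f i) \<le> (\<Sum>i\<le>n. B ^ 2)"
      unfolding of_int_sum by (intro sum_mono) auto
    also have "\<dots> = (real n + 1) * 1 * B ^ 2" by simp
    also have "\<dots> \<le> (real n + 1) * (real n + 1) * B ^ 2"
      by (intro mult_right_mono mult_left_mono) auto
    finally show "real_of_int (\<Sum>i\<le>n. poly.coeff f i * poly.coeff f i) \<le> ((real n + 1) * B) ^ 2"
      by (simp add: power2_eq_square algebra_simps)
  qed
  also have "\<dots> = (real n + 1) * B" using assms(2) by simp
  finally show ?thesis .
qed

end

text \<open>Polynomials with isomorphic root fields are to be counted inside one of these fields.
  The image of \<alpha>' generates that field and is again a root of f', and its conjugates are
  distinct roots of f', so the Mahler measure of f' controls them.\<close>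

lemma transport_root:
  assumes A: "galois_root n f G \<beta> \<alpha>" and B: "galois_root n f' G \<beta>' \<alpha>'"
    and iso: "\<phi> \<in> ring_iso (subring_of (root_field.K \<alpha>')) (subring_of (root_field.K \<alpha>))"
  defines "conjg \<equiv> root_field.conjg \<alpha>"
  shows "\<phi> \<alpha>' \<in> root_field.OK \<alpha>" "\<phi> \<alpha>' \<in> complex_roots f'"
    "inj_on (\<lambda>z. conjg z (\<phi> \<alpha>')) (complex_roots f)"
    "(\<Prod>z\<in>complex_roots f. max 1 (cmod (conjg z (\<phi> \<alpha>')))) \<le> (\<Prod>w\<in>complex_roots f'. max 1 (cmod w))"
proof -
  interpret A: galois_root n f G \<beta> \<alpha> by (rule A)
  interpret B: galois_root n f' G \<beta>' \<alpha>' by (rule B)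
  have hom: "\<phi> \<in> Ring.ring_hom (subring_of B.K) (subring_of A.K)"
    and bij: "bij_betw \<phi> B.K A.K" using iso by (auto simp: ring_iso_def)
  note ev = hom_rat_eval[OF B.subfield_K hom B.\<alpha>_K]
  define b where "b = \<phi> \<alpha>'"
  have bK: "b \<in> A.K" using subring_of_homD(1)[OF hom B.\<alpha>_K] by (simp add: b_def)
  have "rat_eval B.F b = \<phi> (rat_eval B.F \<alpha>')" by (simp only: ev b_def)
  also have "rat_eval B.F \<alpha>' = rat_eval 0 \<alpha>'" using B.\<alpha>_root by (simp add: complex_roots_eq)
  also have "\<phi> \<dots> = 0" using ev[of 0] by simp
  finally have b0: "rat_eval B.F b = 0" .
  thus root: "\<phi> \<alpha>' \<in> complex_roots f'" by (simp add: complex_roots_eq b_def)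
  show OK: "\<phi> \<alpha>' \<in> A.OK" using B.root_algebraic_int[OF root] bK by (simp add: A.OK_iff b_def)
  obtain p where p: "b = rat_eval p \<alpha>" using A.KE[OF bK] .
  \<comment> \<open>Surjectivity of \<phi> writes \<alpha> as a polynomial in b. A conjugate of b
    therefore determines the root it comes from, whence the injectivity below.\<close>
  obtain q where q: "\<alpha> = rat_eval q b"
  proof -
    obtain y where "y \<in> B.K" "\<phi> y = \<alpha>"
      using bij_betw_imp_surj_on[OF bij] A.\<alpha>_K by (metis imageE)
    then obtain q where "y = rat_eval q \<alpha>'" using B.KE by blast
    hence "\<alpha> = rat_eval q b" using \<open>\<phi> y = \<alpha>\<close> ev by (simp add: b_def)
    thus ?thesis using that by blast
  qed
  have comp: "rat_eval (pcompose r p) z = rat_eval r (rat_eval p z)" for r z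
    unfolding rat_eval_def by (simp add: of_rat_hom.map_poly_pcompose poly_pcompose)
  have transfer: "rat_eval r (A.conjg z b) = A.conjg z (rat_eval r b)" if "z \<in> A.R" for r z
    using that A.conjg_rat_eval[of z "pcompose r p"] by (simp add: comp p A.conjg_rat_eval[OF that])
  show inj: "inj_on (\<lambda>z. conjg z (\<phi> \<alpha>')) A.R"
  proof (rule inj_onI)
    fix z w assume zw: "z \<in> A.R" "w \<in> A.R" "conjg z (\<phi> \<alpha>') = conjg w (\<phi> \<alpha>')"
    have "z = A.conjg z \<alpha>" using zw A.conjg_\<alpha> by simp
    also have "\<dots> = rat_eval q (A.conjg z b)" using transfer[OF zw(1)] q by simp
    also have "\<dots> = rat_eval q (A.conjg w b)" using zw(3) by (simp add: conjg_def b_def)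
    also have "\<dots> = A.conjg w \<alpha>" using transfer[OF zw(2)] q by simp
    also have "\<dots> = w" using zw A.conjg_\<alpha> by simp
    finally show "z = w" .
  qed
  have sub: "(\<lambda>z. conjg z (\<phi> \<alpha>')) ` A.R \<subseteq> B.R"
    using transfer[of _ B.F] b0 by (auto simp: complex_roots_eq[of f'] conjg_def b_def A.conjg_simps)
  have "(\<Prod>z\<in>A.R. max 1 (cmod (conjg z (\<phi> \<alpha>')))) = (\<Prod>w\<in>(\<lambda>z. conjg z (\<phi> \<alpha>')) ` A.R. max 1 (cmod w))"
    by (simp add: prod.reindex[OF inj])
  also have "\<dots> \<le> (\<Prod>w\<in>B.R. max 1 (cmod w))"
    by (rule prod_mono2[OF B.finite_R sub]) auto
  finally show "(\<Prod>z\<in>A.R. max 1 (cmod (conjg z (\<phi> \<alpha>')))) \<le> (\<Prod>w\<in>B.R. max 1 (cmod w))" .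
qed

text \<open>A counted polynomial is the minimal polynomial of each of its roots. Hence an integer
  transported from f determines f, and counting integers bounds the number of polynomials.\<close>

lemma monic_irreducible_common_root:
  assumes A: "galois_poly n f G \<beta>" and B: "galois_poly n f' G \<beta>'"
    and z: "z \<in> complex_roots f" "z \<in> complex_roots f'"
  shows "f = f'"
proof -
  interpret A: galois_root n f G \<beta> z
    using A z by (simp add: galois_root_def galois_root_axioms_def)
  interpret B: galois_poly n f' G \<beta>' by (rule B)
  have "rat_eval B.F z = 0" using z by (simp add: complex_roots_eq)
  hence "A.F dvd B.F" using A.rat_eval_eq_0_iff[OF A.\<alpha>] by simp
  then obtain q where q: "B.F = A.F * q" by (auto elim: dvdE)
  have nz: "B.F \<noteq> 0" using B.irreducible_F by auto
  hence q0: "q \<noteq> 0" using q by auto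
  have "Polynomial.degree q = 0"
    using degree_mult_eq[OF A.F_nz q0] A.degree_rat B.degree_rat q by simp
  then obtain c where c: "q = [:c:]" by (elim degree_eq_zeroE)
  have "lead_coeff B.F = lead_coeff A.F * c" using q c by (simp add: lead_coeff_mult)
  hence "c = 1" using A.monic_rat B.monic_rat by simp
  hence "B.F = A.F" using q c by simp
  thus ?thesis by (auto simp: poly_eq_iff)
qed

section \<open>Summation over number fields\<close>

locale transitive_group =
  fixes n :: nat and G :: "(nat \<Rightarrow> nat) set"
  assumes n2: "n \<ge> 2" and trans: "transitive_perm_group n G"
begin

text \<open>An arbitrary but fixed choice: each polynomial is assigned a single field, and the count
  runs over the isomorphism classes of these fields.\<close>

definition root :: "int poly \<Rightarrow> complex" where "root f = (SOME z. z \<in> complex_roots f)"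

definition fld :: "int poly \<Rightarrow> complex set" where "fld f = root_field.K (root f)"

definition fld_disc :: "int poly \<Rightarrow> real" where "fld_disc f = real_of_int \<bar>discriminant (fld f)\<bar>"

lemma galois_rootE:
  assumes "f \<in> galois_polys n B G"
  obtains \<beta> where "galois_root n f G \<beta> (root f)"
proof -
  obtain \<beta> where \<beta>: "galois_poly n f G \<beta>" using galois_polysE[OF assms _ trans] n2 by force
  interpret galois_poly n f G \<beta> by (rule \<beta>)
  have "\<beta> 1 \<in> complex_roots f" using \<beta>_R n_pos' by simp
  hence "root f \<in> complex_roots f" unfolding root_def by (rule someI)
  hence "galois_root n f G \<beta> (root f)" by unfold_locales
  thus ?thesis by (rule that)
qed

lemma fld_disc_ge_1: "f \<in> galois_polys n B G \<Longrightarrow> 1 \<le> fld_disc f"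
proof -
  assume "f \<in> galois_polys n B G"
  then obtain \<beta> where \<beta>: "galois_root n f G \<beta> (root f)" by (rule galois_rootE)
  interpret galois_root n f G \<beta> "root f" by (rule \<beta>)
  have "\<bar>discriminant K\<bar> \<ge> 1" using discriminant_nonzero[OF \<alpha>_OK] by linarith
  thus ?thesis unfolding fld_disc_def fld_def by linarith
qed

lemma prod_complex_roots_le:
  assumes "f \<in> galois_polys n B G" "B \<ge> 0"
  shows "(\<Prod>z\<in>complex_roots f. max 1 (cmod z)) \<le> (real n + 1) * B"
proof -
  obtain \<beta> where \<beta>: "galois_root n f G \<beta> (root f)" using assms(1) by (rule galois_rootE)
  interpret galois_root n f G \<beta> "root f" by (rule \<beta>)
  show ?thesis by (rule prod_roots_le) (use assms in \<open>auto simp: galois_polys_def\<close>)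
qed

lemma fld_disc_le:
  assumes "f \<in> galois_polys n B G" "B \<ge> 0"
  shows "fld_disc f \<le> (fact n) ^ 2 * ((real n + 1) * B) ^ (2 * (n - 1))"
proof -
  obtain \<beta> where \<beta>: "galois_root n f G \<beta> (root f)" using assms(1) by (rule galois_rootE)
  interpret galois_root n f G \<beta> "root f" by (rule \<beta>)
  have "fld_disc f \<le> (fact n) ^ 2 * (\<Prod>z\<in>complex_roots f. max 1 (cmod z)) ^ (2 * (n - 1))"
    unfolding fld_disc_def fld_def by (rule discriminant_le_mahler[OF \<alpha>_OK])
  also have "\<dots> \<le> (fact n) ^ 2 * ((real n + 1) * B) ^ (2 * (n - 1))"
    using prod_complex_roots_le[OF assms]
    by (intro mult_left_mono power_mono prod_nonneg) auto
  finally show ?thesis .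
qed

text \<open>Each f is sent to the image of its chosen root under an isomorphism onto the field of
  f0. The image is again a root of f, so this map is injective and trades polynomials for integers
  of one field.\<close>

lemma isomorphic_generators:
  assumes f0: "f0 \<in> galois_polys n B G" and B: "B \<ge> 0" and A: "A \<subseteq> galois_polys n B G"
    and iso: "\<And>f. f \<in> A \<Longrightarrow> subring_of (fld f) \<simeq> subring_of (fld f0)"
  shows "\<exists>Y. finite Y \<and> card Y = card A \<and> Y \<subseteq> root_field.OK (root f0) \<and>
    (\<forall>x\<in>Y. inj_on (\<lambda>z. root_field.conjg (root f0) z x) (complex_roots f0) \<and>
      (\<Prod>z\<in>complex_roots f0. max 1 (cmod (root_field.conjg (root f0) z x))) \<le> (real n + 1) * B)"
proof -
  obtain \<beta>0 where \<beta>0: "galois_root n f0 G \<beta>0 (root f0)" using f0 by (rule galois_rootE)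
  have "\<forall>f\<in>A. \<exists>\<phi>. \<phi> \<in> ring_iso (subring_of (fld f)) (subring_of (fld f0))"
    using iso unfolding is_ring_iso_def by blast
  then obtain \<phi> where \<phi>: "\<And>f. f \<in> A \<Longrightarrow> \<phi> f \<in> ring_iso (subring_of (fld f)) (subring_of (fld f0))"
    by metis
  define b where "b f = \<phi> f (root f)" for f
  have b: "b f \<in> root_field.OK (root f0)" "b f \<in> complex_roots f"
    "inj_on (\<lambda>z. root_field.conjg (root f0) z (b f)) (complex_roots f0)"
    "(\<Prod>z\<in>complex_roots f0. max 1 (cmod (root_field.conjg (root f0) z (b f)))) \<le> (real n + 1) * B"
    if f: "f \<in> A" for f
  proof -
    have fS: "f \<in> galois_polys n B G" using f A by blast
    then obtain \<beta> where \<beta>: "galois_root n f G \<beta> (root f)" by (rule galois_rootE)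
    note t = transport_root[OF \<beta>0 \<beta> \<phi>[OF f, unfolded fld_def]]
    show "b f \<in> root_field.OK (root f0)" "b f \<in> complex_roots f"
      "inj_on (\<lambda>z. root_field.conjg (root f0) z (b f)) (complex_roots f0)"
      using t(1-3) by (simp_all add: b_def)
    show "(\<Prod>z\<in>complex_roots f0. max 1 (cmod (root_field.conjg (root f0) z (b f)))) \<le> (real n + 1) * B"
      using t(4) prod_complex_roots_le[OF fS B] by (simp add: b_def)
  qed
  have "inj_on b A"
  proof (rule inj_onI)
    fix f g assume f: "f \<in> A" and g: "g \<in> A" and eq: "b f = b g"
    have "f \<in> galois_polys n B G" "g \<in> galois_polys n B G" using f g A by auto
    then obtain \<beta>f \<beta>g where "galois_root n f G \<beta>f (root f)" "galois_root n g G \<beta>g (root g)"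
      by (metis galois_rootE)
    hence "galois_poly n f G \<beta>f" "galois_poly n g G \<beta>g" by (simp_all add: galois_root_def)
    thus "f = g" using b(2)[OF f] b(2)[OF g] eq by (metis monic_irreducible_common_root)
  qed
  show ?thesis
  proof (intro exI[of _ "b ` A"] conjI)
    show "finite (b ` A)" using A finite_galois_polys finite_subset by blast
    show "card (b ` A) = card A" by (rule card_image) fact
  qed (use b in auto)
qed

lemma card_isomorphic:
  assumes f0: "f0 \<in> galois_polys n B G" and B: "B \<ge> 1" and A: "A \<subseteq> galois_polys n B G"
    and iso: "\<And>f. f \<in> A \<Longrightarrow> subring_of (fld f) \<simeq> subring_of (fld f0)"
  defines "M \<equiv> (real n + 1) * B"
  shows "real (card A) \<le> 32 ^ n * M * (log 2 M + 1) ^ (n - 1)"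
    and "primitive_perm_group n G \<Longrightarrow> real (card A) \<le>
      count_const n * M / fld_disc f0 powr (1 / real (n * (n - 1))) * (log 2 M + 1) ^ (n - 1)"
proof -
  obtain \<beta>0 where \<beta>0: "galois_root n f0 G \<beta>0 (root f0)" using f0 by (rule galois_rootE)
  interpret galois_root n f0 G \<beta>0 "root f0" by (rule \<beta>0)
  have "1 * 1 \<le> (real n + 1) * B" using B by (intro mult_mono) auto
  hence M: "M \<ge> 1" by (simp add: M_def)
  have B0: "B \<ge> 0" using B by simp
  have "\<exists>Y. finite Y \<and> card Y = card A \<and> Y \<subseteq> OK \<and> (\<forall>x\<in>Y. inj_on (\<lambda>z. conjg z x) (complex_roots f0) \<and>
      (\<Prod>z\<in>complex_roots f0. max 1 (cmod (conjg z x))) \<le> M)"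
    unfolding M_def by (rule isomorphic_generators[OF f0 B0 A]) (rule iso)
  then obtain Y where Y: "finite Y" "card Y = card A" "Y \<subseteq> OK"
    "\<And>x. x \<in> Y \<Longrightarrow> inj_on (\<lambda>z. conjg z x) (complex_roots f0)"
    "\<And>x. x \<in> Y \<Longrightarrow> (\<Prod>z\<in>complex_roots f0. max 1 (cmod (conjg z x))) \<le> M"
    by blast
  show "real (card A) \<le> 32 ^ n * M * (log 2 M + 1) ^ (n - 1)"
    using card_bounded_conjugates[OF \<alpha>_OK Y(1,3) M Y(5)] by (simp add: Y(2))
  show "real (card A) \<le> count_const n * M / fld_disc f0 powr (1 / real (n * (n - 1))) * (log 2 M + 1) ^ (n - 1)"
    if "primitive_perm_group n G"
    using card_bounded_conjugates_primitive[OF \<alpha>_OK Y(1,3) M n2 Y(5) Y(4) primitive_conjugates[OF that]]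
    by (simp add: Y(2) fld_disc_def fld_def)
qed

text \<open>The bound per class is a hypothesis and S is arbitrary, so that the same argument serves
  all polynomials at once and a dyadic slice on which the bound depends on the discriminant.\<close>

lemma card_le_classes:
  assumes S: "S \<subseteq> galois_polys n B G" and D: "\<And>f. f \<in> S \<Longrightarrow> fld_disc f \<le> D"
    and fin: "finite (galois_field_classes n D G)" and q: "q \<ge> 0"
    and fib: "\<And>f0 A. f0 \<in> S \<Longrightarrow> A \<subseteq> S \<Longrightarrow> (\<And>f. f \<in> A \<Longrightarrow> subring_of (fld f) \<simeq> subring_of (fld f0)) \<Longrightarrow>
      real (card A) \<le> q"
  shows "real (card S) \<le> q * real (card (galois_field_classes n D G))"
proof -
  define r where "r = {(K, K'). K \<in> galois_fields n D G \<and> K' \<in> galois_fields n D G \<and>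
                 subring_of K \<simeq> subring_of K'}"
  define h where "h f = r `` {fld f}" for f
  have finS: "finite S" using S finite_galois_polys finite_subset by blast
  have mem: "fld f \<in> galois_fields n D G" if f: "f \<in> S" for f
  proof -
    have "f \<in> galois_polys n B G" using S f by blast
    then obtain \<beta> where \<beta>: "galois_root n f G \<beta> (root f)" by (rule galois_rootE)
    interpret galois_root n f G \<beta> "root f" by (rule \<beta>)
    show ?thesis using galois_fields_K[of D] D[OF f] by (simp add: fld_disc_def fld_def)
  qed
  have "real (card {f \<in> S. h f = c}) \<le> q" if c: "c \<in> h ` S" for c
  proof -
    obtain f0 where f0: "f0 \<in> S" "c = h f0" using c by blast
    have "subring_of (fld f) \<simeq> subring_of (fld f0)" if f: "f \<in> {f \<in> S. h f = c}" for f
    proof -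
      \<comment> \<open>Reflexivity places \<open>fld f0\<close> in its own class, hence in the
        equal class of f; membership there is the isomorphism.\<close>
      have "(fld f0, fld f0) \<in> r" using mem[OF f0(1)] by (simp add: r_def ring_iso_refl)
      hence "fld f0 \<in> h f" using f f0 by (simp add: h_def)
      thus ?thesis by (simp add: h_def r_def)
    qed
    thus ?thesis by (intro fib[OF f0(1)]) auto
  qed
  hence "real (card S) \<le> q * real (card (h ` S))" by (rule card_le_fibres[OF finS])
  also have "h ` S \<subseteq> galois_field_classes n D G"
    using mem unfolding galois_field_classes_def r_def[symmetric] h_def by (auto intro: quotientI)
  hence "q * real (card (h ` S)) \<le> q * real (card (galois_field_classes n D G))"
    using q card_mono[OF fin] by (intro mult_left_mono) auto
  finally show ?thesis .
qed

end

text \<open>A real upper bound rules out the value infinity, so the finiteness of the set of classes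
  comes from the hypothesis on \<open>N_count\<close>.\<close>

lemma N_count_le:
  assumes "ereal_of_enat (N_count n D G) \<le> ereal x"
  shows "finite (galois_field_classes n D G)" "real (card (galois_field_classes n D G)) \<le> x"
  using assms by (auto simp: N_count_def split: if_splits)

text \<open>For B >= 2 the logarithm is at least ln 2, which lets additive constants be absorbed
  into a multiple of ln B.\<close>

lemma log_le_ln:
  assumes "B \<ge> 2" "a \<ge> 1"
  shows "log 2 (a * B) + 1 \<le> (1 / ln 2 + (log 2 a + 1) / ln 2) * ln B"
proof -
  have "ln 2 \<le> ln B" using assms by simp
  hence "1 \<le> ln B / ln 2" by simp
  hence "(log 2 a + 1) * 1 \<le> (log 2 a + 1) * (ln B / ln 2)"
    using assms by (intro mult_left_mono) auto
  moreover have "log 2 (a * B) = log 2 a + ln B / ln 2"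
    using assms by (simp add: log_mult) (simp add: log_def)
  ultimately show ?thesis by (simp add: algebra_simps)
qed

section \<open>The two bounds under the hypothesis on the number of fields\<close>

locale field_count_bound = transitive_group +
  fixes e C D0 :: real
  assumes e: "e > 1 / (real n ^ 2 - real n)" and C: "C > 0"
    and N_bound: "\<And>D. D \<ge> D0 \<Longrightarrow> ereal_of_enat (N_count n D G) \<le> ereal (C * D powr e)"
begin

text \<open>The exponent with which the discriminant enters the saving of the primitive
  case.\<close>

definition \<delta> :: real where "\<delta> = 1 / real (n * (n - 1))"

lemma \<delta>: "0 < \<delta>" "\<delta> < e" "(2 * real n - 2) * \<delta> = 2 / real n"
proof -
  have 1: "real (n * (n - 1)) = real n * (real n - 1)" using n2 by (simp add: of_nat_diff)
  show "0 < \<delta>" using n2 by (simp add: \<delta>_def)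
  show "\<delta> < e" using e unfolding \<delta>_def 1 by (simp add: power2_eq_square algebra_simps)
  show "(2 * real n - 2) * \<delta> = 2 / real n" unfolding \<delta>_def 1 using n2 by (simp add: field_simps)
qed

text \<open>The last entry is the constant in the bound for the discriminants; D0 and 1 bring every
  D1 Z with Z >= 1 into the range of the hypothesis and keep its logarithm nonnegative.\<close>

definition D1 :: real where "D1 = max (max 1 D0) ((fact n) ^ 2 * (real n + 1) ^ (2 * (n - 1)))"

lemma D1: "D1 \<ge> 1" "D1 \<ge> D0" by (auto simp: D1_def)

lemma fld_disc_le_D1:
  assumes f: "f \<in> galois_polys n B G" and B: "B \<ge> 1"
  shows "fld_disc f \<le> D1 * B powr (2 * real n - 2)"
proof -
  have "fld_disc f \<le> ((fact n) ^ 2 * (real n + 1) ^ (2 * (n - 1))) * B ^ (2 * (n - 1))"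
    using fld_disc_le[OF f] B by (simp add: power_mult_distrib mult.assoc)
  also have "\<dots> \<le> D1 * B ^ (2 * (n - 1))"
    using B by (intro mult_right_mono) (auto simp: D1_def)
  also have "B ^ (2 * (n - 1)) = B powr (real (2 * (n - 1)))" by (rule powr_realpow[symmetric]) (use B in simp)
  also have "real (2 * (n - 1)) = 2 * real n - 2" using n2 by (simp add: of_nat_diff)
  finally show ?thesis .
qed

definition c_log :: real where "c_log = 1 / ln 2 + (log 2 (real n + 1) + 1) / ln 2"

lemma log_power_le:
  assumes "B \<ge> 2"
  shows "(log 2 ((real n + 1) * B) + 1) ^ (n - 1) \<le> c_log ^ (n - 1) * ln B ^ (n - 1)"
proof -
  have "1 * 1 \<le> (real n + 1) * B" using assms by (intro mult_mono) auto
  hence "0 \<le> log 2 ((real n + 1) * B) + 1" by simp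
  hence "(log 2 ((real n + 1) * B) + 1) ^ (n - 1) \<le> (c_log * ln B) ^ (n - 1)"
    unfolding c_log_def using log_le_ln[OF assms, of "real n + 1"] by (intro power_mono) auto
  thus ?thesis by (simp add: power_mult_distrib)
qed

text \<open>Z is B^(2n-2) in the first bound and a power of 2 in the second. The factor D1 brings
  even small Z into the range where the hypothesis applies.\<close>

lemma classes_bound:
  assumes "Z \<ge> 1"
  shows "finite (galois_field_classes n (D1 * Z) G)"
    "real (card (galois_field_classes n (D1 * Z) G)) \<le> C * D1 powr e * Z powr e"
proof -
  have "D1 * 1 \<le> D1 * Z" using D1 assms by (intro mult_left_mono) auto
  hence "D1 * Z \<ge> D0" using D1 by linarith
  note * = N_count_le[OF N_bound[OF this]]
  show "finite (galois_field_classes n (D1 * Z) G)" by (rule *(1))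
  show "real (card (galois_field_classes n (D1 * Z) G)) \<le> C * D1 powr e * Z powr e"
    using *(2) D1 assms by (simp add: powr_mult mult.assoc)
qed

theorem P_count_le:
  assumes B: "B \<ge> 2"
  shows "real (P_count n B G) \<le>
    (32 ^ n * (real n + 1) * c_log ^ (n - 1) * (C * D1 powr e)) * B powr (e * (2 * real n - 2) + 1) * ln B ^ (n - 1)"
proof -
  define M where "M = (real n + 1) * B"
  define q where "q = 32 ^ n * M * (log 2 M + 1) ^ (n - 1)"
  define Z where "Z = B powr (2 * real n - 2)"
  have "1 * 1 \<le> (real n + 1) * B" using B by (intro mult_mono) auto
  hence M: "M \<ge> 1" by (simp add: M_def)
  have Z1: "Z \<ge> 1" unfolding Z_def using B n2 by (intro ge_one_powr_ge_zero) auto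
  have q0: "q \<ge> 0" using M by (simp add: q_def)
  have "real (card (galois_polys n B G)) \<le> q * real (card (galois_field_classes n (D1 * Z) G))"
  proof (rule card_le_classes[OF subset_refl _ classes_bound(1)[OF Z1] q0])
    show "fld_disc f \<le> D1 * Z" if "f \<in> galois_polys n B G" for f
      unfolding Z_def using B that by (intro fld_disc_le_D1) auto
    show "real (card A) \<le> q" if "f0 \<in> galois_polys n B G" "A \<subseteq> galois_polys n B G"
      "\<And>f. f \<in> A \<Longrightarrow> subring_of (fld f) \<simeq> subring_of (fld f0)" for f0 A
      unfolding q_def M_def using B by (intro card_isomorphic(1)[OF that(1) _ that(2,3)]) auto
  qed
  also have "\<dots> \<le> q * (C * D1 powr e * Z powr e)"
    using q0 classes_bound(2)[OF Z1] by (rule mult_left_mono[rotated])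
  also have "\<dots> \<le> 32 ^ n * M * (c_log ^ (n - 1) * ln B ^ (n - 1)) * (C * D1 powr e * Z powr e)"
    unfolding q_def M_def using log_power_le[OF B] B C
    by (intro mult_right_mono mult_left_mono) auto
  also have "Z powr e = B powr (e * (2 * real n - 2))" by (simp add: Z_def powr_powr mult.commute)
  also have "32 ^ n * M * (c_log ^ (n - 1) * ln B ^ (n - 1)) * (C * D1 powr e * B powr (e * (2 * real n - 2))) =
      (32 ^ n * (real n + 1) * c_log ^ (n - 1) * (C * D1 powr e)) * B powr (e * (2 * real n - 2) + 1) * ln B ^ (n - 1)"
    using B by (simp add: M_def powr_add)
  finally show ?thesis by (simp add: P_count_def)
qed

text \<open>From one dyadic level to the next the bound for the number of fields grows by 2^e and
  the saving by 2^\<delta>; this is the quotient.\<close>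

definition ratio :: real where "ratio = 2 powr (e - \<delta>)"

lemma ratio: "ratio > 1" unfolding ratio_def using \<delta> by (intro gr_one_powr) auto

text \<open>The fields are grouped dyadically by discriminant; since \<open>e > \<delta>\<close>, the resulting geometric
  sum is dominated by its last term.\<close>

theorem P_count_le_primitive:
  assumes B: "B \<ge> 2" and prim: "primitive_perm_group n G"
  shows "real (P_count n B G) \<le>
    (count_const n * (real n + 1) * c_log ^ (n - 1) * (C * D1 powr e * 2 powr e) * (ratio / (ratio - 1) * D1 powr (e - \<delta>)))
     * B powr (e * (2 * real n - 2) + 1 - 2 / real n) * ln B ^ (n - 1)"
proof -
  define M where "M = (real n + 1) * B"
  define q where "q = count_const n * M * (log 2 M + 1) ^ (n - 1)"
  define Z where "Z = B powr (2 * real n - 2)"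
  define S where "S = galois_polys n B G"
  define lev where "lev f = nat \<lfloor>log 2 (fld_disc f)\<rfloor>" for f
  define m where "m = nat \<lfloor>log 2 (D1 * Z)\<rfloor>"
  have "1 * 1 \<le> (real n + 1) * B" using B by (intro mult_mono) auto
  hence M: "M \<ge> 1" by (simp add: M_def)
  have Z1: "Z \<ge> 1" unfolding Z_def using B n2 by (intro ge_one_powr_ge_zero) auto
  have DZ: "D1 * Z \<ge> 1" using mult_mono[of 1 D1 1 Z] D1 Z1 by simp
  have cc: "count_const n \<ge> 0" by (simp add: count_const_def kappa_def)
  have q0: "q \<ge> 0" using M cc by (simp add: q_def)
  have finS: "finite S" unfolding S_def by (rule finite_galois_polys)
  have lev: "2 ^ lev f \<le> fld_disc f" "fld_disc f \<le> 2 ^ (lev f + 1)" "lev f \<le> m" if f: "f \<in> S" for f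
  proof -
    have d1: "fld_disc f \<ge> 1" using f fld_disc_ge_1 by (simp add: S_def)
    have "log 2 (fld_disc f) \<ge> 0" using d1 by simp
    hence "real (lev f) \<le> log 2 (fld_disc f)" "log 2 (fld_disc f) \<le> real (lev f + 1)"
      unfolding lev_def by linarith+
    thus "2 ^ lev f \<le> fld_disc f" "fld_disc f \<le> 2 ^ (lev f + 1)"
      using d1 by (simp_all only: le_log_iff[of 2 "fld_disc f"] log_le_iff[of 2 "fld_disc f"] powr_realpow[symmetric])
    have "fld_disc f \<le> D1 * Z" unfolding Z_def using B f by (intro fld_disc_le_D1) (auto simp: S_def)
    hence "log 2 (fld_disc f) \<le> log 2 (D1 * Z)" using d1 DZ by (subst log_le_cancel_iff) auto
    thus "lev f \<le> m" unfolding lev_def m_def by (intro nat_mono floor_mono)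
  qed
  have level: "real (card {f \<in> S. lev f = k}) \<le> q * (C * D1 powr e * 2 powr e) * ratio ^ k" for k
  proof -
    \<comment> \<open>On level k every discriminant is at least 2^k, which makes the bound for one
      class independent of the representative f0.\<close>
    define qk where "qk = q / (2 ^ k) powr \<delta>"
    have Zk: "(2::real) ^ (k + 1) \<ge> 1" by (rule one_le_power) simp
    have "real (card {f \<in> S. lev f = k}) \<le> qk * real (card (galois_field_classes n (D1 * 2 ^ (k + 1)) G))"
    proof (rule card_le_classes[OF _ _ classes_bound(1)[OF Zk]])
      show "{f \<in> S. lev f = k} \<subseteq> galois_polys n B G" by (auto simp: S_def)
      show "0 \<le> qk" using q0 by (simp add: qk_def)
      show "fld_disc f \<le> D1 * 2 ^ (k + 1)" if "f \<in> {f \<in> S. lev f = k}" for f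
      proof -
        have "fld_disc f \<le> 1 * 2 ^ (k + 1)" using lev(2)[of f] that by auto
        also have "\<dots> \<le> D1 * 2 ^ (k + 1)" using D1 by (intro mult_right_mono) auto
        finally show ?thesis .
      qed
      fix f0 A assume f0: "f0 \<in> {f \<in> S. lev f = k}" and A: "A \<subseteq> {f \<in> S. lev f = k}"
        and iso: "\<And>f. f \<in> A \<Longrightarrow> subring_of (fld f) \<simeq> subring_of (fld f0)"
      have "real (card A) \<le> count_const n * M / fld_disc f0 powr \<delta> * (log 2 M + 1) ^ (n - 1)"
        unfolding M_def \<delta>_def using f0 A B
        by (intro card_isomorphic(2)[OF _ _ _ iso prim]) (auto simp: S_def)
      also have "\<dots> = q / fld_disc f0 powr \<delta>" by (simp add: q_def)
      also have "\<dots> \<le> qk"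
      proof -
        have k: "2 ^ k \<le> fld_disc f0" using lev(1)[of f0] f0 by auto
        have "0 < (2 ^ k :: real)" by simp
        hence "0 < fld_disc f0" using k by linarith
        thus ?thesis
          unfolding qk_def using q0 k \<delta> by (intro divide_left_mono powr_mono2 mult_pos_pos) auto
      qed
      finally show "real (card A) \<le> qk" .
    qed
    also have "\<dots> \<le> qk * (C * D1 powr e * (2 ^ (k + 1)) powr e)"
      using classes_bound(2)[OF Zk] q0 by (intro mult_left_mono) (auto simp: qk_def)
    also have "\<dots> = q * (C * D1 powr e * 2 powr e) * ratio ^ k"
    proof -
      have "(2 ^ (k + 1)) powr e = 2 powr e * 2 powr (real k * e)"
        by (simp add: powr_realpow[symmetric] powr_powr powr_mult powr_add)
      moreover have "ratio ^ k = 2 powr (real k * e) / (2 ^ k) powr \<delta>"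
        by (simp add: ratio_def powr_realpow[symmetric] powr_powr powr_diff[symmetric] algebra_simps)
      ultimately show ?thesis by (simp add: qk_def)
    qed
    finally show ?thesis .
  qed
  have "real (card S) = (\<Sum>k\<in>lev ` S. real (card {f \<in> S. lev f = k}))"
    using sum.image_gen[OF finS, of "\<lambda>_. 1::real" lev] by simp
  also have "\<dots> \<le> (\<Sum>k\<in>{..m}. real (card {f \<in> S. lev f = k}))"
    using lev(3) by (intro sum_mono2) auto
  also have "\<dots> \<le> (\<Sum>k\<in>{..m}. q * (C * D1 powr e * 2 powr e) * ratio ^ k)"
    by (intro sum_mono level)
  also have "\<dots> = q * (C * D1 powr e * 2 powr e) * (\<Sum>k\<le>m. ratio ^ k)"
    by (simp add: sum_distrib_left)
  also have "\<dots> \<le> q * (C * D1 powr e * 2 powr e) * (ratio / (ratio - 1) * D1 powr (e - \<delta>) * Z powr (e - \<delta>))"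
  proof (rule mult_left_mono)
    \<comment> \<open>The sum is at most a constant times its last term, and 2^m is at most the
      bound D1 Z for all discriminants, so the dependence on m becomes a power of Z.\<close>
    have "(\<Sum>k\<le>m. ratio ^ k) = (ratio ^ Suc m - 1) / (ratio - 1)"
      using ratio geometric_sum[of ratio "Suc m"] by (simp add: lessThan_Suc_atMost)
    also have "\<dots> \<le> ratio ^ Suc m / (ratio - 1)" using ratio by (intro divide_right_mono) auto
    also have "ratio ^ Suc m = ratio * (2 powr real m) powr (e - \<delta>)"
      by (simp add: ratio_def powr_realpow[symmetric] powr_powr mult.commute)
    also have "(2 powr real m) powr (e - \<delta>) \<le> (D1 * Z) powr (e - \<delta>)"
    proof (rule powr_mono2)
      have "real m \<le> log 2 (D1 * Z)" unfolding m_def using DZ by simp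
      thus "2 powr real m \<le> D1 * Z" using DZ by (subst (asm) le_log_iff) auto
    qed (use \<delta> in auto)
    hence "ratio * (2 powr real m) powr (e - \<delta>) / (ratio - 1) \<le> ratio * (D1 * Z) powr (e - \<delta>) / (ratio - 1)"
      using ratio by (intro divide_right_mono mult_left_mono) auto
    also have "\<dots> = ratio / (ratio - 1) * D1 powr (e - \<delta>) * Z powr (e - \<delta>)"
      using D1 Z1 by (simp add: powr_mult)
    finally show "(\<Sum>k\<le>m. ratio ^ k) \<le> ratio / (ratio - 1) * D1 powr (e - \<delta>) * Z powr (e - \<delta>)" .
  qed (use q0 C in auto)
  also have "\<dots> \<le> count_const n * M * (c_log ^ (n - 1) * ln B ^ (n - 1)) *
      (C * D1 powr e * 2 powr e) * (ratio / (ratio - 1) * D1 powr (e - \<delta>) * Z powr (e - \<delta>))"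
    unfolding q_def M_def using log_power_le[OF B] B C cc ratio
    by (intro mult_right_mono mult_left_mono) auto
  \<comment> \<open>The identity (2n - 2) \<delta> = 2/n converts the saving in the discriminant
    into the exponent of B.\<close>
  also have "Z powr (e - \<delta>) = B powr (e * (2 * real n - 2) - 2 / real n)"
    by (simp add: Z_def powr_powr \<delta>(3)[symmetric] algebra_simps)
  also have "count_const n * M * (c_log ^ (n - 1) * ln B ^ (n - 1)) * (C * D1 powr e * 2 powr e) *
      (ratio / (ratio - 1) * D1 powr (e - \<delta>) * B powr (e * (2 * real n - 2) - 2 / real n)) =
    (count_const n * (real n + 1) * c_log ^ (n - 1) * (C * D1 powr e * 2 powr e) * (ratio / (ratio - 1) * D1 powr (e - \<delta>)))
     * (B powr (e * (2 * real n - 2) - 2 / real n) * B) * ln B ^ (n - 1)"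
    by (simp add: M_def)
  also have "B powr (e * (2 * real n - 2) - 2 / real n) * B = B powr (e * (2 * real n - 2) - 2 / real n + 1)"
    using B by (simp add: powr_add)
  also have "e * (2 * real n - 2) - 2 / real n + 1 = e * (2 * real n - 2) + 1 - 2 / real n" by simp
  finally show ?thesis by (simp add: P_count_def S_def)
qed

end

text \<open>Passing to \<open>max c 1\<close> gives positivity without inspecting the explicit
  constants.\<close>

lemma ex_positive_constant:
  assumes "\<And>B::real. B \<ge> 2 \<Longrightarrow> f B \<le> c * g B * h B" "\<And>B. B \<ge> 2 \<Longrightarrow> 0 \<le> g B * h B"
  shows "\<exists>c :: real. c > 0 \<and> (\<forall>B\<ge>2. f B \<le> c * g B * h B)"
proof (intro exI[of _ "max c 1"] conjI allI impI)
  fix B :: real assume B: "B \<ge> 2"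
  have "c * (g B * h B) \<le> max c 1 * (g B * h B)" using assms(2)[OF B] by (intro mult_right_mono) auto
  thus "f B \<le> max c 1 * g B * h B" using assms(1)[OF B] by (simp add: mult.assoc)
qed simp

theorem theorem1p3:
  fixes n :: nat and G :: "(nat \<Rightarrow> nat) set" and e :: real
  assumes "n \<ge> 2"
    and "subgroup G (sym_group n)"
    and "transitive_perm_group n G"
    and "e > 1 / (real n ^ 2 - real n)"
    and "\<exists>C D0 :: real. C > 0 \<and> D0 > 0 \<and>
           (\<forall>D\<ge>D0. ereal_of_enat (N_count n D G) \<le> ereal (C * D powr e))"
  shows "(\<exists>c :: real. c > 0 \<and>
            (\<forall>B\<ge>2. real (P_count n B G)
               \<le> c * B powr (e * (2 * real n - 2) + 1) * ln B ^ (n - 1))) \<and>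
         (primitive_perm_group n G \<longrightarrow>
           (\<exists>c' :: real. c' > 0 \<and>
            (\<forall>B\<ge>2. real (P_count n B G)
               \<le> c' * B powr (e * (2 * real n - 2) + 1 - 2 / real n) * ln B ^ (n - 1))))"
proof -
  obtain C D0 :: real where "C > 0" and
    "\<And>D. D \<ge> D0 \<Longrightarrow> ereal_of_enat (N_count n D G) \<le> ereal (C * D powr e)"
    using assms(5) by blast
  then interpret field_count_bound n G e C D0
    by unfold_locales (use assms in auto)
  show ?thesis
  proof (intro conjI impI)
    show "\<exists>c :: real. c > 0 \<and> (\<forall>B\<ge>2. real (P_count n B G)
               \<le> c * B powr (e * (2 * real n - 2) + 1) * ln B ^ (n - 1))"
      by (rule ex_positive_constant[where g = "\<lambda>B. B powr (e * (2 * real n - 2) + 1)"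
            and h = "\<lambda>B. ln B ^ (n - 1)", OF P_count_le]) simp_all
    show "\<exists>c' :: real. c' > 0 \<and> (\<forall>B\<ge>2. real (P_count n B G)
               \<le> c' * B powr (e * (2 * real n - 2) + 1 - 2 / real n) * ln B ^ (n - 1))"
      if "primitive_perm_group n G"
      by (rule ex_positive_constant[where g = "\<lambda>B. B powr (e * (2 * real n - 2) + 1 - 2 / real n)"
            and h = "\<lambda>B. ln B ^ (n - 1)", OF P_count_le_primitive[OF _ that]]) simp_all
  qed
qed

end
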